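(* Let $X=(M,J)$ be an almost complex manifold of real dimension $2n$ with a global frame $\{v_1,w_1,\dots,v_n,w_n\}$ of $TM$ such that $Jv_i=w_i$, $Jw_i=-v_i$ for all $i$. Let $\varphi^i=v^i+\sqrt{-1}\,w^i$, with $\{v^i,w^i\}$ the dual coframe, $\psi=\varphi^1\wedge\dots\wedge\varphi^n$, let $\lambda^i_{jk}$ be the smooth functions with $\bar\partial\varphi^i=\sum_{j,k=1}^n\lambda^i_{jk}\varphi^j\wedge\bar\varphi^k$, and let $\alpha=-\sum_{k=1}^n\alpha_k\bar\varphi^k$ with $\alpha_k=\sum_{i=1}^n\lambda^i_{ik}$. Let $m\ge1$ be an integer and $f:M\to\mathbb{C}$ a smooth function. Then the smooth pluricanonical section $f\cdot\psi^{\otimes m}$ of $\omega_X^{\otimes m}$ is pseudoholomorphic if and only if $$\bar\partial f+mf\alpha=0.$$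
   Context: $J$ need not be integrable. On forms, $\bar\partial$ is the component of $d$ mapping $(p,q)$-forms to $(p,q+1)$-forms. $\omega_X=\bigwedge^{n,0}X$. Identifying $\bigwedge^{n,1}X$ with $\bigwedge^{0,1}X\otimes\omega_X$ (via $\eta\wedge s\leftrightarrow\eta\otimes s$), $\bar\partial$ acts on sections of $\omega_X$ and is extended by the Leibniz rule to $\bar\partial:\Gamma(X,\omega_X^{\otimes m})\to\Gamma(X,\bigwedge^{0,1}X\otimes\omega_X^{\otimes m})$. A section $s$ of $\omega_X^{\otimes m}$ is pseudoholomorphic if $\bar\partial s=0$. *)

theory Defs
  imports "HOL-Analysis.Analysis"
begin

section \<open>Smooth manifolds\<close>

primrec Ck_on :: "nat \<Rightarrow> 'e::real_normed_vector set \<Rightarrow> ('e \<Rightarrow> 'b::real_normed_vector) \<Rightarrow> bool" where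
  "Ck_on 0 S f \<longleftrightarrow> continuous_on S f"
| "Ck_on (Suc k) S f \<longleftrightarrow> (\<forall>x\<in>S. f differentiable (at x)) \<and>
     (\<forall>v. Ck_on k S (\<lambda>x. frechet_derivative f (at x) v))"

definition smooth_on :: "'e::real_normed_vector set \<Rightarrow> ('e \<Rightarrow> 'b::real_normed_vector) \<Rightarrow> bool" where
  "smooth_on S f \<longleftrightarrow> (\<forall>k. Ck_on k S f)"

text \<open>An atlas is a set of charts \<open>(U, \<kappa>)\<close>; only the values of \<open>\<kappa>\<close> on \<open>U\<close> matter. The
  manifold is the whole type \<open>'a\<close>, and its dimension is that of the model space \<open>'e\<close>.\<close>

type_synonym ('a, 'e) atlas = "('a set \<times> ('a \<Rightarrow> 'e)) set"

definition smooth_manifold ::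
  "('a::{t2_space, second_countable_topology}, 'e::euclidean_space) atlas \<Rightarrow> bool" where
  "smooth_manifold A \<longleftrightarrow>
     (\<Union>(U, \<kappa>)\<in>A. U) = UNIV \<and>
     (\<forall>(U, \<kappa>)\<in>A. open U \<and> open (\<kappa> ` U) \<and> homeomorphism U (\<kappa> ` U) \<kappa> (inv_into U \<kappa>)) \<and>
     (\<forall>(U, \<kappa>)\<in>A. \<forall>(V, \<mu>)\<in>A. smooth_on (\<kappa> ` (U \<inter> V)) (\<lambda>x. \<mu> (inv_into U \<kappa> x)))"

definition smooth_fun ::
  "('a, 'e::euclidean_space) atlas \<Rightarrow> ('a \<Rightarrow> 'b::real_normed_vector) \<Rightarrow> bool" where
  "smooth_fun A f \<longleftrightarrow> (\<forall>(U, \<kappa>)\<in>A. smooth_on (\<kappa> ` U) (\<lambda>x. f (inv_into U \<kappa> x)))"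

section \<open>Tangent vectors, vector fields and almost complex structures\<close>

text \<open>A tangent vector at \<open>p\<close> is a derivation at \<open>p\<close> of the algebra of smooth real functions,
  extended by \<open>0\<close> to the non-smooth ones, so that equal tangent vectors are equal functions.\<close>

type_synonym 'a tvec = "('a \<Rightarrow> real) \<Rightarrow> real"
type_synonym 'a ctvec = "('a \<Rightarrow> real) \<Rightarrow> complex"

definition tangent :: "('a, 'e::euclidean_space) atlas \<Rightarrow> 'a \<Rightarrow> 'a tvec set" where
  "tangent A p = {D.
     (\<forall>g. \<not> smooth_fun A g \<longrightarrow> D g = 0) \<and>
     (\<forall>g h c. smooth_fun A g \<and> smooth_fun A h \<longrightarrow> D (\<lambda>x. g x + c * h x) = D g + c * D h) \<and>
     (\<forall>g h. smooth_fun A g \<and> smooth_fun A h \<longrightarrow> D (\<lambda>x. g x * h x) = g p * D h + h p * D g)}"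

definition vector_field :: "('a, 'e::euclidean_space) atlas \<Rightarrow> ('a \<Rightarrow> 'a tvec) \<Rightarrow> bool" where
  "vector_field A X \<longleftrightarrow> (\<forall>p. X p \<in> tangent A p) \<and>
     (\<forall>g. smooth_fun A g \<longrightarrow> smooth_fun A (\<lambda>p. X p g))"

definition almost_complex ::
  "('a, 'e::euclidean_space) atlas \<Rightarrow> ('a \<Rightarrow> 'a tvec \<Rightarrow> 'a tvec) \<Rightarrow> bool" where
  "almost_complex A J \<longleftrightarrow>
     (\<forall>p. \<forall>D\<in>tangent A p. J p D \<in> tangent A p \<and> J p (J p D) = (\<lambda>g. - D g) \<and>
        (\<forall>E\<in>tangent A p. \<forall>c. J p (\<lambda>g. D g + c * E g) = (\<lambda>g. J p D g + c * J p E g))) \<and>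
     (\<forall>X. vector_field A X \<longrightarrow> vector_field A (\<lambda>p. J p (X p)))"

definition global_frame ::
  "('a, 'e::euclidean_space) atlas \<Rightarrow> nat \<Rightarrow> (nat \<Rightarrow> 'a \<Rightarrow> 'a tvec) \<Rightarrow> (nat \<Rightarrow> 'a \<Rightarrow> 'a tvec) \<Rightarrow> bool" where
  "global_frame A n v w \<longleftrightarrow>
     (\<forall>i\<in>{1..n}. vector_field A (v i) \<and> vector_field A (w i)) \<and>
     (\<forall>p. (\<forall>a b. (\<forall>g. (\<Sum>i=1..n. a i * v i p g + b i * w i p g) = 0) \<longrightarrow>
              (\<forall>i\<in>{1..n}. a i = 0 \<and> b i = 0)) \<and>
          (\<forall>D\<in>tangent A p. \<exists>a b. D = (\<lambda>g. \<Sum>i=1..n. a i * v i p g + b i * w i p g)))"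

text \<open>The complexified tangent space: \<open>D + \<i> E\<close> acts on real functions with complex values.\<close>

definition cplx :: "'a tvec \<Rightarrow> 'a ctvec" where
  "cplx D = (\<lambda>g. of_real (D g))"

definition ctangent :: "('a, 'e::euclidean_space) atlas \<Rightarrow> 'a \<Rightarrow> 'a ctvec set" where
  "ctangent A p = {\<lambda>g. cplx D g + \<i> * cplx E g | D E. D \<in> tangent A p \<and> E \<in> tangent A p}"

definition conj_vec :: "'a ctvec \<Rightarrow> 'a ctvec" where
  "conj_vec Z = (\<lambda>g. cnj (Z g))"

definition cvector_field :: "('a, 'e::euclidean_space) atlas \<Rightarrow> ('a \<Rightarrow> 'a ctvec) \<Rightarrow> bool" where
  "cvector_field A X \<longleftrightarrow> (\<forall>p. X p \<in> ctangent A p) \<and>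
     (\<forall>g. smooth_fun A g \<longrightarrow> smooth_fun A (\<lambda>p. X p g))"

definition capply :: "('a \<Rightarrow> 'a ctvec) \<Rightarrow> ('a \<Rightarrow> complex) \<Rightarrow> 'a \<Rightarrow> complex" where
  "capply X h p = X p (\<lambda>q. Re (h q)) + \<i> * X p (\<lambda>q. Im (h q))"

definition lie_bracket :: "('a \<Rightarrow> 'a ctvec) \<Rightarrow> ('a \<Rightarrow> 'a ctvec) \<Rightarrow> 'a \<Rightarrow> 'a ctvec" where
  "lie_bracket X Y p = (\<lambda>g. capply X (\<lambda>q. Y q g) p - capply Y (\<lambda>q. X q g) p)"

definition cJ :: "('a \<Rightarrow> 'a tvec \<Rightarrow> 'a tvec) \<Rightarrow> 'a \<Rightarrow> 'a ctvec \<Rightarrow> 'a ctvec" where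
  "cJ J p Z = (\<lambda>g. cplx (J p (\<lambda>h. Re (Z h))) g + \<i> * cplx (J p (\<lambda>h. Im (Z h))) g)"

definition T10 ::
  "('a, 'e::euclidean_space) atlas \<Rightarrow> ('a \<Rightarrow> 'a tvec \<Rightarrow> 'a tvec) \<Rightarrow> 'a \<Rightarrow> 'a ctvec set" where
  "T10 A J p = {Z \<in> ctangent A p. cJ J p Z = (\<lambda>g. \<i> * Z g)}"

definition T01 ::
  "('a, 'e::euclidean_space) atlas \<Rightarrow> ('a \<Rightarrow> 'a tvec \<Rightarrow> 'a tvec) \<Rightarrow> 'a \<Rightarrow> 'a ctvec set" where
  "T01 A J p = {Z \<in> ctangent A p. cJ J p Z = (\<lambda>g. - \<i> * Z g)}"

definition proj10 :: "('a \<Rightarrow> 'a tvec \<Rightarrow> 'a tvec) \<Rightarrow> 'a \<Rightarrow> 'a ctvec \<Rightarrow> 'a ctvec" where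
  "proj10 J p Z = (\<lambda>g. (Z g - \<i> * cJ J p Z g) / 2)"

definition proj01 :: "('a \<Rightarrow> 'a tvec \<Rightarrow> 'a tvec) \<Rightarrow> 'a \<Rightarrow> 'a ctvec \<Rightarrow> 'a ctvec" where
  "proj01 J p Z = (\<lambda>g. (Z g + \<i> * cJ J p Z g) / 2)"

section \<open>Complex differential forms\<close>

text \<open>A complex \<open>k\<close>-covector at \<open>p\<close> is an alternating \<open>\<complex>\<close>-multilinear form on lists of \<open>k\<close>
  complexified tangent vectors at \<open>p\<close>. It is \<open>0\<close> on all other lists; equality of forms is
  thus equality of functions.\<close>

type_synonym 'a form = "'a \<Rightarrow> 'a ctvec list \<Rightarrow> complex"

definition covector ::
  "('a, 'e::euclidean_space) atlas \<Rightarrow> 'a \<Rightarrow> nat \<Rightarrow> ('a ctvec list \<Rightarrow> complex) \<Rightarrow> bool" where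
  "covector A p k \<theta> \<longleftrightarrow>
     (\<forall>xs. \<not> (length xs = k \<and> set xs \<subseteq> ctangent A p) \<longrightarrow> \<theta> xs = 0) \<and>
     (\<forall>xs i Y Z c. length xs = k \<and> set xs \<subseteq> ctangent A p \<and> i < k \<and>
        Y \<in> ctangent A p \<and> Z \<in> ctangent A p \<longrightarrow>
        \<theta> (xs[i := (\<lambda>g. Y g + c * Z g)]) = \<theta> (xs[i := Y]) + c * \<theta> (xs[i := Z])) \<and>
     (\<forall>xs i j. length xs = k \<and> set xs \<subseteq> ctangent A p \<and> i < j \<and> j < k \<and> xs ! i = xs ! j \<longrightarrow>
        \<theta> xs = 0)"

definition kform :: "('a, 'e::euclidean_space) atlas \<Rightarrow> nat \<Rightarrow> 'a form \<Rightarrow> bool" where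
  "kform A k \<omega> \<longleftrightarrow> (\<forall>p. covector A p k (\<omega> p)) \<and>
     (\<forall>Xs. (\<forall>X\<in>set Xs. cvector_field A X) \<longrightarrow> smooth_fun A (\<lambda>p. \<omega> p (map (\<lambda>X. X p) Xs)))"

definition fun_form :: "('a \<Rightarrow> complex) \<Rightarrow> 'a form" where
  "fun_form f = (\<lambda>p xs. if xs = [] then f p else 0)"

definition conj_form :: "'a form \<Rightarrow> 'a form" where
  "conj_form \<omega> = (\<lambda>p xs. cnj (\<omega> p (map conj_vec xs)))"

text \<open>The invariant formula for \<open>(d \<omega>) (X\<^sub>0, \<dots>, X\<^sub>k)\<close>; \<open>nths Xs (- I)\<close> omits the entries with
  index in \<open>I\<close>.\<close>

definition koszul :: "'a form \<Rightarrow> ('a \<Rightarrow> 'a ctvec) list \<Rightarrow> 'a \<Rightarrow> complex" where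
  "koszul \<omega> Xs p =
     (\<Sum>i<length Xs. (- 1) ^ i * capply (Xs ! i) (\<lambda>q. \<omega> q (map (\<lambda>X. X q) (nths Xs (- {i})))) p) +
     (\<Sum>(i, j)\<in>{(i, j). i < j \<and> j < length Xs}. (- 1) ^ (i + j) *
        \<omega> p (map (\<lambda>X. X p) (lie_bracket (Xs ! i) (Xs ! j) # nths Xs (- {i, j}))))"

definition ext_d :: "('a, 'e::euclidean_space) atlas \<Rightarrow> nat \<Rightarrow> 'a form \<Rightarrow> 'a form" where
  "ext_d A k \<omega> = (THE \<eta>. kform A (Suc k) \<eta> \<and>
     (\<forall>Xs. length Xs = Suc k \<and> (\<forall>X\<in>set Xs. cvector_field A X) \<longrightarrow>
        (\<forall>p. \<eta> p (map (\<lambda>X. X p) Xs) = koszul \<omega> Xs p)))"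

definition pq_covector ::
  "('a, 'e::euclidean_space) atlas \<Rightarrow> ('a \<Rightarrow> 'a tvec \<Rightarrow> 'a tvec) \<Rightarrow> 'a \<Rightarrow> nat \<Rightarrow> nat \<Rightarrow>
     ('a ctvec list \<Rightarrow> complex) \<Rightarrow> bool" where
  "pq_covector A J p a b \<theta> \<longleftrightarrow> covector A p (a + b) \<theta> \<and>
     (\<forall>xs. length xs = a + b \<and> set xs \<subseteq> T10 A J p \<union> T01 A J p \<and> \<theta> xs \<noteq> 0 \<longrightarrow>
        length (filter (\<lambda>Z. Z \<in> T10 A J p) xs) = a)"

text \<open>The \<open>(a, b)\<close>-component of an \<open>(a + b)\<close>-form: split every argument into its \<open>(1,0)\<close> and
  \<open>(0,1)\<close> parts, expand, and keep the terms with exactly \<open>a\<close> arguments of type \<open>(1,0)\<close>.\<close>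

definition pq_component ::
  "('a, 'e::euclidean_space) atlas \<Rightarrow> ('a \<Rightarrow> 'a tvec \<Rightarrow> 'a tvec) \<Rightarrow> nat \<Rightarrow> nat \<Rightarrow> 'a form \<Rightarrow> 'a form" where
  "pq_component A J a b \<eta> = (\<lambda>p xs.
     if length xs = a + b \<and> set xs \<subseteq> ctangent A p
     then \<Sum>S | S \<subseteq> {..<length xs} \<and> card S = a.
       \<eta> p (map (\<lambda>i. if i \<in> S then proj10 J p (xs ! i) else proj01 J p (xs ! i)) [0..<length xs])
     else 0)"

definition dbar ::
  "('a, 'e::euclidean_space) atlas \<Rightarrow> ('a \<Rightarrow> 'a tvec \<Rightarrow> 'a tvec) \<Rightarrow> nat \<Rightarrow> nat \<Rightarrow> 'a form \<Rightarrow> 'a form" where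
  "dbar A J a b \<omega> = pq_component A J a (Suc b) (ext_d A (a + b) \<omega>)"

section \<open>Tensor products of bundles of forms\<close>

text \<open>An element of \<open>E\<^sub>1 \<otimes> \<dots> \<otimes> E\<^sub>r\<close>, where \<open>E\<^sub>i\<close> is the bundle of covectors of type
  \<open>(a\<^sub>i, b\<^sub>i)\<close>, is at \<open>p\<close> a function of \<open>r\<close> blocks of tangent vectors that is a covector of type
  \<open>(a\<^sub>i, b\<^sub>i)\<close> in the \<open>i\<close>-th block; the blocks are collected in a list.\<close>

type_synonym 'a tensor = "'a \<Rightarrow> 'a ctvec list list \<Rightarrow> complex"

definition tensor_section ::
  "('a, 'e::euclidean_space) atlas \<Rightarrow> ('a \<Rightarrow> 'a tvec \<Rightarrow> 'a tvec) \<Rightarrow> (nat \<times> nat) list \<Rightarrow>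
     'a tensor \<Rightarrow> bool" where
  "tensor_section A J ts T \<longleftrightarrow>
     (\<forall>p xss. length xss \<noteq> length ts \<longrightarrow> T p xss = 0) \<and>
     (\<forall>p xss i. length xss = length ts \<and> i < length ts \<longrightarrow>
        pq_covector A J p (fst (ts ! i)) (snd (ts ! i)) (\<lambda>xs. T p (xss[i := xs]))) \<and>
     (\<forall>Xss. (\<forall>Xs\<in>set Xss. \<forall>X\<in>set Xs. cvector_field A X) \<longrightarrow>
        smooth_fun A (\<lambda>p. T p (map (map (\<lambda>X. X p)) Xss)))"

definition tensor_list :: "'a form list \<Rightarrow> 'a tensor" where
  "tensor_list ss = (\<lambda>p xss. if length xss = length ss
     then \<Prod>i<length ss. (ss ! i) p (xss ! i) else 0)"

text \<open>The linear map \<open>\<eta> \<otimes> s \<mapsto> \<eta> \<and> s\<close>, as a sum over shuffles: \<open>S\<close> is the set of positions whose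
  arguments go to the first factor. Normalisation: \<open>(\<eta>\<^sub>1 \<and> \<dots> \<and> \<eta>\<^sub>k) (X\<^sub>1, \<dots>, X\<^sub>k) = det (\<eta>\<^sub>i X\<^sub>j)\<close> for
  1-forms. No degrees are needed since forms vanish on lists of the wrong length.\<close>

definition wedge_map :: "'a tensor \<Rightarrow> 'a form" where
  "wedge_map t = (\<lambda>p xs. \<Sum>S\<in>Pow {..<length xs}.
     (- 1) ^ card {(i, j). i \<in> S \<and> j \<in> {..<length xs} - S \<and> j < i} * t p [nths xs S, nths xs (- S)])"

definition wedge :: "'a form \<Rightarrow> 'a form \<Rightarrow> 'a form" where
  "wedge \<omega> \<eta> = wedge_map (tensor_list [\<omega>, \<eta>])"

definition wedge_list :: "'a form list \<Rightarrow> 'a form" where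
  "wedge_list \<omega>s = foldr wedge \<omega>s (fun_form (\<lambda>p. 1))"

section \<open>Pluricanonical sections\<close>

definition canonical_section ::
  "('a, 'e::euclidean_space) atlas \<Rightarrow> ('a \<Rightarrow> 'a tvec \<Rightarrow> 'a tvec) \<Rightarrow> nat \<Rightarrow> 'a form \<Rightarrow> bool" where
  "canonical_section A J n s \<longleftrightarrow> kform A n s \<and> (\<forall>p. pq_covector A J p n 0 (s p))"

definition pluricanonical_section ::
  "('a, 'e::euclidean_space) atlas \<Rightarrow> ('a \<Rightarrow> 'a tvec \<Rightarrow> 'a tvec) \<Rightarrow> nat \<Rightarrow> nat \<Rightarrow> 'a tensor \<Rightarrow> bool" where
  "pluricanonical_section A J n m T \<longleftrightarrow> tensor_section A J (replicate m (n, 0)) T"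

text \<open>\<open>dbar\<close> of a canonical section \<open>s\<close>, moved from \<open>\<Lambda>\<^sup>n\<^sup>,\<^sup>1\<close> to \<open>\<Lambda>\<^sup>0\<^sup>,\<^sup>1 \<otimes> \<Lambda>\<^sup>n\<^sup>,\<^sup>0\<close> along the isomorphism
  \<open>\<eta> \<otimes> s \<mapsto> \<eta> \<and> s\<close>.\<close>

definition dbar_canonical ::
  "('a, 'e::euclidean_space) atlas \<Rightarrow> ('a \<Rightarrow> 'a tvec \<Rightarrow> 'a tvec) \<Rightarrow> nat \<Rightarrow> 'a form \<Rightarrow> 'a tensor" where
  "dbar_canonical A J n s =
     (THE t. tensor_section A J [(0, 1), (n, 0)] t \<and> wedge_map t = dbar A J n 0 s)"

text \<open>The Leibniz expression \<open>\<Sum>\<^sub>i s\<^sub>1 \<otimes> \<dots> \<otimes> dbar s\<^sub>i \<otimes> \<dots> \<otimes> s\<^sub>m\<close>, with the \<open>\<Lambda>\<^sup>0\<^sup>,\<^sup>1\<close> factor moved to the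
  front.\<close>

definition leibniz ::
  "('a, 'e::euclidean_space) atlas \<Rightarrow> ('a \<Rightarrow> 'a tvec \<Rightarrow> 'a tvec) \<Rightarrow> nat \<Rightarrow> 'a form list \<Rightarrow> 'a tensor" where
  "leibniz A J n ss = (\<lambda>p yss. case yss of [] \<Rightarrow> 0 | ys # xss \<Rightarrow>
     if length xss = length ss
     then \<Sum>i<length ss. dbar_canonical A J n (ss ! i) p [ys, xss ! i] *
            (\<Prod>j\<in>{..<length ss} - {i}. (ss ! j) p (xss ! j))
     else 0)"

text \<open>The extension to tensor powers is additive and given by the Leibniz expression on
  products \<open>s\<^sub>1 \<otimes> \<dots> \<otimes> s\<^sub>m\<close>. Every section of the \<open>m\<close>-th tensor power is a finite sum of such
  products of global sections.\<close>

definition dbar_pluricanonical ::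
  "('a, 'e::euclidean_space) atlas \<Rightarrow> ('a \<Rightarrow> 'a tvec \<Rightarrow> 'a tvec) \<Rightarrow> nat \<Rightarrow> nat \<Rightarrow> 'a tensor \<Rightarrow> 'a tensor" where
  "dbar_pluricanonical A J n m T = (THE U. \<exists>N ss.
     (\<forall>a<N. length (ss a) = m \<and> (\<forall>s\<in>set (ss a). canonical_section A J n s)) \<and>
     T = (\<lambda>p xss. \<Sum>a<N. tensor_list (ss a) p xss) \<and>
     U = (\<lambda>p yss. \<Sum>a<(N::nat). leibniz A J n (ss a) p yss))"

definition pseudoholomorphic ::
  "('a, 'e::euclidean_space) atlas \<Rightarrow> ('a \<Rightarrow> 'a tvec \<Rightarrow> 'a tvec) \<Rightarrow> nat \<Rightarrow> nat \<Rightarrow> 'a tensor \<Rightarrow> bool" where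
  "pseudoholomorphic A J n m T \<longleftrightarrow> pluricanonical_section A J n m T \<and>
     dbar_pluricanonical A J n m T = (\<lambda>p yss. 0)"

end

theory Submission
  imports Defs
begin

text \<open>Let \<open>Z\<^sub>1, \<dots>, Z\<^sub>n\<close> be the frame of \<open>T\<^sup>1\<^sup>,\<^sup>0\<close> dual to \<open>\<phi>\<^sub>1, \<dots>, \<phi>\<^sub>n\<close>. On the arguments \<open>(conj Z\<^sub>k, Z\<^sub>j)\<close> the
  structure equation reads \<open>\<phi>\<^sub>i [conj Z\<^sub>k, Z\<^sub>j] = lam i j k\<close>. Every \<open>(n,1)\<close>-form is determined by its
  values on the lists \<open>(conj Z\<^sub>k, Z\<^sub>1, \<dots>, Z\<^sub>n)\<close>, and there the invariant formula for \<open>d (h \<psi>)\<close>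
  collapses to \<open>(conj Z\<^sub>k) h - h (\<Sum>j. \<phi>\<^sub>j [conj Z\<^sub>k, Z\<^sub>j])\<close>; hence \<open>dbar (h \<psi>) = (dbar h + h \<alpha>) \<and> \<psi>\<close>. Since
  every canonical section is a multiple of \<open>\<psi>\<close>, the Leibniz expression of any decomposition of
  \<open>f \<psi>\<^sup>m\<close> into products equals \<open>(dbar f + m f \<alpha>) \<otimes> \<psi>\<^sup>m\<close>.

  The exterior derivative is defined by a description operator, so its existence has to be shown:
  Cartan's formula \<open>\<iota>\<^sub>X d = L\<^sub>X - d \<iota>\<^sub>X\<close> gives by induction on the degree that the invariant formula is
  tensorial and alternating, and the global frame extends tangent vectors to vector fields.\<close>

section \<open>Smooth functions\<close>

text \<open>Charts serve only to show that smooth functions are closed under algebraic operations;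
  after that every field, form and section is handled in the global frame. Signs: \<phi>_i has
  constant values on the frame, so d \<phi>_i on (conj Z_k, Z_j) is minus \<phi>_i of the bracket,
  while \<phi>_j wedge conj \<phi>_k equals -1 there, and the two signs cancel. The Lie derivative
  along conj Z_k then subtracts the trace of these coefficients, which is the minus sign in
  \<alpha>. Only brackets of mixed type occur, so the computation is valid for non-integrable J.
  Besides \<open>ext_d\<close>, the operators \<open>dbar_canonical\<close> and
  \<open>dbar_pluricanonical\<close> are also given by descriptions. For the former, uniqueness is
  the injectivity of \<eta> \<otimes> s \<mapsto> \<eta> \<and> s on the tensor product of types
  (0,1) and (n,0). For the latter, the Leibniz expression of a product of sections h_i \<psi>
  depends only on the function h_1 ... h_m, additively, so all decompositions of one section give
  the same value. The factor m counts the tensor factors, each of which contributes one copy of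
  \<alpha>.\<close>

lemma Ck_on_cong:
  assumes "open S" and "\<And>x. x \<in> S \<Longrightarrow> f x = g x" and "Ck_on k S f"
  shows "Ck_on k S g"
  using assms
proof (induction k arbitrary: f g)
  case 0
  then have "continuous_on S g \<longleftrightarrow> continuous_on S f" by (intro continuous_on_cong) auto
  then show ?case using 0 by simp
next
  case (Suc k)
  have g: "(g has_derivative frechet_derivative f (at x)) (at x)" if "x \<in> S" for x
    using Suc.prems that
    by (intro has_derivative_transform_within_open[of f _ x UNIV S g])
       (auto simp: frechet_derivative_works)
  have e: "frechet_derivative f (at x) v = frechet_derivative g (at x) v" if "x \<in> S" for x v
    by (simp add: frechet_derivative_at[OF g[OF that]])
  have "Ck_on k S (\<lambda>x. frechet_derivative g (at x) v)" for v
  proof (rule Suc.IH[OF \<open>open S\<close>])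
    show "Ck_on k S (\<lambda>x. frechet_derivative f (at x) v)" using Suc.prems(3) by simp
  qed (rule e)
  moreover have "g differentiable (at x)" if "x \<in> S" for x
    using g[OF that] by (auto simp: differentiable_def)
  ultimately show ?case by simp
qed

lemma Ck_on_SucD: "Ck_on (Suc k) S f \<Longrightarrow> Ck_on k S f"
proof (induction k arbitrary: f)
  case 0
  then show ?case
    by (auto intro!: continuous_at_imp_continuous_on differentiable_imp_continuous_within)
next
  case (Suc k)
  have "Ck_on k S (\<lambda>x. frechet_derivative f (at x) v)" for v
    using Suc.prems by (intro Suc.IH) auto
  then show ?case using Suc.prems by auto
qed

lemma Ck_on_const: "Ck_on k S (\<lambda>x. c)"
  by (induction k arbitrary: c) auto

text \<open>The derivative of the composite is known in closed form only at points of
  \<open>S\<close>; since \<open>S\<close> is open, \<open>Ck_on_cong\<close> lets this form replace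
  \<open>frechet_derivative\<close>. The rules for sums and products follow the same scheme.\<close>

lemma Ck_on_bounded_linear:
  assumes "open S" "bounded_linear L" "Ck_on k S f"
  shows "Ck_on k S (\<lambda>x. L (f x))"
  using assms(3)
proof (induction k arbitrary: f)
  case 0
  then show ?case using assms(2) by (auto intro: bounded_linear.continuous_on)
next
  case (Suc k)
  have d: "((\<lambda>x. L (f x)) has_derivative (\<lambda>v. L (frechet_derivative f (at x) v))) (at x)"
    if "x \<in> S" for x
    using Suc.prems that
    by (intro bounded_linear.has_derivative[OF assms(2)]) (auto simp: frechet_derivative_works)
  have "Ck_on k S (\<lambda>x. frechet_derivative (\<lambda>x. L (f x)) (at x) v)" for v
  proof (rule Ck_on_cong[OF assms(1)])
    show "Ck_on k S (\<lambda>x. L (frechet_derivative f (at x) v))"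
      using Suc by auto
    show "L (frechet_derivative f (at x) v) = frechet_derivative (\<lambda>x. L (f x)) (at x) v"
      if "x \<in> S" for x
      using frechet_derivative_at[OF d[OF that]] by (rule fun_cong)
  qed
  then show ?case using d by (auto simp: differentiable_def)
qed

lemma Ck_on_add:
  assumes "open S" "Ck_on k S f" "Ck_on k S g"
  shows "Ck_on k S (\<lambda>x. f x + g x)"
  using assms(2,3)
proof (induction k arbitrary: f g)
  case 0
  then show ?case by (auto intro: continuous_on_add)
next
  case (Suc k)
  have d: "((\<lambda>x. f x + g x) has_derivative
      (\<lambda>v. frechet_derivative f (at x) v + frechet_derivative g (at x) v)) (at x)"
    if "x \<in> S" for x
    using Suc.prems that by (intro has_derivative_add) (auto simp: frechet_derivative_works)
  have "Ck_on k S (\<lambda>x. frechet_derivative (\<lambda>x. f x + g x) (at x) v)" for v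
  proof (rule Ck_on_cong[OF assms(1)])
    show "Ck_on k S (\<lambda>x. frechet_derivative f (at x) v + frechet_derivative g (at x) v)"
      using Suc by auto
    show "frechet_derivative f (at x) v + frechet_derivative g (at x) v
        = frechet_derivative (\<lambda>x. f x + g x) (at x) v" if "x \<in> S" for x
      using frechet_derivative_at[OF d[OF that]] by (rule fun_cong)
  qed
  then show ?case using d by (auto simp: differentiable_def)
qed

lemma Ck_on_bilinear:
  assumes "open S" "bounded_bilinear B" "Ck_on k S f" "Ck_on k S g"
  shows "Ck_on k S (\<lambda>x. B (f x) (g x))"
  using assms(3,4)
proof (induction k arbitrary: f g)
  case 0
  then show ?case using assms(2) by (auto intro: bounded_bilinear.continuous_on)
next
  case (Suc k)
  have d: "((\<lambda>x. B (f x) (g x)) has_derivative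
      (\<lambda>v. B (f x) (frechet_derivative g (at x) v) + B (frechet_derivative f (at x) v) (g x))) (at x)"
    if "x \<in> S" for x
    using Suc.prems that
    by (intro bounded_bilinear.FDERIV[OF assms(2)]) (auto simp: frechet_derivative_works)
  have "Ck_on k S (\<lambda>x. frechet_derivative (\<lambda>x. B (f x) (g x)) (at x) v)" for v
  proof (rule Ck_on_cong[OF assms(1)])
    \<comment> \<open>Each summand of the product rule keeps one factor undifferentiated, whose
      regularity is lowered from \<open>Suc k\<close> to \<open>k\<close>.\<close>
    show "Ck_on k S (\<lambda>x. B (f x) (frechet_derivative g (at x) v) + B (frechet_derivative f (at x) v) (g x))"
      using Suc.prems Ck_on_SucD[OF Suc.prems(1)] Ck_on_SucD[OF Suc.prems(2)]
      by (intro Ck_on_add assms(1) Suc.IH) auto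
    show "B (f x) (frechet_derivative g (at x) v) + B (frechet_derivative f (at x) v) (g x)
        = frechet_derivative (\<lambda>x. B (f x) (g x)) (at x) v" if "x \<in> S" for x
      using frechet_derivative_at[OF d[OF that]] by (rule fun_cong)
  qed
  then show ?case using d by (auto simp: differentiable_def)
qed

lemma smooth_fun_const: "smooth_fun A (\<lambda>p. c)"
  by (auto simp: smooth_fun_def smooth_on_def Ck_on_const)

locale manifold =
  fixes A :: "('a::{t2_space, second_countable_topology}, 'e::euclidean_space) atlas"
  assumes smooth_manifold: "smooth_manifold A"
begin

lemma open_chart_image: "(U, \<kappa>) \<in> A \<Longrightarrow> open (\<kappa> ` U)"
  using smooth_manifold by (force simp: smooth_manifold_def)

lemma smooth_fun_iff:
  "smooth_fun A f \<longleftrightarrow> (\<forall>U \<kappa> k. (U, \<kappa>) \<in> A \<longrightarrow> Ck_on k (\<kappa> ` U) (\<lambda>x. f (inv_into U \<kappa> x)))"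
  by (auto simp: smooth_fun_def smooth_on_def)

lemma smooth_fun_bounded_linear:
  "bounded_linear L \<Longrightarrow> smooth_fun A f \<Longrightarrow> smooth_fun A (\<lambda>p. L (f p))"
  by (simp add: smooth_fun_iff Ck_on_bounded_linear[of _ L] open_chart_image)

lemma smooth_fun_bilinear:
  "bounded_bilinear B \<Longrightarrow> smooth_fun A f \<Longrightarrow> smooth_fun A g \<Longrightarrow> smooth_fun A (\<lambda>p. B (f p) (g p))"
  by (simp add: smooth_fun_iff Ck_on_bilinear[of _ B] open_chart_image)

lemma smooth_fun_add: "smooth_fun A f \<Longrightarrow> smooth_fun A g \<Longrightarrow> smooth_fun A (\<lambda>p. f p + g p)"
  by (simp add: smooth_fun_iff Ck_on_add open_chart_image)

lemma smooth_fun_mult: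
  fixes f g :: "'a \<Rightarrow> 'b::real_normed_algebra"
  shows "smooth_fun A f \<Longrightarrow> smooth_fun A g \<Longrightarrow> smooth_fun A (\<lambda>p. f p * g p)"
  by (rule smooth_fun_bilinear[OF bounded_bilinear_mult])

lemma smooth_fun_minus: "smooth_fun A f \<Longrightarrow> smooth_fun A (\<lambda>p. - f p)"
  by (rule smooth_fun_bounded_linear[OF bounded_linear_minus[OF bounded_linear_ident]])

lemma smooth_fun_diff: "smooth_fun A f \<Longrightarrow> smooth_fun A g \<Longrightarrow> smooth_fun A (\<lambda>p. f p - g p)"
  using smooth_fun_add[of f "\<lambda>p. - g p"] smooth_fun_minus[of g] by simp

lemma smooth_fun_sum:
  "(\<And>i. i \<in> I \<Longrightarrow> smooth_fun A (f i)) \<Longrightarrow> smooth_fun A (\<lambda>p. \<Sum>i\<in>I. f i p)"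
  by (induction I rule: infinite_finite_induct) (auto intro!: smooth_fun_const smooth_fun_add)

lemma smooth_fun_prod:
  fixes f :: "'i \<Rightarrow> 'a \<Rightarrow> 'b::{real_normed_algebra,comm_monoid_mult}"
  shows "(\<And>i. i \<in> I \<Longrightarrow> smooth_fun A (f i)) \<Longrightarrow> smooth_fun A (\<lambda>p. \<Prod>i\<in>I. f i p)"
  by (induction I rule: infinite_finite_induct) (auto intro!: smooth_fun_const smooth_fun_mult)

lemma smooth_fun_Re: "smooth_fun A f \<Longrightarrow> smooth_fun A (\<lambda>p. Re (f p))"
  by (rule smooth_fun_bounded_linear[OF bounded_linear_Re])

lemma smooth_fun_Im: "smooth_fun A f \<Longrightarrow> smooth_fun A (\<lambda>p. Im (f p))"
  by (rule smooth_fun_bounded_linear[OF bounded_linear_Im])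

lemma smooth_fun_cnj: "smooth_fun A f \<Longrightarrow> smooth_fun A (\<lambda>p. cnj (f p))"
  by (rule smooth_fun_bounded_linear[OF bounded_linear_cnj])

lemma smooth_fun_of_real: "smooth_fun A f \<Longrightarrow> smooth_fun A (\<lambda>p. complex_of_real (f p))"
  by (rule smooth_fun_bounded_linear[OF bounded_linear_of_real])

end

section \<open>Complex tangent vectors and Lie brackets\<close>

context manifold begin

text \<open>The defining conditions have real coefficients, so they hold for a complex-valued
  functional exactly when they hold for its real and imaginary parts. Membership thus becomes
  intrinsic, with no choice of \<open>D\<close> and \<open>E\<close>.\<close>

lemma ctangent_iff:
  "Z \<in> ctangent A p \<longleftrightarrow>
     (\<forall>g. \<not> smooth_fun A g \<longrightarrow> Z g = 0) \<and>
     (\<forall>g h c. smooth_fun A g \<and> smooth_fun A h \<longrightarrow>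
        Z (\<lambda>x. g x + c * h x) = Z g + complex_of_real c * Z h) \<and>
     (\<forall>g h. smooth_fun A g \<and> smooth_fun A h \<longrightarrow>
        Z (\<lambda>x. g x * h x) = complex_of_real (g p) * Z h + complex_of_real (h p) * Z g)"
    (is "_ \<longleftrightarrow> ?R")
proof
  assume "Z \<in> ctangent A p"
  then show ?R
    by (auto simp: ctangent_def tangent_def cplx_def algebra_simps)
next
  assume R: ?R
  then have "(\<lambda>g. Re (Z g)) \<in> tangent A p" "(\<lambda>g. Im (Z g)) \<in> tangent A p"
    by (auto simp: tangent_def)
  moreover have "Z = (\<lambda>g. cplx (\<lambda>g. Re (Z g)) g + \<i> * cplx (\<lambda>g. Im (Z g)) g)"
    by (auto simp: cplx_def complex_eq)
  ultimately show "Z \<in> ctangent A p"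
    unfolding ctangent_def by blast
qed

lemma ctangent_nonsmooth: "Z \<in> ctangent A p \<Longrightarrow> \<not> smooth_fun A g \<Longrightarrow> Z g = 0"
  by (simp add: ctangent_iff)

lemma ctangent_lincomb:
  "Y \<in> ctangent A p \<Longrightarrow> Z \<in> ctangent A p \<Longrightarrow> (\<lambda>g. Y g + c * Z g) \<in> ctangent A p"
  by (auto simp: ctangent_iff algebra_simps)

lemma ctangent_zero: "(\<lambda>g. 0) \<in> ctangent A p"
  by (auto simp: ctangent_iff)

lemma ctangent_sum:
  "(\<And>i. i \<in> I \<Longrightarrow> Z i \<in> ctangent A p) \<Longrightarrow> (\<lambda>g. \<Sum>i\<in>I. c i * Z i g) \<in> ctangent A p"
proof (induction I rule: infinite_finite_induct)
  case (insert i I)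
  then have "(\<lambda>g. (\<Sum>i\<in>I. c i * Z i g) + c i * Z i g) \<in> ctangent A p"
    by (intro ctangent_lincomb) auto
  then show ?case using insert by (simp add: add.commute)
qed (auto intro: ctangent_zero)

lemma ctangent_conj: "Z \<in> ctangent A p \<Longrightarrow> conj_vec Z \<in> ctangent A p"
  by (auto simp: ctangent_iff conj_vec_def)

lemma ctangent_cplx: "D \<in> tangent A p \<Longrightarrow> cplx D \<in> ctangent A p"
  by (auto simp: ctangent_iff tangent_def cplx_def)

lemma ctangent_ReD: "Z \<in> ctangent A p \<Longrightarrow> (\<lambda>g. Re (Z g)) \<in> tangent A p"
  and ctangent_ImD: "Z \<in> ctangent A p \<Longrightarrow> (\<lambda>g. Im (Z g)) \<in> tangent A p"
  by (auto simp: ctangent_iff tangent_def)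

lemma ctangent_add_arg:
  "Z \<in> ctangent A p \<Longrightarrow> smooth_fun A g \<Longrightarrow> smooth_fun A h \<Longrightarrow> Z (\<lambda>x. g x + h x) = Z g + Z h"
  using ctangent_iff[of Z p] by (metis (no_types, lifting) ext mult_1 of_real_1)

lemma ctangent_diff_arg:
  "Z \<in> ctangent A p \<Longrightarrow> smooth_fun A g \<Longrightarrow> smooth_fun A h \<Longrightarrow> Z (\<lambda>x. g x - h x) = Z g - Z h"
proof -
  assume a: "Z \<in> ctangent A p" "smooth_fun A g" "smooth_fun A h"
  then have "Z (\<lambda>x. g x + (-1) * h x) = Z g + complex_of_real (-1) * Z h"
    unfolding ctangent_iff by blast
  then show ?thesis by simp
qed

lemma ctangent_mult_arg:
  "Z \<in> ctangent A p \<Longrightarrow> smooth_fun A g \<Longrightarrow> smooth_fun A h \<Longrightarrow>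
     Z (\<lambda>x. g x * h x) = complex_of_real (g p) * Z h + complex_of_real (h p) * Z g"
  by (simp add: ctangent_iff)

text \<open>The Leibniz rule on \<open>1 * 1\<close> forces the value at \<open>1\<close> to vanish.
  The constant \<open>c\<close> is then read as \<open>0 + c * 1\<close>, and the value at the zero
  function comes from \<open>1 - 1\<close>.\<close>

lemma ctangent_const_arg:
  assumes "Z \<in> ctangent A p"
  shows "Z (\<lambda>x. c) = 0"
proof -
  have "Z (\<lambda>x. 1 * 1) = 1 * Z (\<lambda>x. 1) + 1 * Z (\<lambda>x. 1)"
    using ctangent_mult_arg[OF assms smooth_fun_const smooth_fun_const, of 1 1] by simp
  then have 1: "Z (\<lambda>x. 1) = 0" by simp
  have "Z (\<lambda>x. c * 1) = c * Z (\<lambda>x. 1) + 1 * Z (\<lambda>x. c)"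
    using ctangent_mult_arg[OF assms smooth_fun_const smooth_fun_const, of c 1] by simp
  moreover have "Z (\<lambda>x. 0 + c * 1) = Z (\<lambda>x. 0) + c * Z (\<lambda>x. 1)"
    using assms smooth_fun_const unfolding ctangent_iff by blast
  moreover have "Z (\<lambda>x. 1 - 1) = 0"
    using ctangent_diff_arg[OF assms smooth_fun_const smooth_fun_const, of 1 1] by simp
  ultimately show ?thesis using 1 by simp
qed

lemma capply_const: "X p \<in> ctangent A p \<Longrightarrow> capply X (\<lambda>q. c) p = 0"
  by (simp add: capply_def ctangent_const_arg)

lemma capply_add:
  assumes "X p \<in> ctangent A p" "smooth_fun A f" "smooth_fun A g"
  shows "capply X (\<lambda>q. f q + g q) p = capply X f p + capply X g p"
  using assms(2,3)
  by (simp add: capply_def ctangent_add_arg[OF assms(1)] smooth_fun_Re smooth_fun_Im algebra_simps)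

lemma capply_mult:
  assumes "X p \<in> ctangent A p" "smooth_fun A f" "smooth_fun A g"
  shows "capply X (\<lambda>q. f q * g q) p = f p * capply X g p + g p * capply X f p"
proof -
  \<comment> \<open>The derivation rule sees only real functions, so multiplication by a complex
    number is broken into two real scalings.\<close>
  have c: "z * a = complex_of_real (Re z) * a + \<i> * (complex_of_real (Im z) * a)" for z a
    by (simp add: complex_eq_iff)
  show ?thesis
    unfolding c[of "f p"] c[of "g p"]
    using assms(2,3)
    by (simp add: capply_def ctangent_add_arg[OF assms(1)] ctangent_diff_arg[OF assms(1)]
        ctangent_mult_arg[OF assms(1)] smooth_fun_Re smooth_fun_Im smooth_fun_mult algebra_simps)
qed

lemma capply_cmult:
  assumes "X p \<in> ctangent A p" "smooth_fun A g"
  shows "capply X (\<lambda>q. c * g q) p = c * capply X g p"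
  using capply_mult[where X = X and p = p and f = "\<lambda>q. c" and g = g] capply_const[of X p c] assms
  by (simp add: smooth_fun_const)

lemma capply_sum:
  assumes "X p \<in> ctangent A p" "\<And>i. i \<in> I \<Longrightarrow> smooth_fun A (f i)"
  shows "capply X (\<lambda>q. \<Sum>i\<in>I. f i q) p = (\<Sum>i\<in>I. capply X (f i) p)"
  using assms(2)
proof (induction I rule: infinite_finite_induct)
  case (insert i I)
  then show ?case using assms(1) by (simp add: capply_add smooth_fun_sum)
qed (use capply_const[of X p 0] assms(1) in auto)

lemma cvector_field_ctangent: "cvector_field A X \<Longrightarrow> X p \<in> ctangent A p"
  by (simp add: cvector_field_def)

text \<open>A non-smooth \<open>g\<close> is sent to \<open>0\<close> at every point, so the default
  values of tangent vectors depend smoothly on the point as well.\<close>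

lemma cvector_field_smooth:
  assumes "cvector_field A X"
  shows "smooth_fun A (\<lambda>p. X p g)"
proof (cases "smooth_fun A g")
  case True
  then show ?thesis using assms by (simp add: cvector_field_def)
next
  case False
  then have "(\<lambda>p. X p g) = (\<lambda>p. 0)"
    using ctangent_nonsmooth cvector_field_ctangent[OF assms] by blast
  then show ?thesis by (simp add: smooth_fun_const)
qed

lemma smooth_fun_capply:
  "cvector_field A X \<Longrightarrow> smooth_fun A (\<lambda>p. capply X h p)"
  by (simp add: capply_def smooth_fun_add smooth_fun_mult smooth_fun_const cvector_field_smooth)

lemma cvector_field_lincomb:
  assumes "cvector_field A X" "cvector_field A Y" "smooth_fun A h"
  shows "cvector_field A (\<lambda>p g. X p g + h p * Y p g)"
  using assms unfolding cvector_field_def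
  by (simp add: ctangent_lincomb smooth_fun_add smooth_fun_mult)

lemma cvector_field_zero: "cvector_field A (\<lambda>p g. 0)"
  by (auto simp: cvector_field_def ctangent_zero smooth_fun_const)

lemma cvector_field_sum:
  assumes "\<And>i. i \<in> I \<Longrightarrow> cvector_field A (X i)" "\<And>i. i \<in> I \<Longrightarrow> smooth_fun A (h i)"
  shows "cvector_field A (\<lambda>p g. \<Sum>i\<in>I. h i p * X i p g)"
  using assms unfolding cvector_field_def
  by (auto intro!: ctangent_sum smooth_fun_sum smooth_fun_mult)

lemma lie_bracket_nonsmooth:
  assumes "cvector_field A X" "cvector_field A Y" "\<not> smooth_fun A g"
  shows "lie_bracket X Y p g = 0"
proof -
  have "(\<lambda>q. X q g) = (\<lambda>q. 0)" "(\<lambda>q. Y q g) = (\<lambda>q. 0)"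
    using assms ctangent_nonsmooth cvector_field_ctangent by blast+
  then show ?thesis
    using assms by (simp add: lie_bracket_def capply_const cvector_field_ctangent)
qed

lemma lie_bracket_ctangent:
  assumes "cvector_field A X" "cvector_field A Y"
  shows "lie_bracket X Y p \<in> ctangent A p"
proof -
  have X: "X q \<in> ctangent A q" and Y: "Y q \<in> ctangent A q" for q
    using assms by (auto simp: cvector_field_ctangent)
  have s: "smooth_fun A (\<lambda>q. X q g)" "smooth_fun A (\<lambda>q. Y q g)" for g
    using assms by (auto simp: cvector_field_smooth)
  have cr: "capply W (\<lambda>q. complex_of_real (g q)) p = W p g" if "W p \<in> ctangent A p" for W g
    using that by (simp add: capply_def ctangent_const_arg)
  show ?thesis
    unfolding ctangent_iff
  proof (intro conjI allI impI)
    fix g :: "'a \<Rightarrow> real" assume "\<not> smooth_fun A g"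
    then show "lie_bracket X Y p g = 0" using lie_bracket_nonsmooth assms by blast
  next
    fix g h :: "'a \<Rightarrow> real" and c assume "smooth_fun A g \<and> smooth_fun A h"
    then have e: "W (\<lambda>x. g x + c * h x) = W g + complex_of_real c * W h" if "W \<in> ctangent A q" for W q
      using that unfolding ctangent_iff by blast
    show "lie_bracket X Y p (\<lambda>x. g x + c * h x) = lie_bracket X Y p g + complex_of_real c * lie_bracket X Y p h"
      unfolding lie_bracket_def e[OF X] e[OF Y]
      by (simp add: capply_add capply_cmult X Y smooth_fun_mult smooth_fun_const s algebra_simps)
  next
    fix g h :: "'a \<Rightarrow> real" assume gh: "smooth_fun A g \<and> smooth_fun A h"
    have e: "W (\<lambda>x. g x * h x) = complex_of_real (g q) * W h + complex_of_real (h q) * W g"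
      if "W \<in> ctangent A q" for W q
      using that gh ctangent_mult_arg by blast
    have sg: "smooth_fun A (\<lambda>q. complex_of_real (g q))" "smooth_fun A (\<lambda>q. complex_of_real (h q))"
      using gh smooth_fun_of_real by blast+
    \<comment> \<open>The mixed first-order terms \<open>V p h * W p g + V p g * W p h\<close> are
      symmetric in \<open>V\<close> and \<open>W\<close>; hence they cancel in the commutator and
      the Leibniz rule survives.\<close>
    have x: "capply W (\<lambda>q. complex_of_real (g q) * V q h + complex_of_real (h q) * V q g) p =
        g p * capply W (\<lambda>q. V q h) p + V p h * W p g + h p * capply W (\<lambda>q. V q g) p + V p g * W p h"
      if "W p \<in> ctangent A p" "\<And>g. smooth_fun A (\<lambda>q. V q g)" for W V
      using that sg by (simp add: capply_add capply_mult smooth_fun_mult cr)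
    show "lie_bracket X Y p (\<lambda>x. g x * h x) =
        complex_of_real (g p) * lie_bracket X Y p h + complex_of_real (h p) * lie_bracket X Y p g"
      unfolding lie_bracket_def e[OF X] e[OF Y] 
        x[of X Y, OF X s(2)] x[of Y X, OF Y s(1)]
      by (simp add: algebra_simps)
  qed
qed

lemma cvector_field_lie_bracket:
  assumes "cvector_field A X" "cvector_field A Y"
  shows "cvector_field A (lie_bracket X Y)"
  unfolding cvector_field_def
  using lie_bracket_ctangent[OF assms]
  by (auto simp: lie_bracket_def intro!: smooth_fun_diff smooth_fun_capply assms)

lemma lie_bracket_self: "lie_bracket X X p = (\<lambda>g. 0)"
  by (simp add: lie_bracket_def)

text \<open>The last term is the failure of linearity over functions. It is what has to cancel when
  the Lie derivative and the invariant formula for \<open>d\<close> are shown to be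
  tensorial.\<close>

lemma lie_bracket_lincomb_right:
  assumes "cvector_field A X" "cvector_field A Y" "cvector_field A Z" "smooth_fun A h"
  shows "lie_bracket X (\<lambda>q g. Y q g + h q * Z q g) p =
    (\<lambda>g. (lie_bracket X Y p g + h p * lie_bracket X Z p g) + capply X h p * Z p g)"
proof
  fix g
  have "capply X (\<lambda>q. Y q g + h q * Z q g) p
      = capply X (\<lambda>q. Y q g) p + (h p * capply X (\<lambda>q. Z q g) p + Z p g * capply X h p)"
    using assms
    by (simp add: capply_add capply_mult cvector_field_ctangent cvector_field_smooth smooth_fun_mult)
  then show "lie_bracket X (\<lambda>q g. Y q g + h q * Z q g) p g =
    (lie_bracket X Y p g + h p * lie_bracket X Z p g) + capply X h p * Z p g"
    by (simp add: lie_bracket_def capply_def algebra_simps)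
qed

lemma lie_bracket_lincomb_left:
  assumes "cvector_field A X" "cvector_field A Y" "cvector_field A Z" "smooth_fun A h"
  shows "lie_bracket (\<lambda>q g. Y q g + h q * Z q g) X p =
    (\<lambda>g. (lie_bracket Y X p g + h p * lie_bracket Z X p g) + (- capply X h p) * Z p g)"
proof -
  have anti: "lie_bracket U W p g = - lie_bracket W U p g" for U W :: "'a \<Rightarrow> 'a ctvec" and g
    by (simp add: lie_bracket_def)
  show ?thesis
    unfolding anti[of _ X] lie_bracket_lincomb_right[OF assms] by (simp add: algebra_simps)
qed

end

section \<open>Alternating forms\<close>

text \<open>Omitting positions commutes with \<open>Cons\<close> up to an index shift. These rules
  turn the alternating sums over omitted entries into recursions on the argument list.\<close>

lemma nths_Cons_omit_0: "nths (x # xs) (- {0}) = xs"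
  by (simp add: nths_Cons nths_all)

lemma nths_Cons_omit_Suc: "nths (x # xs) (- {Suc i}) = x # nths xs (- {i})"
proof -
  have "{j. Suc j \<in> - {Suc i}} = - {i}" by auto
  then show ?thesis by (simp add: nths_Cons)
qed

lemma nths_Cons_omit_0_Suc: "nths (x # xs) (- {0, Suc i}) = nths xs (- {i})"
proof -
  have "{j. Suc j \<in> - {0, Suc i}} = - {i}" by auto
  then show ?thesis by (simp add: nths_Cons)
qed

lemma nths_Cons_omit_Suc_Suc: "nths (x # xs) (- {Suc i, Suc j}) = x # nths xs (- {i, j})"
proof -
  have "{l. Suc l \<in> - {Suc i, Suc j}} = - {i, j}" by auto
  then show ?thesis by (simp add: nths_Cons)
qed

lemma nths_omit: "i < length xs \<Longrightarrow> nths xs (- {i}) = take i xs @ drop (Suc i) xs"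
proof (induction xs arbitrary: i)
  case (Cons x xs)
  then show ?case by (cases i) (auto simp: nths_Cons_omit_0 nths_Cons_omit_Suc)
qed simp

text \<open>Alternation is split off from \<open>covector\<close> because type components of forms
  are compared through multilinearity alone, on lists of frame vectors.\<close>

definition multilinear ::
  "('a, 'e::euclidean_space) atlas \<Rightarrow> 'a \<Rightarrow> nat \<Rightarrow> ('a ctvec list \<Rightarrow> complex) \<Rightarrow> bool" where
  "multilinear A p k \<theta> \<longleftrightarrow>
     (\<forall>xs. \<not> (length xs = k \<and> set xs \<subseteq> ctangent A p) \<longrightarrow> \<theta> xs = 0) \<and>
     (\<forall>xs i Y Z c. length xs = k \<and> set xs \<subseteq> ctangent A p \<and> i < k \<and>
        Y \<in> ctangent A p \<and> Z \<in> ctangent A p \<longrightarrow>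
        \<theta> (xs[i := (\<lambda>g. Y g + c * Z g)]) = \<theta> (xs[i := Y]) + c * \<theta> (xs[i := Z]))"

lemma covector_iff_multilinear:
  "covector A p k \<theta> \<longleftrightarrow> multilinear A p k \<theta> \<and>
     (\<forall>xs i j. length xs = k \<and> set xs \<subseteq> ctangent A p \<and> i < j \<and> j < k \<and> xs ! i = xs ! j \<longrightarrow> \<theta> xs = 0)"
  by (auto simp: covector_def multilinear_def)

lemma covector_multilinear: "covector A p k \<theta> \<Longrightarrow> multilinear A p k \<theta>"
  by (simp add: covector_iff_multilinear)

lemma multilinear_support:
  "multilinear A p k \<theta> \<Longrightarrow> length xs \<noteq> k \<or> \<not> set xs \<subseteq> ctangent A p \<Longrightarrow> \<theta> xs = 0"
  unfolding multilinear_def by blast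

lemma multilinear_0:
  "multilinear A p 0 \<theta> \<longleftrightarrow> (\<forall>xs. xs \<noteq> [] \<longrightarrow> \<theta> xs = 0)"
  unfolding multilinear_def by auto

lemma covector_0:
  "covector A p 0 \<theta> \<longleftrightarrow> (\<forall>xs. xs \<noteq> [] \<longrightarrow> \<theta> xs = 0)"
  by (auto simp: covector_iff_multilinear multilinear_0)

text \<open>The exterior product of a 1-covector \<open>a\<close> with \<open>\<theta>\<close>,
  expanded over the position of the argument that goes to \<open>a\<close>, as in a Laplace
  expansion.\<close>

definition ext_prod :: "('v \<Rightarrow> complex) \<Rightarrow> ('v list \<Rightarrow> complex) \<Rightarrow> 'v list \<Rightarrow> complex" where
  "ext_prod a \<theta> xs = (\<Sum>i<length xs. (- 1) ^ i * (a (xs ! i) * \<theta> (nths xs (- {i}))))"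

lemma ext_prod_Nil: "ext_prod a \<theta> [] = 0"
  by (simp add: ext_prod_def)

text \<open>Contraction with \<open>x\<close> is an antiderivation, here for the product of
  \<open>a\<close> with \<open>\<theta>\<close>. This recursion replaces the signed sum in all later
  inductions.\<close>

lemma ext_prod_Cons: "ext_prod a \<theta> (x # xs) = a x * \<theta> xs - ext_prod a (\<lambda>ys. \<theta> (x # ys)) xs"
  by (simp add: ext_prod_def sum.lessThan_Suc_shift nths_Cons_omit_0 nths_Cons_omit_Suc sum_negf
      del: sum.lessThan_Suc)

lemma ext_prod_lincomb:
  "ext_prod a (\<lambda>ys. \<theta> ys + c * \<theta>' ys) xs = ext_prod a \<theta> xs + c * ext_prod a \<theta>' xs"
  by (simp add: ext_prod_def sum.distrib sum_distrib_left algebra_simps)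

lemma ext_prod_zero: "ext_prod a (\<lambda>ys. 0) xs = 0"
  by (simp add: ext_prod_def)

text \<open>Only shuffles whose first block is a singleton survive, and the block \<open>{i}\<close>
  passes the \<open>i\<close> earlier positions, which gives the sign.\<close>

lemma wedge_map_ext_prod:
  assumes "\<And>ys zs. length ys \<noteq> 1 \<Longrightarrow> t p [ys, zs] = 0"
  shows "wedge_map t p xs = (\<Sum>i<length xs. (- 1) ^ i * t p [[xs ! i], nths xs (- {i})])"
proof -
  let ?F = "\<lambda>S. (- 1) ^ card {(i, j). i \<in> S \<and> j \<in> {..<length xs} - S \<and> j < i} * t p [nths xs S, nths xs (- S)]"
  have len: "length (nths xs S) = card S" if "S \<subseteq> {..<length xs}" for S
  proof -
    have "{i. i < length xs \<and> i \<in> S} = S" using that by auto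
    then show ?thesis by (simp add: length_nths)
  qed
  have "(\<Sum>S\<in>Pow {..<length xs}. ?F S) = (\<Sum>S\<in>(\<lambda>i. {i}) ` {..<length xs}. ?F S)"
  proof (rule sum.mono_neutral_right)
    show "\<forall>S\<in>Pow {..<length xs} - (\<lambda>i. {i}) ` {..<length xs}. ?F S = 0"
    proof
      fix S assume S: "S \<in> Pow {..<length xs} - (\<lambda>i. {i}) ` {..<length xs}"
      then have "card S \<noteq> 1" by (auto simp: card_1_singleton_iff)
      then show "?F S = 0" using S len[of S] assms by auto
    qed
  qed auto
  also have "\<dots> = (\<Sum>i<length xs. ?F {i})"
    by (subst sum.reindex) auto
  also have "\<dots> = (\<Sum>i<length xs. (- 1) ^ i * t p [[xs ! i], nths xs (- {i})])"
  proof (rule sum.cong)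
    fix i assume i: "i \<in> {..<length xs}"
    have "{(i', j). i' \<in> {i} \<and> j \<in> {..<length xs} - {i} \<and> j < i'} = (\<lambda>j. (i, j)) ` {..<i}"
      using i by auto
    then have "card {(i', j). i' \<in> {i} \<and> j \<in> {..<length xs} - {i} \<and> j < i'} = i"
      by (simp add: card_image inj_on_def)
    moreover have "nths xs {i} = [xs ! i]"
    proof -
      have "{j. j < length xs \<and> j \<in> {i}} = {i}" using i by auto
      then have "length (nths xs {i}) = 1" by (simp add: length_nths)
      moreover have "set (nths xs {i}) = {xs ! i}" using i by (auto simp: set_nths)
      ultimately show ?thesis by (auto simp: length_Suc_conv)
    qed
    ultimately show "?F {i} = (- 1) ^ i * t p [[xs ! i], nths xs (- {i})]" by simp
  qed simp
  finally show ?thesis by (simp add: wedge_map_def)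
qed

lemma wedge_ext_prod:
  assumes "\<And>ys. length ys \<noteq> 1 \<Longrightarrow> \<omega> p ys = 0"
  shows "wedge \<omega> \<eta> p xs = ext_prod (\<lambda>x. \<omega> p [x]) (\<eta> p) xs"
proof -
  have t: "tensor_list [\<omega>, \<eta>] p [ys, zs] = \<omega> p ys * \<eta> p zs" for ys zs
    by (simp add: tensor_list_def lessThan_Suc mult.commute)
  show ?thesis
    unfolding wedge_def ext_prod_def by (subst wedge_map_ext_prod) (auto simp: t assms)
qed

section \<open>Algebra of multilinear and alternating forms on complexified tangent spaces\<close>

context manifold begin

lemma multilinear_update:
  assumes "multilinear A p k \<theta>" "Y \<in> ctangent A p" "Z \<in> ctangent A p" "i < length xs"
  shows "\<theta> (xs[i := (\<lambda>g. Y g + c * Z g)]) = \<theta> (xs[i := Y]) + c * \<theta> (xs[i := Z])"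
\<comment> \<open>The entry at \<open>i\<close> is overwritten, so it need not be tangent. If the
  length or another entry is bad, all three values are the default \<open>0\<close>.\<close>
proof (cases "length xs = k \<and> (\<forall>j<length xs. j \<noteq> i \<longrightarrow> xs ! j \<in> ctangent A p)")
  case True
  then have "set (xs[i := Y]) \<subseteq> ctangent A p"
    using assms by (auto simp: in_set_conv_nth nth_list_update)
  then have "\<theta> (xs[i := Y, i := (\<lambda>g. Y g + c * Z g)]) = \<theta> (xs[i := Y, i := Y]) + c * \<theta> (xs[i := Y, i := Z])"
    using assms True by (simp add: multilinear_def del: list_update_overwrite)
  then show ?thesis by simp
next
  case False
  have "\<theta> (xs[i := W]) = 0" for W
  proof (rule multilinear_support[OF assms(1)])
    show "length (xs[i := W]) \<noteq> k \<or> \<not> set (xs[i := W]) \<subseteq> ctangent A p"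
      using False by (force simp: set_conv_nth subset_eq nth_list_update)
  qed
  then show ?thesis by simp
qed

lemma multilinear_head:
  assumes "multilinear A p k \<theta>" "Y \<in> ctangent A p" "Z \<in> ctangent A p"
  shows "\<theta> ((\<lambda>g. Y g + c * Z g) # xs) = \<theta> (Y # xs) + c * \<theta> (Z # xs)"
  using multilinear_update[OF assms, of 0 "Y # xs"] by simp

lemma multilinear_tail:
  assumes "multilinear A p (Suc k) \<theta>" "x \<in> ctangent A p"
  shows "multilinear A p k (\<lambda>xs. \<theta> (x # xs))"
  unfolding multilinear_def
proof (intro conjI allI impI; (elim conjE)?)
  show "\<theta> (x # xs) = 0" if "\<not> (length xs = k \<and> set xs \<subseteq> ctangent A p)" for xs
    using that by (intro multilinear_support[OF assms(1)]) auto
  show "\<theta> (x # xs[i := \<lambda>g. Y g + c * Z g]) = \<theta> (x # xs[i := Y]) + c * \<theta> (x # xs[i := Z])"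
    if "i < k" "length xs = k" "Y \<in> ctangent A p" "Z \<in> ctangent A p" for xs i Y Z c
    using multilinear_update[OF assms(1) that(3,4), of "Suc i" "x # xs"] that by simp
qed

lemma multilinear_SucI:
  assumes supp: "\<And>xs. length xs \<noteq> Suc k \<or> \<not> set xs \<subseteq> ctangent A p \<Longrightarrow> \<theta> xs = 0"
    and head: "\<And>xs Y Z c. length xs = k \<Longrightarrow> set xs \<subseteq> ctangent A p \<Longrightarrow> Y \<in> ctangent A p \<Longrightarrow>
       Z \<in> ctangent A p \<Longrightarrow> \<theta> ((\<lambda>g. Y g + c * Z g) # xs) = \<theta> (Y # xs) + c * \<theta> (Z # xs)"
    and tail: "\<And>x. x \<in> ctangent A p \<Longrightarrow> multilinear A p k (\<lambda>xs. \<theta> (x # xs))"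
  shows "multilinear A p (Suc k) \<theta>"
  unfolding multilinear_def
proof (intro conjI allI impI; (elim conjE)?)
  show "\<theta> xs = 0" if "\<not> (length xs = Suc k \<and> set xs \<subseteq> ctangent A p)" for xs
    using that supp by blast
  fix xs :: "'a ctvec list" and i Y Z c
  assume a: "length xs = Suc k" "set xs \<subseteq> ctangent A p" "i < Suc k" "Y \<in> ctangent A p" "Z \<in> ctangent A p"
  then obtain x ys where xs: "xs = x # ys" by (cases xs) auto
  show "\<theta> (xs[i := \<lambda>g. Y g + c * Z g]) = \<theta> (xs[i := Y]) + c * \<theta> (xs[i := Z])"
  proof (cases i)
    case 0
    then show ?thesis using head a xs by simp
  next
    case (Suc j)
    then show ?thesis using multilinear_update[OF tail, of x Y Z j ys c] a xs by simp
  qed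
qed

lemma multilinear_zero: "multilinear A p k \<theta> \<Longrightarrow> \<theta> ((\<lambda>g. 0) # xs) = 0"
  using multilinear_head[of p k \<theta> "\<lambda>g. 0" "\<lambda>g. 0" 1 xs] ctangent_zero by simp

lemma multilinear_scale:
  "multilinear A p k \<theta> \<Longrightarrow> Y \<in> ctangent A p \<Longrightarrow> \<theta> ((\<lambda>g. c * Y g) # xs) = c * \<theta> (Y # xs)"
  using multilinear_head[of p k \<theta> "\<lambda>g. 0" Y c xs] multilinear_zero[of p k \<theta> xs] ctangent_zero by simp

lemma multilinear_sum:
  assumes "multilinear A p k \<theta>" "\<And>i. i \<in> I \<Longrightarrow> Z i \<in> ctangent A p"
  shows "\<theta> ((\<lambda>g. \<Sum>i\<in>I. c i * Z i g) # xs) = (\<Sum>i\<in>I. c i * \<theta> (Z i # xs))"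
  using assms(2)
proof (induction I rule: infinite_finite_induct)
  case (insert i I)
  then have "\<theta> ((\<lambda>g. (\<Sum>i\<in>I. c i * Z i g) + c i * Z i g) # xs)
      = \<theta> ((\<lambda>g. \<Sum>i\<in>I. c i * Z i g) # xs) + c i * \<theta> (Z i # xs)"
    by (intro multilinear_head[OF assms(1)] ctangent_sum) auto
  then show ?case using insert by (simp add: add.commute)
qed (use multilinear_zero[OF assms(1)] in auto)

lemma multilinear_zero_entry:
  assumes "multilinear A p k \<theta>" "(\<lambda>g. 0) \<in> set xs"
  shows "\<theta> xs = 0"
  using assms
proof (induction xs arbitrary: k \<theta>)
  case (Cons x xs)
  show ?case
  proof (cases "x = (\<lambda>g. 0)")
    case True
    then show ?thesis using multilinear_zero[OF Cons.prems(1)] by simp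
  next
    case False
    show ?thesis
    proof (cases "k = 0 \<or> x \<notin> ctangent A p")
      case True
      then show ?thesis using multilinear_support[OF Cons.prems(1)] by auto
    next
      case k: False
      then obtain l where "k = Suc l" by (cases k) auto
      then show ?thesis
        using Cons.IH[of l "\<lambda>xs. \<theta> (x # xs)"] Cons.prems False k multilinear_tail by auto
    qed
  qed
qed simp

lemma multilinear_lincomb:
  assumes "multilinear A p k \<theta>" "multilinear A p k \<theta>'"
  shows "multilinear A p k (\<lambda>xs. \<theta> xs + c * \<theta>' xs)"
  using assms unfolding multilinear_def by (auto simp: algebra_simps)

lemma multilinear_eqI:
  assumes "multilinear A p k \<theta>" "multilinear A p k \<theta>'"
    and "\<And>i. i < N \<Longrightarrow> E i \<in> ctangent A p"
    and "\<And>Y. Y \<in> ctangent A p \<Longrightarrow> \<exists>c. Y = (\<lambda>g. \<Sum>i<N. c i * E i g)"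
    and "\<And>js. length js = k \<Longrightarrow> set js \<subseteq> {..<N} \<Longrightarrow> \<theta> (map E js) = \<theta>' (map E js)"
  shows "\<theta> = \<theta>'"
proof
  fix xs
  show "\<theta> xs = \<theta>' xs"
    using assms(1,2,5)
  proof (induction xs arbitrary: k \<theta> \<theta>')
    case Nil
    then show ?case
      using multilinear_support[of A p k \<theta> "[]"] multilinear_support[of A p k \<theta>' "[]"]
      by (cases "k = 0") auto
  next
    case (Cons x xs)
    show ?case
    proof (cases "k = 0 \<or> x \<notin> ctangent A p")
      case True
      then show ?thesis
        using multilinear_support[OF Cons.prems(1)] multilinear_support[OF Cons.prems(2)] by auto
    next
      case False
      then obtain l where k: "k = Suc l" by (cases k) auto
      from False assms(4) obtain c where x: "x = (\<lambda>g. \<Sum>i<N. c i * E i g)" by blast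
      have "\<theta> (E i # xs) = \<theta>' (E i # xs)" if "i < N" for i
      proof (rule Cons.IH)
        show "multilinear A p l (\<lambda>xs. \<theta> (E i # xs))" "multilinear A p l (\<lambda>xs. \<theta>' (E i # xs))"
          using Cons.prems k that assms(3) multilinear_tail by auto
        show "\<theta> (E i # map E js) = \<theta>' (E i # map E js)" if "length js = l" "set js \<subseteq> {..<N}" for js
          using Cons.prems(3)[of "i # js"] k that \<open>i < N\<close> by simp
      qed
      then show ?thesis
        unfolding x
        using multilinear_sum[OF Cons.prems(1), of "{..<N}" E c xs]
          multilinear_sum[OF Cons.prems(2), of "{..<N}" E c xs] assms(3) by simp
    qed
  qed
qed

lemma covector_lincomb:
  assumes "covector A p k \<theta>" "covector A p k \<theta>'"
  shows "covector A p k (\<lambda>xs. \<theta> xs + c * \<theta>' xs)"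
  unfolding covector_iff_multilinear
  using assms by (auto simp: covector_iff_multilinear multilinear_lincomb)

lemma covector_zero: "covector A p k (\<lambda>xs. 0)"
  by (simp add: covector_def)

lemma covector_sum:
  "(\<And>i. i \<in> I \<Longrightarrow> covector A p k (\<theta> i)) \<Longrightarrow> covector A p k (\<lambda>xs. \<Sum>i\<in>I. c i * \<theta> i xs)"
proof (induction I rule: infinite_finite_induct)
  case (insert i I)
  then have "covector A p k (\<lambda>xs. (\<Sum>i\<in>I. c i * \<theta> i xs) + c i * \<theta> i xs)"
    by (intro covector_lincomb) auto
  then show ?case using insert by (simp add: add.commute)
qed (auto intro: covector_zero)

lemma covector_tail:
  assumes "covector A p (Suc k) \<theta>" "x \<in> ctangent A p"
  shows "covector A p k (\<lambda>xs. \<theta> (x # xs))"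
  unfolding covector_iff_multilinear
proof (intro conjI allI impI; (elim conjE)?)
  show "multilinear A p k (\<lambda>xs. \<theta> (x # xs))"
    by (intro multilinear_tail covector_multilinear assms)
  show "\<theta> (x # xs) = 0" if "length xs = k" "set xs \<subseteq> ctangent A p" "i < j" "j < k" "xs ! i = xs ! j"
    for xs i j
  proof -
    have "length (x # xs) = Suc k \<and> set (x # xs) \<subseteq> ctangent A p \<and> Suc i < Suc j \<and> Suc j < Suc k \<and>
        (x # xs) ! Suc i = (x # xs) ! Suc j"
      using that assms by simp
    then show ?thesis using assms(1) unfolding covector_def by blast
  qed
qed

lemma covector_not_distinct:
  assumes "covector A p k \<theta>" "\<not> distinct xs"
  shows "\<theta> xs = 0"
proof (cases "length xs = k \<and> set xs \<subseteq> ctangent A p")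
  case True
  from assms(2) obtain i j where "i < j" "j < length xs" "xs ! i = xs ! j"
    by (metis distinct_conv_nth linorder_neqE_nat)
  then show ?thesis using True assms(1) unfolding covector_def by blast
next
  case False
  then show ?thesis using assms(1) unfolding covector_def by blast
qed

lemma covector_swap:
  assumes "covector A p k \<theta>"
  shows "\<theta> (x # y # zs) = - \<theta> (y # x # zs)"
proof (cases "k \<ge> 2 \<and> x \<in> ctangent A p \<and> y \<in> ctangent A p")
  case True
  then obtain l where k: "k = Suc l" by (cases k) auto
  \<comment> \<open>Polarization: the form vanishes on a repeated argument \<open>x + y\<close>, and
    expanding both slots leaves the two swapped terms.\<close>
  let ?s = "\<lambda>g. x g + 1 * y g"
  have x: "x \<in> ctangent A p" and y: "y \<in> ctangent A p" using True by auto
  then have s: "?s \<in> ctangent A p" by (intro ctangent_lincomb)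
  note m = covector_multilinear[OF assms]
  have h: "\<theta> (?s # zs') = \<theta> (x # zs') + \<theta> (y # zs')" for zs'
    using multilinear_head[OF m x y, of 1 zs'] by simp
  have t: "\<theta> (u # ?s # zs) = \<theta> (u # x # zs) + \<theta> (u # y # zs)" if "u \<in> ctangent A p" for u
    using multilinear_head[OF multilinear_tail[OF m[unfolded k] that] x y, of 1 zs] by simp
  have 0: "\<theta> (u # u # zs) = 0" for u
    by (rule covector_not_distinct[OF assms]) simp
  show ?thesis
    using 0[of ?s] 0[of x] 0[of y] h[of "?s # zs"] t[OF x] t[OF y]
    by (simp add: eq_neg_iff_add_eq_0)
next
  case False
  then have "\<theta> (x # y # zs) = 0" "\<theta> (y # x # zs) = 0"
    by (auto intro!: multilinear_support[OF covector_multilinear[OF assms]])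
  then show ?thesis by simp
qed

lemma covector_move_to_front:
  assumes "covector A p k \<theta>"
  shows "\<theta> (us @ x # vs) = (- 1) ^ length us * \<theta> (x # us @ vs)"
  using assms
proof (induction us arbitrary: k \<theta>)
  case (Cons u us)
  show ?case
  proof (cases "k = 0 \<or> u \<notin> ctangent A p")
    case True
    then have "\<theta> (u # us @ x # vs) = 0" "\<theta> (x # u # us @ vs) = 0"
      by (auto intro!: multilinear_support[OF covector_multilinear[OF Cons.prems]])
    then show ?thesis by simp
  next
    case False
    then obtain l where k: "k = Suc l" by (cases k) auto
    then show ?thesis
      using Cons.IH[of l "\<lambda>xs. \<theta> (u # xs)"] covector_tail[of p l \<theta> u] Cons.prems False
        covector_swap[OF Cons.prems, of u x "us @ vs"] by simp
  qed
qed simp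

text \<open>A permutation of the arguments changes the value only by a sign. Restricting the claim
  to vanishing avoids tracking that sign.\<close>

lemma covector_mset:
  assumes "covector A p k \<theta>" "mset xs = mset ys" "\<theta> ys = 0"
  shows "\<theta> xs = 0"
  using assms
proof (induction xs arbitrary: ys k \<theta>)
  case (Cons x xs)
  then have "x \<in> set ys" by (metis list.set_intros(1) mset_eq_setD)
  then obtain us vs where ys: "ys = us @ x # vs" by (meson split_list)
  show ?case
  proof (cases "k = 0 \<or> x \<notin> ctangent A p")
    case True
    then show ?thesis
      by (auto intro!: multilinear_support[OF covector_multilinear[OF Cons.prems(1)]])
  next
    case False
    then obtain l where k: "k = Suc l" by (cases k) auto
    show ?thesis
    proof (rule Cons.IH)
      show "covector A p l (\<lambda>xs. \<theta> (x # xs))"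
        using False k Cons.prems(1) covector_tail[of p l \<theta> x] by simp
      show "mset xs = mset (us @ vs)" using Cons.prems(2) ys by simp
      show "\<theta> (x # us @ vs) = 0"
        using Cons.prems(3) covector_move_to_front[OF Cons.prems(1), of us x vs] ys by simp
    qed
  qed
qed simp

text \<open>A repeated index gives \<open>0\<close>, so only strictly increasing index lists remain.
  It is applied to differences of two covectors, to prove that they agree.\<close>

lemma covector_strictly_sorted:
  fixes js :: "nat list"
  assumes "covector A p k \<theta>"
    and "distinct (sort js) \<Longrightarrow> \<theta> (map E (sort js)) = 0"
  shows "\<theta> (map E js) = 0"
proof (rule covector_mset[OF assms(1)])
  show "mset (map E js) = mset (map E (sort js))" by simp
  show "\<theta> (map E (sort js)) = 0"
  proof (cases "distinct (sort js)")
    case True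
    then show ?thesis using assms(2) by simp
  next
    case False
    then have "\<not> distinct (map E (sort js))" by (simp add: distinct_map)
    then show ?thesis using covector_not_distinct[OF assms(1)] by blast
  qed
qed

text \<open>Alternation is only required in the first two slots: the tails take care of the others.\<close>

lemma covector_SucI:
  assumes supp: "\<And>xs. length xs \<noteq> Suc k \<or> \<not> set xs \<subseteq> ctangent A p \<Longrightarrow> \<theta> xs = 0"
    and head: "\<And>xs Y Z c. length xs = k \<Longrightarrow> set xs \<subseteq> ctangent A p \<Longrightarrow> Y \<in> ctangent A p \<Longrightarrow>
       Z \<in> ctangent A p \<Longrightarrow> \<theta> ((\<lambda>g. Y g + c * Z g) # xs) = \<theta> (Y # xs) + c * \<theta> (Z # xs)"
    and alt: "\<And>x xs. Suc (length xs) = k \<Longrightarrow> set (x # xs) \<subseteq> ctangent A p \<Longrightarrow> \<theta> (x # x # xs) = 0"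
    and tail: "\<And>x. x \<in> ctangent A p \<Longrightarrow> covector A p k (\<lambda>xs. \<theta> (x # xs))"
  shows "covector A p (Suc k) \<theta>"
  unfolding covector_iff_multilinear
proof (intro conjI allI impI; (elim conjE)?)
  show "multilinear A p (Suc k) \<theta>"
    by (intro multilinear_SucI supp head covector_multilinear[OF tail])
  fix xs :: "'a ctvec list" and i j
  assume a: "length xs = Suc k" "set xs \<subseteq> ctangent A p" "i < j" "j < Suc k" "xs ! i = xs ! j"
  then obtain x ys where xs: "xs = x # ys" by (cases xs) auto
  note t = tail[of x]
  show "\<theta> xs = 0"
  proof (cases i)
    case 0
    then have "x \<in> set ys" using a xs by (cases j) auto
    then obtain us vs where ys: "ys = us @ x # vs" by (meson split_list)
    then show ?thesis
      using covector_move_to_front[OF t, of us x vs] alt[of "us @ vs" x] a xs by simp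
  next
    case (Suc l)
    then obtain j' where "j = Suc j'" using a by (cases j) auto
    then have "l < j'" "j' < length ys" "ys ! l = ys ! j'" using a xs Suc by auto
    then have "\<not> distinct ys" by (metis distinct_conv_nth less_irrefl less_trans)
    then show ?thesis using covector_not_distinct[OF t] a xs by simp
  qed
qed

text \<open>By \<open>ext_prod_Cons\<close>, contraction with \<open>x\<close> leaves a multiple of
  \<open>\<theta>\<close> and an exterior product with a form of lower degree, so the induction
  varies \<open>\<theta>\<close>. For a doubled argument the two terms
  \<open>a x * \<theta> (x # xs)\<close> cancel.\<close>

lemma covector_ext_prod:
  assumes "\<And>x. x \<notin> ctangent A p \<Longrightarrow> a x = 0"
    and "\<And>Y Z c. Y \<in> ctangent A p \<Longrightarrow> Z \<in> ctangent A p \<Longrightarrow> a (\<lambda>g. Y g + c * Z g) = a Y + c * a Z"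
    and "covector A p k \<theta>"
  shows "covector A p (Suc k) (ext_prod a \<theta>)"
  using assms(3)
proof (induction k arbitrary: \<theta>)
  case 0
  then have t: "(\<lambda>ys. \<theta> (x # ys)) = (\<lambda>ys. 0)" for x by (auto simp: covector_0)
  have "ext_prod a \<theta> xs = 0" if "length xs \<noteq> Suc 0 \<or> \<not> set xs \<subseteq> ctangent A p" for xs
    using that 0 assms(1) t by (cases xs) (auto simp: ext_prod_Nil ext_prod_Cons ext_prod_zero covector_0)
  then show ?case
    using 0 assms(2) t
    by (intro covector_SucI) (auto simp: ext_prod_Cons ext_prod_zero covector_0 algebra_simps)
next
  case (Suc k)
  note m = covector_multilinear[OF Suc.prems]
  have z: "(\<lambda>ys. \<theta> (x # ys)) = (\<lambda>ys. 0)" if "x \<notin> ctangent A p" for x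
    using that multilinear_support[OF m] by auto
  show ?case
  proof (rule covector_SucI)
    fix xs :: "'a ctvec list"
    assume xs: "length xs \<noteq> Suc (Suc k) \<or> \<not> set xs \<subseteq> ctangent A p"
    show "ext_prod a \<theta> xs = 0"
    proof (cases xs)
      case (Cons x ys)
      show ?thesis
      proof (cases "x \<in> ctangent A p")
        case True
        then have "ext_prod a (\<lambda>ys. \<theta> (x # ys)) ys = 0" "\<theta> ys = 0"
          using multilinear_support[OF m, of ys] xs Cons
            multilinear_support[OF covector_multilinear[OF Suc.IH[OF covector_tail[OF Suc.prems True]]], of ys]
          by auto
        then show ?thesis by (simp add: Cons ext_prod_Cons)
      next
        case False
        then show ?thesis by (simp add: Cons ext_prod_Cons assms(1) z ext_prod_zero)
      qed
    qed (simp add: ext_prod_Nil)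
  next
    fix xs :: "'a ctvec list" and Y Z c
    assume "Y \<in> ctangent A p" "Z \<in> ctangent A p"
    then show "ext_prod a \<theta> ((\<lambda>g. Y g + c * Z g) # xs) = ext_prod a \<theta> (Y # xs) + c * ext_prod a \<theta> (Z # xs)"
      by (simp add: ext_prod_Cons assms(2) multilinear_head[OF m] ext_prod_lincomb algebra_simps)
  next
    fix x :: "'a ctvec" and xs
    assume "set (x # xs) \<subseteq> ctangent A p"
    have "(\<lambda>ys. \<theta> (x # x # ys)) = (\<lambda>ys. 0)"
      using covector_not_distinct[OF Suc.prems] by auto
    then show "ext_prod a \<theta> (x # x # xs) = 0"
      by (simp add: ext_prod_Cons ext_prod_zero)
  next
    fix x assume x: "x \<in> ctangent A p"
    have "covector A p (Suc k) (\<lambda>xs. a x * \<theta> xs + (-1) * ext_prod a (\<lambda>ys. \<theta> (x # ys)) xs)"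
      using covector_lincomb[OF covector_lincomb[OF covector_zero Suc.prems, of "a x"]
          Suc.IH[OF covector_tail[OF Suc.prems x]], of "-1"] by simp
    then show "covector A p (Suc k) (\<lambda>xs. ext_prod a \<theta> (x # xs))"
      by (simp add: ext_prod_Cons)
  qed
qed

end

section \<open>Exterior derivative\<close>

abbreviation ev :: "('b \<Rightarrow> 'c) list \<Rightarrow> 'b \<Rightarrow> 'c list" where
  "ev Xs p \<equiv> map (\<lambda>X. X p) Xs"

definition interior_prod :: "('a \<Rightarrow> 'a ctvec) \<Rightarrow> 'a form \<Rightarrow> 'a form" where
  "interior_prod X \<omega> = (\<lambda>p xs. \<omega> p (X p # xs))"

text \<open>The usual Lie derivative of \<open>\<omega>\<close> evaluated on fields, except that the
  bracket is moved from slot \<open>j\<close> to the front, at the cost of \<open>(- 1) ^ j\<close>.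
  In this shape it matches the bracket terms of \<open>koszul\<close>.\<close>

definition lie_deriv :: "('a \<Rightarrow> 'a ctvec) \<Rightarrow> 'a form \<Rightarrow> ('a \<Rightarrow> 'a ctvec) list \<Rightarrow> 'a \<Rightarrow> complex" where
  "lie_deriv X \<omega> Xs p = capply X (\<lambda>q. \<omega> q (ev Xs q)) p -
     (\<Sum>j<length Xs. (- 1) ^ j * \<omega> p (lie_bracket X (Xs ! j) p # ev (nths Xs (- {j})) p))"

lemma capply_lincomb_field:
  "capply (\<lambda>q g. Y q g + h q * Z q g) f p = capply Y f p + h p * capply Z f p"
  by (simp add: capply_def algebra_simps)

context manifold begin

text \<open>The analogue of \<open>covector\<close> for functionals of vector fields: linear over
  functions, with coefficients evaluated at \<open>p\<close>. Conditions are imposed only on the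
  head and the first two slots, since fixing a head field passes to the tail; this is the shape that
  \<open>covector_SucI\<close> consumes.\<close>

primrec tensorial :: "nat \<Rightarrow> 'a \<Rightarrow> (('a \<Rightarrow> 'a ctvec) list \<Rightarrow> complex) \<Rightarrow> bool" where
  "tensorial 0 p \<Phi> \<longleftrightarrow> True"
| "tensorial (Suc k) p \<Phi> \<longleftrightarrow>
     (\<forall>Y Z h Xs. cvector_field A Y \<and> cvector_field A Z \<and> smooth_fun A h \<and> length Xs = k \<and>
        (\<forall>X\<in>set Xs. cvector_field A X) \<longrightarrow>
        \<Phi> ((\<lambda>q g. Y q g + h q * Z q g) # Xs) = \<Phi> (Y # Xs) + h p * \<Phi> (Z # Xs)) \<and>
     (\<forall>X Xs. Suc (length Xs) = k \<and> (\<forall>X\<in>set (X # Xs). cvector_field A X) \<longrightarrow> \<Phi> (X # X # Xs) = 0) \<and>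
     (\<forall>X. cvector_field A X \<longrightarrow> tensorial k p (\<lambda>Xs. \<Phi> (X # Xs)))"

lemma tensorial_head:
  "tensorial (Suc k) p \<Phi> \<Longrightarrow> cvector_field A Y \<Longrightarrow> cvector_field A Z \<Longrightarrow> smooth_fun A h \<Longrightarrow>
     length Xs = k \<Longrightarrow> \<forall>X\<in>set Xs. cvector_field A X \<Longrightarrow>
     \<Phi> ((\<lambda>q g. Y q g + h q * Z q g) # Xs) = \<Phi> (Y # Xs) + h p * \<Phi> (Z # Xs)"
  by simp

lemma tensorial_tail: "tensorial (Suc k) p \<Phi> \<Longrightarrow> cvector_field A X \<Longrightarrow> tensorial k p (\<lambda>Xs. \<Phi> (X # Xs))"
  by simp

lemma tensorial_lincomb:
  "tensorial k p \<Phi> \<Longrightarrow> tensorial k p \<Psi> \<Longrightarrow> tensorial k p (\<lambda>Xs. \<Phi> Xs + c * \<Psi> Xs)"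
proof (induction k arbitrary: \<Phi> \<Psi>)
  case (Suc k)
  have "tensorial k p (\<lambda>Xs. \<Phi> (X # Xs) + c * \<Psi> (X # Xs))" if "cvector_field A X" for X
    by (rule Suc.IH) (use Suc.prems that in auto)
  then show ?case using Suc.prems by (auto simp: algebra_simps)
qed simp

lemma tensorial_covector: "covector A p k \<theta> \<Longrightarrow> tensorial k p (\<lambda>Xs. \<theta> (ev Xs p))"
proof (induction k arbitrary: \<theta>)
  case (Suc k)
  have "tensorial k p (\<lambda>Xs. \<theta> (X p # ev Xs p))" if "cvector_field A X" for X
    using Suc.IH[OF covector_tail[OF Suc.prems cvector_field_ctangent[OF that]]] .
  moreover have "\<theta> (x # x # xs) = 0" for x xs
    by (rule covector_not_distinct[OF Suc.prems]) simp
  ultimately show ?case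
    using multilinear_head[OF covector_multilinear[OF Suc.prems]]
    by (simp add: cvector_field_ctangent)
qed simp

lemma kform_covector: "kform A k \<omega> \<Longrightarrow> covector A p k (\<omega> p)"
  by (simp add: kform_def)

lemma kform_multilinear: "kform A k \<omega> \<Longrightarrow> multilinear A p k (\<omega> p)"
  by (simp add: kform_def covector_multilinear)

lemma kform_smooth:
  "kform A k \<omega> \<Longrightarrow> \<forall>X\<in>set Xs. cvector_field A X \<Longrightarrow> smooth_fun A (\<lambda>p. \<omega> p (ev Xs p))"
  by (simp add: kform_def)

lemma kform_interior_prod:
  assumes "kform A (Suc k) \<omega>" "cvector_field A X"
  shows "kform A k (interior_prod X \<omega>)"
  unfolding kform_def
proof (intro conjI allI impI)
  show "covector A p k (interior_prod X \<omega> p)" for p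
    unfolding interior_prod_def using covector_tail[OF kform_covector cvector_field_ctangent] assms by simp
  show "smooth_fun A (\<lambda>p. interior_prod X \<omega> p (ev Xs p))" if "\<forall>X\<in>set Xs. cvector_field A X" for Xs
    using kform_smooth[OF assms(1), of "X # Xs"] assms(2) that by (simp add: interior_prod_def)
qed

lemma kform_lincomb:
  assumes "kform A k \<omega>" "kform A k \<omega>'" "smooth_fun A h"
  shows "kform A k (\<lambda>p xs. \<omega> p xs + h p * \<omega>' p xs)"
  using assms by (simp add: kform_def covector_lincomb smooth_fun_add smooth_fun_mult)

lemma kform_zero: "kform A k (\<lambda>p xs. 0)"
  by (simp add: kform_def covector_zero smooth_fun_const)

lemma interior_prod_lincomb:
  assumes "kform A k \<omega>" "cvector_field A Y" "cvector_field A Z"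
  shows "interior_prod (\<lambda>q g. Y q g + h q * Z q g) \<omega> = (\<lambda>p xs. interior_prod Y \<omega> p xs + h p * interior_prod Z \<omega> p xs)"
  by (simp add: interior_prod_def multilinear_head[OF kform_multilinear[OF assms(1)]]
      cvector_field_ctangent assms(2,3))

lemma interior_prod_self:
  "kform A k \<omega> \<Longrightarrow> interior_prod X (interior_prod X \<omega>) = (\<lambda>p xs. 0)"
  by (auto simp: interior_prod_def intro!: ext covector_not_distinct[OF kform_covector])

text \<open>The Leibniz rule of the Lie derivative for a function coefficient, with the additional
  term \<open>capply X h p\<close>.\<close>

lemma lie_deriv_lincomb_form:
  assumes "kform A k \<omega>" "kform A k \<omega>'" "smooth_fun A h" "cvector_field A X"
    "\<forall>X\<in>set Xs. cvector_field A X"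
  shows "lie_deriv X (\<lambda>p xs. \<omega> p xs + h p * \<omega>' p xs) Xs p
    = lie_deriv X \<omega> Xs p + h p * lie_deriv X \<omega>' Xs p + capply X h p * \<omega>' p (ev Xs p)"
  using kform_smooth[OF assms(1,5)] kform_smooth[OF assms(2,5)] assms(3,4)
  by (simp add: lie_deriv_def capply_add capply_mult cvector_field_ctangent smooth_fun_mult
      sum.distrib sum_distrib_left algebra_simps)

text \<open>The commutator of the Lie derivative along \<open>X\<close> with contraction by
  \<open>Y\<close> is contraction by the bracket of \<open>X\<close> and \<open>Y\<close>. It lowers
  the degree in inductions.\<close>

lemma lie_deriv_Cons:
  assumes "kform A k \<omega>"
  shows "lie_deriv X \<omega> (Y # Ys) p = lie_deriv X (interior_prod Y \<omega>) Ys p - \<omega> p (lie_bracket X Y p # ev Ys p)"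
proof -
  have "\<omega> p (b # Y p # ys) = - \<omega> p (Y p # b # ys)" for b ys
    by (rule covector_swap[OF kform_covector[OF assms]])
  then show ?thesis
    by (simp add: lie_deriv_def interior_prod_def sum.lessThan_Suc_shift nths_Cons_omit_0
        nths_Cons_omit_Suc sum_negf del: sum.lessThan_Suc)
qed

text \<open>In the head slot the derivative of \<open>h\<close> arises twice with opposite signs:
  from the coefficient of \<open>interior_prod Z \<omega>\<close>, and from the bracket of
  \<open>X\<close> with \<open>h Z\<close>. On a doubled argument \<open>Y\<close> the two bracket
  terms differ by one swap and cancel.\<close>

lemma tensorial_lie_deriv:
  assumes "kform A k \<omega>" "cvector_field A X"
  shows "tensorial k p (\<lambda>Xs. lie_deriv X \<omega> Xs p)"
  using assms(1)
proof (induction k arbitrary: \<omega>)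
  case (Suc k)
  note C = lie_deriv_Cons[OF Suc.prems]
  have head: "lie_deriv X \<omega> ((\<lambda>q g. Y q g + h q * Z q g) # Xs) p
      = lie_deriv X \<omega> (Y # Xs) p + h p * lie_deriv X \<omega> (Z # Xs) p"
    if Y: "cvector_field A Y" and Z: "cvector_field A Z" and h: "smooth_fun A h"
      and Xs: "\<forall>X\<in>set Xs. cvector_field A X" for Y Z h Xs
  proof -
    note l = multilinear_head[OF kform_multilinear[OF Suc.prems]]
    have "\<omega> p (lie_bracket X (\<lambda>q g. Y q g + h q * Z q g) p # ev Xs p) =
      \<omega> p (lie_bracket X Y p # ev Xs p) + h p * \<omega> p (lie_bracket X Z p # ev Xs p) +
      capply X h p * \<omega> p (Z p # ev Xs p)"
      unfolding lie_bracket_lincomb_right[OF assms(2) Y Z h]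
      by (simp add: l ctangent_lincomb lie_bracket_ctangent assms(2) Y Z cvector_field_ctangent)
    then show ?thesis
      unfolding C interior_prod_lincomb[OF Suc.prems Y Z]
        lie_deriv_lincomb_form[OF kform_interior_prod[OF Suc.prems Y] kform_interior_prod[OF Suc.prems Z] h assms(2) Xs]
      by (simp add: interior_prod_def algebra_simps)
  qed
  have alt: "lie_deriv X \<omega> (Y # Y # Xs) p = 0"
    if "Suc (length Xs) = k" and Y: "cvector_field A Y" for Y Xs
  proof -
    have z: "lie_deriv X (\<lambda>p xs. 0) Xs p = 0"
      by (simp add: lie_deriv_def capply_const cvector_field_ctangent assms(2))
    show ?thesis
      unfolding C lie_deriv_Cons[OF kform_interior_prod[OF Suc.prems Y]] interior_prod_self[OF Suc.prems]
      using covector_swap[OF kform_covector[OF Suc.prems], of p "Y p" "lie_bracket X Y p" "ev Xs p"]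
      by (simp add: interior_prod_def z)
  qed
  have tail: "tensorial k p (\<lambda>Xs. lie_deriv X \<omega> (Y # Xs) p)" if Y: "cvector_field A Y" for Y
  proof -
    have "tensorial k p (\<lambda>Xs. lie_deriv X (interior_prod Y \<omega>) Xs p + (-1) * \<omega> p (lie_bracket X Y p # ev Xs p))"
      by (intro tensorial_lincomb Suc.IH kform_interior_prod[OF Suc.prems Y]
          tensorial_covector[OF covector_tail[OF kform_covector[OF Suc.prems]]] lie_bracket_ctangent assms(2) Y)
    then show ?thesis by (simp add: C)
  qed
  show ?case using head alt tail by simp
qed simp

lemma koszul_Nil: "koszul \<omega> [] p = 0"
  by (simp add: koszul_def)

text \<open>Cartan's formula, by separating the terms in which the head takes part. The index pairs
  \<open>(0, Suc j)\<close> are the bracket terms of \<open>lie_deriv\<close>. The shifted pairs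
  keep their parity and receive a minus sign because \<open>X\<close> has to pass the bracket
  standing in front.\<close>

lemma koszul_Cons:
  assumes "kform A k \<omega>"
  shows "koszul \<omega> (X # Xs) p = lie_deriv X \<omega> Xs p - koszul (interior_prod X \<omega>) Xs p"
proof -
  let ?n = "length Xs" and ?X = "X # Xs"
  let ?P = "{(i, j). i < j \<and> j < ?n}"
  let ?G = "\<lambda>(i, j). (- 1) ^ (i + j) * \<omega> p (ev (lie_bracket (?X ! i) (?X ! j) # nths ?X (- {i, j})) p)"
  have sw: "\<omega> p (b # X p # ys) = - \<omega> p (X p # b # ys)" for b ys
    by (rule covector_swap[OF kform_covector[OF assms]])
  have fin: "finite ?P"
    by (rule finite_subset[of _ "{..<?n} \<times> {..<?n}"]) auto
  have P: "{(i, j). i < j \<and> j < length ?X} = (\<lambda>j. (0, Suc j)) ` {..<?n} \<union> (\<lambda>(i, j). (Suc i, Suc j)) ` ?P"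
    (is "?L = ?A \<union> ?B")
  proof (intro equalityI subsetI)
    fix z assume "z \<in> ?L"
    then obtain i j where z: "z = (i, j)" "i < j" "j < Suc ?n" by auto
    then obtain j' where j: "j = Suc j'" by (cases j) auto
    show "z \<in> ?A \<union> ?B" using z j by (cases i) auto
  qed auto
  have G: "sum ?G {(i, j). i < j \<and> j < length ?X} = sum ?G ?A + sum ?G ?B"
    unfolding P by (rule sum.union_disjoint) (use fin in auto)
  have GA: "sum ?G ?A = (\<Sum>j<?n. - ((- 1) ^ j * \<omega> p (lie_bracket X (Xs ! j) p # ev (nths Xs (- {j})) p)))"
    by (subst sum.reindex) (auto simp: inj_on_def nths_Cons_omit_0_Suc)
  have GB: "sum ?G ?B = (\<Sum>(i, j)\<in>?P. - ((- 1) ^ (i + j) *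
      interior_prod X \<omega> p (ev (lie_bracket (Xs ! i) (Xs ! j) # nths Xs (- {i, j})) p)))"
    by (subst sum.reindex) (auto simp: inj_on_def nths_Cons_omit_Suc_Suc sw interior_prod_def intro!: sum.cong)
  have F: "(\<Sum>i<length ?X. (- 1) ^ i * capply (?X ! i) (\<lambda>q. \<omega> q (ev (nths ?X (- {i})) q)) p)
      = capply X (\<lambda>q. \<omega> q (ev Xs q)) p -
        (\<Sum>i<?n. (- 1) ^ i * capply (Xs ! i) (\<lambda>q. interior_prod X \<omega> q (ev (nths Xs (- {i})) q)) p)"
    by (simp add: sum.lessThan_Suc_shift nths_Cons_omit_0 nths_Cons_omit_Suc interior_prod_def sum_negf
        del: sum.lessThan_Suc)
  show ?thesis
    unfolding koszul_def G GA GB F lie_deriv_def by (simp add: sum_negf case_prod_unfold)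
qed

text \<open>The Leibniz rule for \<open>d\<close> of a function times a form; the extra sum is the
  exterior product of \<open>dh\<close> with \<open>\<omega>'\<close>.\<close>

lemma koszul_lincomb_form:
  assumes "kform A k \<omega>" "kform A k \<omega>'" "smooth_fun A h" "\<forall>X\<in>set Xs. cvector_field A X"
  shows "koszul (\<lambda>p xs. \<omega> p xs + h p * \<omega>' p xs) Xs p
    = koszul \<omega> Xs p + h p * koszul \<omega>' Xs p +
      (\<Sum>i<length Xs. (- 1) ^ i * (capply (Xs ! i) h p * \<omega>' p (ev (nths Xs (- {i})) p)))"
proof -
  have "capply (Xs ! i) (\<lambda>q. \<omega> q (ev (nths Xs (- {i})) q) + h q * \<omega>' q (ev (nths Xs (- {i})) q)) p
      = capply (Xs ! i) (\<lambda>q. \<omega> q (ev (nths Xs (- {i})) q)) p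
      + (h p * capply (Xs ! i) (\<lambda>q. \<omega>' q (ev (nths Xs (- {i})) q)) p
      + \<omega>' p (ev (nths Xs (- {i})) p) * capply (Xs ! i) h p)" if "i < length Xs" for i
  proof -
    have s: "\<forall>X\<in>set (nths Xs (- {i})). cvector_field A X"
      using assms(4) by (meson in_set_nthsD)
    show ?thesis
      using kform_smooth[OF assms(1) s] kform_smooth[OF assms(2) s] assms(3,4) that
      by (simp add: capply_add capply_mult cvector_field_ctangent smooth_fun_mult)
  qed
  then show ?thesis
    by (simp add: koszul_def sum.distrib sum_distrib_left algebra_simps case_prod_unfold)
qed

text \<open>For a head field \<open>h Z\<close>, both the Lie derivative and \<open>d\<close> of the
  contraction produce the product of \<open>dh\<close> with \<open>interior_prod Z \<omega>\<close>;
  Cartan's formula subtracts one from the other. For a doubled head both terms reduce to the Lie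
  derivative along \<open>X\<close> of \<open>interior_prod X \<omega>\<close>.\<close>

lemma tensorial_koszul:
  assumes "kform A k \<omega>"
  shows "tensorial (Suc k) p (\<lambda>Xs. koszul \<omega> Xs p)"
  using assms
proof (induction k arbitrary: \<omega>)
  case 0
  have "interior_prod X \<omega> = (\<lambda>p xs. 0)" for X
    using kform_covector[OF 0] by (auto simp: covector_0 interior_prod_def)
  then show ?case
    by (simp add: koszul_Cons[OF 0] lie_deriv_def koszul_Nil capply_lincomb_field)
next
  case (Suc k)
  note C = koszul_Cons[OF Suc.prems]
  have head: "koszul \<omega> ((\<lambda>q g. Y q g + h q * Z q g) # Xs) p = koszul \<omega> (Y # Xs) p + h p * koszul \<omega> (Z # Xs) p"
    if Y: "cvector_field A Y" and Z: "cvector_field A Z" and h: "smooth_fun A h"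
      and Xs: "\<forall>X\<in>set Xs. cvector_field A X" for Y Z h Xs
  proof -
    note l = multilinear_head[OF kform_multilinear[OF Suc.prems]]
    have br: "\<omega> p (lie_bracket (\<lambda>q g. Y q g + h q * Z q g) (Xs ! i) p # ys) =
      \<omega> p (lie_bracket Y (Xs ! i) p # ys) + h p * \<omega> p (lie_bracket Z (Xs ! i) p # ys) +
      (- capply (Xs ! i) h p) * \<omega> p (Z p # ys)" if "i < length Xs" for i ys
    proof -
      have Xi: "cvector_field A (Xs ! i)" using Xs that by simp
      show ?thesis
        unfolding lie_bracket_lincomb_left[OF Xi Y Z h]
          l[OF ctangent_lincomb[OF lie_bracket_ctangent[OF Y Xi] lie_bracket_ctangent[OF Z Xi]]
            cvector_field_ctangent[OF Z]]
          l[OF lie_bracket_ctangent[OF Y Xi] lie_bracket_ctangent[OF Z Xi]] by simp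
    qed
    have "(\<Sum>j<length Xs. (- 1) ^ j *
          \<omega> p (lie_bracket (\<lambda>q g. Y q g + h q * Z q g) (Xs ! j) p # ev (nths Xs (- {j})) p)) =
        (\<Sum>j<length Xs. (- 1) ^ j * \<omega> p (lie_bracket Y (Xs ! j) p # ev (nths Xs (- {j})) p)) +
        h p * (\<Sum>j<length Xs. (- 1) ^ j * \<omega> p (lie_bracket Z (Xs ! j) p # ev (nths Xs (- {j})) p)) -
        (\<Sum>j<length Xs. (- 1) ^ j * (capply (Xs ! j) h p * \<omega> p (Z p # ev (nths Xs (- {j})) p)))"
      unfolding sum_distrib_left sum.distrib[symmetric] sum_subtractf[symmetric]
      by (rule sum.cong) (simp_all add: br algebra_simps)
    then show ?thesis
      unfolding C interior_prod_lincomb[OF Suc.prems Y Z]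
        koszul_lincomb_form[OF kform_interior_prod[OF Suc.prems Y] kform_interior_prod[OF Suc.prems Z] h Xs]
      by (simp add: lie_deriv_def capply_lincomb_field interior_prod_def algebra_simps)
  qed
  have alt: "koszul \<omega> (X # X # Xs) p = 0"
    if "\<forall>X\<in>set (X # Xs). cvector_field A X" for X Xs
  proof -
    have X: "cvector_field A X" using that by simp
    have z: "koszul (\<lambda>p xs. 0) Xs p = 0"
      using that by (simp add: koszul_def capply_const cvector_field_ctangent)
    show ?thesis
      unfolding C koszul_Cons[OF kform_interior_prod[OF Suc.prems X]] lie_deriv_Cons[OF Suc.prems]
        interior_prod_self[OF Suc.prems] lie_bracket_self
      by (simp add: z multilinear_zero[OF kform_multilinear[OF Suc.prems]])
  qed
  have tail: "tensorial (Suc k) p (\<lambda>Xs. koszul \<omega> (X # Xs) p)" if X: "cvector_field A X" for X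
  proof -
    have "tensorial (Suc k) p (\<lambda>Xs. lie_deriv X \<omega> Xs p + (-1) * koszul (interior_prod X \<omega>) Xs p)"
      by (intro tensorial_lincomb tensorial_lie_deriv Suc kform_interior_prod X)
    then show ?thesis by (simp add: C)
  qed
  show ?case
    unfolding tensorial.simps(2)[of "Suc k"] using head alt tail by auto
qed

lemma smooth_fun_koszul:
  assumes "kform A k \<omega>" "\<forall>X\<in>set Xs. cvector_field A X"
  shows "smooth_fun A (\<lambda>p. koszul \<omega> Xs p)"
proof -
  have "smooth_fun A (\<lambda>p. \<omega> p (ev (lie_bracket (Xs ! i) (Xs ! j) # nths Xs (- {i, j})) p))"
    if "i < j" "j < length Xs" for i j
    using that assms(2) in_set_nthsD[of _ Xs]
    by (intro kform_smooth[OF assms(1)]) (auto intro!: cvector_field_lie_bracket)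
  then show ?thesis
    unfolding koszul_def case_prod_unfold using assms(2)
    by (intro smooth_fun_add smooth_fun_sum smooth_fun_mult[OF smooth_fun_const] smooth_fun_capply) auto
qed

end

section \<open>Existence of the exterior derivative in the presence of a global frame\<close>

locale framed_manifold = manifold A
  for A :: "('a::{t2_space, second_countable_topology}, 'e::euclidean_space) atlas" +
  fixes N :: nat and e :: "nat \<Rightarrow> 'a \<Rightarrow> 'a ctvec" and \<epsilon> :: "nat \<Rightarrow> 'a form"
  assumes frame_field: "i < N \<Longrightarrow> cvector_field A (e i)"
    and coframe_form: "i < N \<Longrightarrow> kform A 1 (\<epsilon> i)"
    and frame_expansion: "Y \<in> ctangent A p \<Longrightarrow> Y = (\<lambda>g. \<Sum>i<N. \<epsilon> i p [Y] * e i p g)"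
begin

text \<open>The coefficients are frozen at \<open>p\<close>. Being constant, they make the extension
  complex-linear in \<open>x\<close>, so linearity over functions descends to linearity in tangent
  vectors.\<close>

definition extend :: "'a \<Rightarrow> 'a ctvec \<Rightarrow> 'a \<Rightarrow> 'a ctvec" where
  "extend p x = (\<lambda>q g. \<Sum>i<N. \<epsilon> i p [x] * e i q g)"

lemma extend_field: "cvector_field A (extend p x)"
  unfolding extend_def by (intro cvector_field_sum frame_field smooth_fun_const) auto

lemma extend_at: "x \<in> ctangent A p \<Longrightarrow> extend p x p = x"
  using frame_expansion[of x p] by (simp add: extend_def)

lemma extend_lincomb:
  assumes "x \<in> ctangent A p" "y \<in> ctangent A p"
  shows "extend p (\<lambda>g. x g + c * y g) = (\<lambda>q g. extend p x q g + c * extend p y q g)"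
proof -
  have "\<epsilon> i p [\<lambda>g. x g + c * y g] = \<epsilon> i p [x] + c * \<epsilon> i p [y]" if "i < N" for i
    by (rule multilinear_head[OF kform_multilinear[OF coframe_form[OF that]] assms])
  then show ?thesis by (simp add: extend_def sum.distrib sum_distrib_left algebra_simps)
qed

lemma tensorial_sum:
  assumes "tensorial (Suc k) p \<Phi>" "finite I" "\<And>i. i \<in> I \<Longrightarrow> cvector_field A (Y i)"
    "\<And>i. i \<in> I \<Longrightarrow> smooth_fun A (h i)" "length Xs = k" "\<forall>X\<in>set Xs. cvector_field A X"
  shows "\<Phi> ((\<lambda>q g. \<Sum>i\<in>I. h i q * Y i q g) # Xs) = (\<Sum>i\<in>I. h i p * \<Phi> (Y i # Xs))"
  using assms(2-4)
proof (induction I rule: finite_induct)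
  case empty
  \<comment> \<open>The zero field is written as \<open>0 + 1 * 0\<close>, so that its value equals
    twice itself.\<close>
  have "\<Phi> ((\<lambda>q g. 0 + 1 * 0) # Xs) = \<Phi> ((\<lambda>q g. 0) # Xs) + 1 * \<Phi> ((\<lambda>q g. 0) # Xs)"
    using tensorial_head[OF assms(1) cvector_field_zero cvector_field_zero smooth_fun_const assms(5,6), of 1]
    by simp
  then show ?case by simp
next
  case (insert i I)
  have "\<Phi> ((\<lambda>q g. (\<Sum>i\<in>I. h i q * Y i q g) + h i q * Y i q g) # Xs)
      = \<Phi> ((\<lambda>q g. \<Sum>i\<in>I. h i q * Y i q g) # Xs) + h i p * \<Phi> (Y i # Xs)"
    using insert.prems by (intro tensorial_head[OF assms(1)] cvector_field_sum assms(5,6)) auto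
  then show ?case using insert by (simp add: add.commute)
qed

lemma tensorial_pointwise:
  assumes "tensorial k p \<Phi>" "length Xs = k" "\<forall>X\<in>set Xs. cvector_field A X"
  shows "\<Phi> Xs = \<Phi> (map (extend p) (ev Xs p))"
  using assms
proof (induction k arbitrary: \<Phi> Xs)
  case (Suc k)
  then obtain X Ys where Xs: "Xs = X # Ys" by (cases Xs) auto
  have X: "cvector_field A X" using Suc.prems Xs by simp
  have Ys: "length Ys = k" "\<forall>X\<in>set Ys. cvector_field A X" using Suc.prems Xs by auto
  have "X = (\<lambda>q g. \<Sum>i<N. \<epsilon> i q [X q] * e i q g)"
    using frame_expansion[OF cvector_field_ctangent[OF X]] by (intro ext) meson
  then have "\<Phi> (X # Ys) = \<Phi> ((\<lambda>q g. \<Sum>i<N. \<epsilon> i q [X q] * e i q g) # Ys)" by simp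
  also have "\<dots> = (\<Sum>i<N. \<epsilon> i p [X p] * \<Phi> (e i # Ys))"
    using kform_smooth[OF coframe_form, of _ "[X]"] X
    by (intro tensorial_sum[OF Suc.prems(1)] frame_field Ys) auto
  also have "\<dots> = \<Phi> (extend p (X p) # Ys)"
    unfolding extend_def
    by (rule tensorial_sum[OF Suc.prems(1), symmetric]) (auto intro: frame_field smooth_fun_const simp: Ys)
  also have "\<dots> = \<Phi> (extend p (X p) # map (extend p) (ev Ys p))"
    by (rule Suc.IH[OF tensorial_tail[OF Suc.prems(1) extend_field] Ys])
  finally show ?case by (simp add: Xs)
qed simp

lemma tensorial_imp_covector:
  assumes "tensorial k p \<Phi>"
  shows "covector A p k (\<lambda>xs. if length xs = k \<and> set xs \<subseteq> ctangent A p then \<Phi> (map (extend p) xs) else 0)"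
  using assms
proof (induction k arbitrary: \<Phi>)
  case 0
  then show ?case by (simp add: covector_0)
next
  case (Suc k)
  have E: "\<forall>X\<in>set (map (extend p) xs). cvector_field A X" for xs by (auto simp: extend_field)
  show ?case
  proof (rule covector_SucI, goal_cases)
    case (2 xs Y Z c)
    have "\<Phi> ((\<lambda>q g. extend p Y q g + c * extend p Z q g) # map (extend p) xs)
       = \<Phi> (extend p Y # map (extend p) xs) + c * \<Phi> (extend p Z # map (extend p) xs)"
      using tensorial_head[OF Suc.prems extend_field extend_field smooth_fun_const _ E] 2 by simp
    then show ?case using 2 by (simp add: extend_lincomb ctangent_lincomb)
  next
    case (3 x xs)
    then show ?case using Suc.prems E[of "x # xs"] by simp
  next
    case (4 x)
    then show ?case using Suc.IH[OF tensorial_tail[OF Suc.prems extend_field]] by (simp cong: if_cong)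
  qed auto
qed

text \<open>Existence comes from evaluating the invariant formula on frozen extensions, which is
  legitimate because it depends only on the values at \<open>p\<close>. Uniqueness holds because
  every tangent vector is the value of a field, and off the tangent lists both forms are
  \<open>0\<close>.\<close>

lemma ext_d_spec:
  assumes "kform A k \<omega>"
  shows "kform A (Suc k) (ext_d A k \<omega>) \<and>
    (\<forall>Xs. length Xs = Suc k \<and> (\<forall>X\<in>set Xs. cvector_field A X) \<longrightarrow>
       (\<forall>p. ext_d A k \<omega> p (ev Xs p) = koszul \<omega> Xs p))"
proof -
  define P where "P = (\<lambda>\<eta>. kform A (Suc k) \<eta> \<and>
    (\<forall>Xs. length Xs = Suc k \<and> (\<forall>X\<in>set Xs. cvector_field A X) \<longrightarrow> (\<forall>p. \<eta> p (ev Xs p) = koszul \<omega> Xs p)))"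
  define \<eta>\<^sub>0 where "\<eta>\<^sub>0 = (\<lambda>p xs. if length xs = Suc k \<and> set xs \<subseteq> ctangent A p
    then koszul \<omega> (map (extend p) xs) p else 0)"
  have c: "covector A p (Suc k) (\<eta>\<^sub>0 p)" for p
    unfolding \<eta>\<^sub>0_def by (rule tensorial_imp_covector[OF tensorial_koszul[OF assms]])
  have kz: "\<eta>\<^sub>0 p (ev Xs p) = koszul \<omega> Xs p" if "length Xs = Suc k" "\<forall>X\<in>set Xs. cvector_field A X" for Xs p
    using tensorial_pointwise[OF tensorial_koszul[OF assms] that] that
    by (auto simp: \<eta>\<^sub>0_def cvector_field_ctangent)
  have sm: "smooth_fun A (\<lambda>p. \<eta>\<^sub>0 p (ev Xs p))" if Xs: "\<forall>X\<in>set Xs. cvector_field A X" for Xs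
  proof (cases "length Xs = Suc k")
    case True
    then show ?thesis using smooth_fun_koszul[OF assms Xs] kz[OF True Xs] by simp
  next
    case False
    then show ?thesis by (simp add: \<eta>\<^sub>0_def smooth_fun_const)
  qed
  have "P \<eta>\<^sub>0" using c kz sm by (simp add: P_def kform_def)
  moreover have "\<eta> = \<eta>\<^sub>0" if "P \<eta>" for \<eta>
  proof (intro ext)
    fix p xs
    show "\<eta> p xs = \<eta>\<^sub>0 p xs"
    proof (cases "length xs = Suc k \<and> set xs \<subseteq> ctangent A p")
      case True
      then have "xs = ev (map (extend p) xs) p"
        by (auto simp: extend_at subset_eq intro!: nth_equalityI)
      moreover have "\<eta> p (ev (map (extend p) xs) p) = koszul \<omega> (map (extend p) xs) p"
        using \<open>P \<eta>\<close> True by (auto simp: P_def extend_field simp del: map_map)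
      ultimately show ?thesis using True by (simp add: \<eta>\<^sub>0_def)
    next
      case False
      then show ?thesis
        using \<open>P \<eta>\<close> multilinear_support[OF kform_multilinear[of "Suc k" \<eta> p]] by (auto simp: P_def \<eta>\<^sub>0_def)
    qed
  qed
  ultimately have "P (THE \<eta>. P \<eta>)" by (rule theI)
  then show ?thesis unfolding P_def ext_d_def .
qed

lemma kform_ext_d: "kform A k \<omega> \<Longrightarrow> kform A (Suc k) (ext_d A k \<omega>)"
  using ext_d_spec by blast

lemma ext_d_koszul:
  "kform A k \<omega> \<Longrightarrow> length Xs = Suc k \<Longrightarrow> \<forall>X\<in>set Xs. cvector_field A X \<Longrightarrow>
     ext_d A k \<omega> p (ev Xs p) = koszul \<omega> Xs p"
  using ext_d_spec by blast

end

section \<open>The frame of a parallelized almost complex manifold\<close>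

lemma conj_vec_conj_vec: "conj_vec (conj_vec Z) = Z"
  by (simp add: conj_vec_def)

context manifold begin

lemma ctangent_conj_iff: "conj_vec Z \<in> ctangent A p \<longleftrightarrow> Z \<in> ctangent A p"
  using ctangent_conj[of Z p] ctangent_conj[of "conj_vec Z" p] by (auto simp: conj_vec_conj_vec)

text \<open>Conjugation of the arguments and of the value are both antilinear, so together they
  preserve complex linearity.\<close>

lemma covector_conj:
  assumes "covector A p k \<theta>"
  shows "covector A p k (\<lambda>xs. cnj (\<theta> (map conj_vec xs)))"
  unfolding covector_iff_multilinear multilinear_def
proof (intro conjI allI impI; (elim conjE)?)
  note m = covector_multilinear[OF assms]
  have s: "set (map conj_vec xs) \<subseteq> ctangent A p \<longleftrightarrow> set xs \<subseteq> ctangent A p" for xs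
    by (auto simp: ctangent_conj_iff)
  show "cnj (\<theta> (map conj_vec xs)) = 0" if "\<not> (length xs = k \<and> set xs \<subseteq> ctangent A p)" for xs
    using multilinear_support[OF m, of "map conj_vec xs"] that s[of xs] by auto
  show "cnj (\<theta> (map conj_vec (xs[i := \<lambda>g. Y g + c * Z g]))) =
      cnj (\<theta> (map conj_vec (xs[i := Y]))) + c * cnj (\<theta> (map conj_vec (xs[i := Z])))"
    if "length xs = k" "i < k" "Y \<in> ctangent A p" "Z \<in> ctangent A p" for xs i Y Z c
  proof -
    have "conj_vec (\<lambda>g. Y g + c * Z g) = (\<lambda>g. conj_vec Y g + cnj c * conj_vec Z g)"
      by (simp add: conj_vec_def)
    then show ?thesis
      using multilinear_update[OF m, of "conj_vec Y" "conj_vec Z" i "map conj_vec xs" "cnj c"] that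
      by (simp add: map_update ctangent_conj)
  qed
  show "cnj (\<theta> (map conj_vec xs)) = 0" if "length xs = k" "i < j" "j < k" "xs ! i = xs ! j" for xs i j
  proof -
    have "map conj_vec xs ! i = map conj_vec xs ! j" using that by simp
    then have "\<not> distinct (map conj_vec xs)"
      using that by (metis distinct_conv_nth length_map less_irrefl less_trans)
    then show ?thesis using covector_not_distinct[OF assms] by simp
  qed
qed

lemma cvector_field_conj: "cvector_field A X \<Longrightarrow> cvector_field A (\<lambda>p. conj_vec (X p))"
  by (simp add: cvector_field_def ctangent_conj) (simp add: conj_vec_def smooth_fun_cnj)

lemma kform_conj:
  assumes "kform A k \<omega>"
  shows "kform A k (conj_form \<omega>)"
  unfolding kform_def
proof (intro conjI allI impI)
  show "covector A p k (conj_form \<omega> p)" for p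
    unfolding conj_form_def by (rule covector_conj[OF kform_covector[OF assms]])
  show "smooth_fun A (\<lambda>p. conj_form \<omega> p (ev Xs p))" if "\<forall>X\<in>set Xs. cvector_field A X" for Xs
  proof -
    have "smooth_fun A (\<lambda>p. \<omega> p (ev (map (\<lambda>X p. conj_vec (X p)) Xs) p))"
      by (rule kform_smooth[OF assms]) (use that cvector_field_conj in auto)
    then show ?thesis by (simp add: conj_form_def comp_def smooth_fun_cnj)
  qed
qed

lemma cvector_field_cplx:
  "vector_field A X \<Longrightarrow> cvector_field A (\<lambda>p. cplx (X p))"
  by (simp add: vector_field_def cvector_field_def ctangent_cplx) (simp add: cplx_def smooth_fun_of_real)

lemma kform_wedge:
  assumes "kform A 1 \<omega>" "kform A k \<eta>"
  shows "kform A (Suc k) (wedge \<omega> \<eta>)"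
  unfolding kform_def
proof (intro conjI allI impI)
  have w: "wedge \<omega> \<eta> p xs = ext_prod (\<lambda>x. \<omega> p [x]) (\<eta> p) xs" for p xs
    by (rule wedge_ext_prod) (use multilinear_support[OF kform_multilinear[OF assms(1)]] in auto)
  show "covector A p (Suc k) (wedge \<omega> \<eta> p)" for p
  proof -
    have "covector A p (Suc k) (ext_prod (\<lambda>x. \<omega> p [x]) (\<eta> p))"
      using multilinear_support[OF kform_multilinear[OF assms(1), of p]]
        multilinear_head[OF kform_multilinear[OF assms(1), of p]]
      by (intro covector_ext_prod kform_covector[OF assms(2)]) auto
    moreover have "wedge \<omega> \<eta> p = ext_prod (\<lambda>x. \<omega> p [x]) (\<eta> p)" using w by (intro ext)
    ultimately show ?thesis by simp
  qed
  show "smooth_fun A (\<lambda>p. wedge \<omega> \<eta> p (ev Xs p))" if X: "\<forall>X\<in>set Xs. cvector_field A X" for Xs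
  proof -
    have "smooth_fun A (\<lambda>p. \<omega> p [(Xs ! i) p])" if "i < length Xs" for i
      using kform_smooth[OF assms(1), of "[Xs ! i]"] that X by simp
    moreover have "smooth_fun A (\<lambda>p. \<eta> p (ev (nths Xs (- {i})) p))" for i
      using X by (intro kform_smooth[OF assms(2)]) (meson in_set_nthsD)
    ultimately show ?thesis
      unfolding w ext_prod_def nths_map length_map
      by (intro smooth_fun_sum smooth_fun_mult smooth_fun_const) auto
  qed
qed

lemma kform_fun:
  assumes "smooth_fun A h"
  shows "kform A 0 (fun_form h)"
proof -
  have "smooth_fun A (\<lambda>p. fun_form h p (ev Xs p))" for Xs
    using assms by (cases "Xs = []") (auto simp: fun_form_def smooth_fun_const)
  then show ?thesis by (simp add: kform_def covector_0 fun_form_def)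
qed

lemma kform_wedge_list:
  "(\<And>\<omega>. \<omega> \<in> set \<omega>s \<Longrightarrow> kform A 1 \<omega>) \<Longrightarrow> kform A (length \<omega>s) (wedge_list \<omega>s)"
  by (induction \<omega>s) (simp_all add: wedge_list_def kform_fun smooth_fun_const kform_wedge)

end

section \<open>Dual frames of types (1,0) and (0,1)\<close>

locale almost_complex_frame = manifold A
  for A :: "('a::{t2_space, second_countable_topology}, 'e::euclidean_space) atlas" +
  fixes J :: "'a \<Rightarrow> 'a tvec \<Rightarrow> 'a tvec" and n :: nat
    and v w :: "nat \<Rightarrow> 'a \<Rightarrow> 'a tvec"
    and v' w' \<phi> :: "nat \<Rightarrow> 'a form"
  assumes acs: "almost_complex A J"
    and frame: "global_frame A n v w"
    and Jv: "\<And>i p. i \<in> {1..n} \<Longrightarrow> J p (v i p) = w i p"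
    and Jw: "\<And>i p. i \<in> {1..n} \<Longrightarrow> J p (w i p) = (\<lambda>g. - v i p g)"
    and dual_form: "\<And>i. i \<in> {1..n} \<Longrightarrow> kform A 1 (v' i) \<and> kform A 1 (w' i)"
    and dual: "\<And>i j p. i \<in> {1..n} \<Longrightarrow> j \<in> {1..n} \<Longrightarrow>
           v' i p [cplx (v j p)] = (if i = j then 1 else 0) \<and> v' i p [cplx (w j p)] = 0 \<and>
           w' i p [cplx (w j p)] = (if i = j then 1 else 0) \<and> w' i p [cplx (v j p)] = 0"
    and phi: "\<phi> = (\<lambda>i p xs. v' i p xs + \<i> * w' i p xs)"
begin

text \<open>The factor \<open>1 / 2\<close> makes these vectors dual to the coframe: \<phi>_i is the
  dual covector of v_i plus \<open>\<i>\<close> times that of w_i, so its value on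
  \<open>Z i\<close> is \<open>1/2 + 1/2\<close>, and on \<open>Zb i\<close> it is
  \<open>1/2 - 1/2\<close>.\<close>

definition Z :: "nat \<Rightarrow> 'a \<Rightarrow> 'a ctvec" where
  "Z i = (\<lambda>p g. 1 / 2 * cplx (v i p) g + (- \<i> / 2) * cplx (w i p) g)"

definition Zb :: "nat \<Rightarrow> 'a \<Rightarrow> 'a ctvec" where
  "Zb i = (\<lambda>p g. 1 / 2 * cplx (v i p) g + (\<i> / 2) * cplx (w i p) g)"

lemma v_field: "i \<in> {1..n} \<Longrightarrow> vector_field A (v i)"
  and w_field: "i \<in> {1..n} \<Longrightarrow> vector_field A (w i)"
  using frame by (auto simp: global_frame_def)

lemma v_tangent: "i \<in> {1..n} \<Longrightarrow> v i p \<in> tangent A p"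
  and w_tangent: "i \<in> {1..n} \<Longrightarrow> w i p \<in> tangent A p"
  using v_field w_field by (auto simp: vector_field_def)

lemma cvector_field_combination:
  assumes "i \<in> {1..n}"
  shows "cvector_field A (\<lambda>p g. a * cplx (v i p) g + b * cplx (w i p) g)"
proof -
  have "cvector_field A (\<lambda>p g. 0 + a * cplx (v i p) g)"
    by (rule cvector_field_lincomb[OF cvector_field_zero cvector_field_cplx[OF v_field[OF assms]] smooth_fun_const])
  then have "cvector_field A (\<lambda>p g. a * cplx (v i p) g)" by simp
  from cvector_field_lincomb[OF this cvector_field_cplx[OF w_field[OF assms]] smooth_fun_const]
  show ?thesis .
qed

lemma Z_field: "i \<in> {1..n} \<Longrightarrow> cvector_field A (Z i)"
  and Zb_field: "i \<in> {1..n} \<Longrightarrow> cvector_field A (Zb i)"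
  unfolding Z_def Zb_def by (rule cvector_field_combination; assumption)+

lemma Z_ctangent: "i \<in> {1..n} \<Longrightarrow> Z i p \<in> ctangent A p"
  and Zb_ctangent: "i \<in> {1..n} \<Longrightarrow> Zb i p \<in> ctangent A p"
  using Z_field Zb_field cvector_field_ctangent by auto

lemma phi_form: "i \<in> {1..n} \<Longrightarrow> kform A 1 (\<phi> i)"
  unfolding phi using kform_lincomb[OF _ _ smooth_fun_const] dual_form by simp

lemma phi_combination:
  assumes "i \<in> {1..n}" "j \<in> {1..n}"
  shows "\<phi> i p [\<lambda>g. a * cplx (v j p) g + b * cplx (w j p) g] = (if i = j then a + \<i> * b else 0)"
proof -
  note m = kform_multilinear[OF phi_form[OF assms(1)], of p]
  have V: "cplx (v j p) \<in> ctangent A p" and W: "cplx (w j p) \<in> ctangent A p"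
    using assms v_tangent w_tangent ctangent_cplx by auto
  have "(\<lambda>g. a * cplx (v j p) g) \<in> ctangent A p"
    using ctangent_lincomb[OF ctangent_zero V, of a] by simp
  then have "\<phi> i p [\<lambda>g. a * cplx (v j p) g + b * cplx (w j p) g]
      = a * \<phi> i p [cplx (v j p)] + b * \<phi> i p [cplx (w j p)]"
    using multilinear_head[OF m _ W] multilinear_scale[OF m V] by simp
  then show ?thesis using dual[OF assms, of p] by (auto simp: phi)
qed

lemma phi_Z: "i \<in> {1..n} \<Longrightarrow> j \<in> {1..n} \<Longrightarrow> \<phi> i p [Z j p] = (if i = j then 1 else 0)"
  and phi_Zb: "i \<in> {1..n} \<Longrightarrow> j \<in> {1..n} \<Longrightarrow> \<phi> i p [Zb j p] = 0"
  unfolding Z_def Zb_def by (simp_all only: phi_combination) auto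

lemma conj_Z: "conj_vec (Z i p) = Zb i p" and conj_Zb: "conj_vec (Zb i p) = Z i p"
  by (auto simp: conj_vec_def Z_def Zb_def cplx_def)

lemma cphi_Zb: "i \<in> {1..n} \<Longrightarrow> j \<in> {1..n} \<Longrightarrow> conj_form (\<phi> i) p [Zb j p] = (if i = j then 1 else 0)"
  and cphi_Z: "i \<in> {1..n} \<Longrightarrow> j \<in> {1..n} \<Longrightarrow> conj_form (\<phi> i) p [Z j p] = 0"
  by (auto simp: conj_form_def conj_Z conj_Zb phi_Z phi_Zb)

lemma cphi_form: "i \<in> {1..n} \<Longrightarrow> kform A 1 (conj_form (\<phi> i))"
  by (intro kform_conj phi_form)

lemma multilinear_type_sum:
  assumes "multilinear A p k \<theta>"
  shows "\<theta> ((\<lambda>g. \<Sum>i=1..n. c i * Z i p g + d i * Zb i p g) # xs)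
    = (\<Sum>i=1..n. c i * \<theta> (Z i p # xs)) + (\<Sum>i=1..n. d i * \<theta> (Zb i p # xs))"
proof -
  have z: "(\<lambda>g. \<Sum>i=1..n. c i * Z i p g) \<in> ctangent A p" "(\<lambda>g. \<Sum>i=1..n. d i * Zb i p g) \<in> ctangent A p"
    using Z_ctangent Zb_ctangent by (auto intro!: ctangent_sum)
  have "\<theta> ((\<lambda>g. (\<Sum>i=1..n. c i * Z i p g) + 1 * (\<Sum>i=1..n. d i * Zb i p g)) # xs)
     = \<theta> ((\<lambda>g. \<Sum>i=1..n. c i * Z i p g) # xs) + 1 * \<theta> ((\<lambda>g. \<Sum>i=1..n. d i * Zb i p g) # xs)"
    by (rule multilinear_head[OF assms z])
  also have "\<theta> ((\<lambda>g. \<Sum>i=1..n. c i * Z i p g) # xs) = (\<Sum>i=1..n. c i * \<theta> (Z i p # xs))"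
    using Z_ctangent by (intro multilinear_sum[OF assms]) auto
  also have "\<theta> ((\<lambda>g. \<Sum>i=1..n. d i * Zb i p g) # xs) = (\<Sum>i=1..n. d i * \<theta> (Zb i p # xs))"
    using Zb_ctangent by (intro multilinear_sum[OF assms]) auto
  finally show ?thesis by (simp add: sum.distrib)
qed

lemma phi_type_sum:
  assumes j: "j \<in> {1..n}"
  shows "\<phi> j p [\<lambda>g. \<Sum>i=1..n. c i * Z i p g + d i * Zb i p g] = c j"
    and "conj_form (\<phi> j) p [\<lambda>g. \<Sum>i=1..n. c i * Z i p g + d i * Zb i p g] = d j"
proof -
  have "(\<Sum>i=1..n. c i * \<phi> j p [Z i p]) = (\<Sum>i=1..n. if j = i then c i else 0)"
    by (rule sum.cong) (use j phi_Z in auto)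
  moreover have "(\<Sum>i=1..n. d i * \<phi> j p [Zb i p]) = 0"
    by (rule sum.neutral) (use j phi_Zb in auto)
  ultimately show "\<phi> j p [\<lambda>g. \<Sum>i=1..n. c i * Z i p g + d i * Zb i p g] = c j"
    using multilinear_type_sum[OF kform_multilinear[OF phi_form[OF j]], where xs = "[]"] j by simp
  have "(\<Sum>i=1..n. d i * conj_form (\<phi> j) p [Zb i p]) = (\<Sum>i=1..n. if j = i then d i else 0)"
    by (rule sum.cong) (use j cphi_Zb in auto)
  moreover have "(\<Sum>i=1..n. c i * conj_form (\<phi> j) p [Z i p]) = 0"
    by (rule sum.neutral) (use j cphi_Z in auto)
  ultimately show "conj_form (\<phi> j) p [\<lambda>g. \<Sum>i=1..n. c i * Z i p g + d i * Zb i p g] = d j"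
    using multilinear_type_sum[OF kform_multilinear[OF cphi_form[OF j]], where xs = "[]"] j by simp
qed

lemma type_expansion:
  assumes "Y \<in> ctangent A p"
  shows "Y = (\<lambda>g. \<Sum>i=1..n. \<phi> i p [Y] * Z i p g + conj_form (\<phi> i) p [Y] * Zb i p g)"
proof -
  from assms obtain D E where DE: "D \<in> tangent A p" "E \<in> tangent A p"
    and Y: "Y = (\<lambda>g. cplx D g + \<i> * cplx E g)"
    by (auto simp: ctangent_def)
  have "\<exists>a b. D = (\<lambda>g. \<Sum>i=1..n. a i * v i p g + b i * w i p g)"
    "\<exists>a b. E = (\<lambda>g. \<Sum>i=1..n. a i * v i p g + b i * w i p g)"
    using frame DE by (simp_all add: global_frame_def)
  then obtain a b a' b' where D: "D = (\<lambda>g. \<Sum>i=1..n. a i * v i p g + b i * w i p g)"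
    and E: "E = (\<lambda>g. \<Sum>i=1..n. a' i * v i p g + b' i * w i p g)" by blast
  \<comment> \<open>Coefficients of \<open>D + \<i> E\<close> after substituting v_i = Z_i + conj
    Z_i and w_i = \<open>\<i>\<close> (Z_i - conj Z_i).\<close>
  define c where "c = (\<lambda>i. (complex_of_real (a i) + \<i> * b i) + \<i> * (a' i + \<i> * b' i))"
  define d where "d = (\<lambda>i. (complex_of_real (a i) - \<i> * b i) + \<i> * (a' i - \<i> * b' i))"
  have Y': "Y = (\<lambda>g. \<Sum>i=1..n. c i * Z i p g + d i * Zb i p g)"
    unfolding Y D E cplx_def of_real_sum sum_distrib_left sum.distrib[symmetric]
    by (intro ext sum.cong) (auto simp: c_def d_def Z_def Zb_def cplx_def complex_eq_iff field_simps)
  have "\<phi> j p [Y] = c j" "conj_form (\<phi> j) p [Y] = d j" if "j \<in> {1..n}" for j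
    unfolding Y' using phi_type_sum[OF that] by auto
  then show ?thesis using Y' by simp
qed

section \<open>The complexified almost complex structure and its eigenspaces\<close>

lemma J_tangent: "D \<in> tangent A p \<Longrightarrow> J p D \<in> tangent A p"
  using acs by (simp add: almost_complex_def)

lemma J_lincomb:
  "D \<in> tangent A p \<Longrightarrow> E \<in> tangent A p \<Longrightarrow> J p (\<lambda>g. D g + c * E g) = (\<lambda>g. J p D g + c * J p E g)"
  using acs by (simp add: almost_complex_def)

lemma tangent_zero: "(\<lambda>g. 0) \<in> tangent A p"
  by (simp add: tangent_def)

lemma tangent_lincomb:
  "D \<in> tangent A p \<Longrightarrow> E \<in> tangent A p \<Longrightarrow> (\<lambda>g. D g + c * E g) \<in> tangent A p"
  by (auto simp: tangent_def algebra_simps)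

lemma J_zero: "J p (\<lambda>g. 0) = (\<lambda>g. 0)"
  using J_lincomb[OF tangent_zero tangent_zero, of p "-1"] by (auto simp: fun_eq_iff)

lemma J_scale: "D \<in> tangent A p \<Longrightarrow> J p (\<lambda>g. c * D g) = (\<lambda>g. c * J p D g)"
  using J_lincomb[OF tangent_zero, of D p c] by (simp add: J_zero)

lemma cJ_ctangent: "Y \<in> ctangent A p \<Longrightarrow> cJ J p Y \<in> ctangent A p"
  unfolding cJ_def by (intro ctangent_lincomb ctangent_cplx J_tangent ctangent_ReD ctangent_ImD)

lemma cJ_lincomb:
  assumes "X \<in> ctangent A p" "Y \<in> ctangent A p"
  shows "cJ J p (\<lambda>g. X g + c * Y g) = (\<lambda>g. cJ J p X g + c * cJ J p Y g)"
proof -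
  note t = ctangent_ReD[OF assms(1)] ctangent_ImD[OF assms(1)] ctangent_ReD[OF assms(2)] ctangent_ImD[OF assms(2)]
  have 3: "J p (\<lambda>g. (D g + a * E g) + b * F g) = (\<lambda>g. (J p D g + a * J p E g) + b * J p F g)"
    if "D \<in> tangent A p" "E \<in> tangent A p" "F \<in> tangent A p" for D E F a b
    using J_lincomb[OF tangent_lincomb[OF that(1,2)] that(3)] J_lincomb[OF that(1,2)] by simp
  \<comment> \<open>A complex scalar mixes real and imaginary parts, while \<open>J\<close> is only
    real-linear; each part is therefore a real combination of three tangent vectors.\<close>
  have "(\<lambda>g. Re (X g + c * Y g)) = (\<lambda>g. (Re (X g) + Re c * Re (Y g)) + (- Im c) * Im (Y g))"
    "(\<lambda>g. Im (X g + c * Y g)) = (\<lambda>g. (Im (X g) + Re c * Im (Y g)) + Im c * Re (Y g))"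
    by (auto simp: algebra_simps)
  then have "J p (\<lambda>g. Re (X g + c * Y g)) = (\<lambda>g. (J p (\<lambda>g. Re (X g)) g + Re c * J p (\<lambda>g. Re (Y g)) g)
        + (- Im c) * J p (\<lambda>g. Im (Y g)) g)"
    "J p (\<lambda>g. Im (X g + c * Y g)) = (\<lambda>g. (J p (\<lambda>g. Im (X g)) g + Re c * J p (\<lambda>g. Im (Y g)) g)
        + Im c * J p (\<lambda>g. Re (Y g)) g)"
    using 3[OF t(1,3,4), of "Re c" "- Im c"] 3[OF t(2,4,3), of "Re c" "Im c"] by simp_all
  then show ?thesis
    by (auto simp: cJ_def cplx_def complex_eq_iff algebra_simps)
qed

lemma cJ_Z: "i \<in> {1..n} \<Longrightarrow> cJ J p (Z i p) = (\<lambda>g. \<i> * Z i p g)"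
  and cJ_Zb: "i \<in> {1..n} \<Longrightarrow> cJ J p (Zb i p) = (\<lambda>g. - \<i> * Zb i p g)"
proof -
  assume i: "i \<in> {1..n}"
  note s = J_scale[OF v_tangent[OF i]] J_scale[OF w_tangent[OF i]]
  have 1: "(\<lambda>g. Re (Z i p g)) = (\<lambda>g. 1/2 * v i p g)" "(\<lambda>g. Im (Z i p g)) = (\<lambda>g. (-1/2) * w i p g)"
    "(\<lambda>g. Re (Zb i p g)) = (\<lambda>g. 1/2 * v i p g)" "(\<lambda>g. Im (Zb i p g)) = (\<lambda>g. 1/2 * w i p g)"
    by (auto simp: Z_def Zb_def cplx_def)
  show "cJ J p (Z i p) = (\<lambda>g. \<i> * Z i p g)"
    unfolding cJ_def 1 s Jv[OF i] Jw[OF i] by (auto simp: Z_def cplx_def complex_eq_iff)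
  show "cJ J p (Zb i p) = (\<lambda>g. - \<i> * Zb i p g)"
    unfolding cJ_def 1 s Jv[OF i] Jw[OF i] by (auto simp: Zb_def cplx_def complex_eq_iff)
qed

lemma Z_T10: "i \<in> {1..n} \<Longrightarrow> Z i p \<in> T10 A J p"
  and Zb_T01: "i \<in> {1..n} \<Longrightarrow> Zb i p \<in> T01 A J p"
  by (auto simp: T10_def T01_def Z_ctangent Zb_ctangent cJ_Z cJ_Zb)

lemma cJ_zero: "cJ J p (\<lambda>g. 0) = (\<lambda>g. 0)"
  by (simp add: cJ_def cplx_def J_zero)

lemma cJ_sum:
  "(\<And>i. i \<in> I \<Longrightarrow> Y i \<in> ctangent A p) \<Longrightarrow>
     cJ J p (\<lambda>g. \<Sum>i\<in>I. c i * Y i g) = (\<lambda>g. \<Sum>i\<in>I. c i * cJ J p (Y i) g)"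
proof (induction I rule: infinite_finite_induct)
  case (insert i I)
  then have "cJ J p (\<lambda>g. (\<Sum>i\<in>I. c i * Y i g) + c i * Y i g)
      = (\<lambda>g. cJ J p (\<lambda>g. \<Sum>i\<in>I. c i * Y i g) g + c i * cJ J p (Y i) g)"
    by (intro cJ_lincomb ctangent_sum) auto
  then show ?case using insert by (simp add: add.commute)
qed (simp_all add: cJ_zero)

lemma cJ_expansion:
  assumes "Y \<in> ctangent A p"
  shows "cJ J p Y = (\<lambda>g. \<Sum>i=1..n. \<i> * \<phi> i p [Y] * Z i p g + (- \<i> * conj_form (\<phi> i) p [Y]) * Zb i p g)"
proof -
  have z: "(\<lambda>g. \<Sum>i=1..n. \<phi> i p [Y] * Z i p g) \<in> ctangent A p"
    "(\<lambda>g. \<Sum>i=1..n. conj_form (\<phi> i) p [Y] * Zb i p g) \<in> ctangent A p"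
    using Z_ctangent Zb_ctangent by (auto intro!: ctangent_sum)
  have "Y = (\<lambda>g. (\<Sum>i=1..n. \<phi> i p [Y] * Z i p g) + 1 * (\<Sum>i=1..n. conj_form (\<phi> i) p [Y] * Zb i p g))"
    using type_expansion[OF assms] by (simp add: sum.distrib)
  then have "cJ J p Y = cJ J p (\<lambda>g. (\<Sum>i=1..n. \<phi> i p [Y] * Z i p g) + 1 * (\<Sum>i=1..n. conj_form (\<phi> i) p [Y] * Zb i p g))"
    by simp
  also have "\<dots> = (\<lambda>g. (\<Sum>i=1..n. \<phi> i p [Y] * cJ J p (Z i p) g) + 1 * (\<Sum>i=1..n. conj_form (\<phi> i) p [Y] * cJ J p (Zb i p) g))"
    unfolding cJ_lincomb[OF z] using cJ_sum[of "{1..n}" "\<lambda>i. Z i p" p] cJ_sum[of "{1..n}" "\<lambda>i. Zb i p" p]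
      Z_ctangent Zb_ctangent by simp
  also have "\<dots> = (\<lambda>g. \<Sum>i=1..n. \<i> * \<phi> i p [Y] * Z i p g + (- \<i> * conj_form (\<phi> i) p [Y]) * Zb i p g)"
    unfolding mult_1 sum.distrib[symmetric]
    by (intro ext sum.cong) (simp_all add: cJ_Z cJ_Zb)
  finally show ?thesis .
qed

lemma phi_cJ:
  assumes "Y \<in> ctangent A p" "j \<in> {1..n}"
  shows "\<phi> j p [cJ J p Y] = \<i> * \<phi> j p [Y]"
    and "conj_form (\<phi> j) p [cJ J p Y] = - \<i> * conj_form (\<phi> j) p [Y]"
  unfolding cJ_expansion[OF assms(1)] by (rule phi_type_sum[OF assms(2)])+

text \<open>Applying \<phi>_j after \<open>J\<close> multiplies its value by \<open>\<i>\<close>,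
  whereas \<open>Y\<close> lies in the eigenspace of \<open>- \<i>\<close>; the two evaluations
  force \<open>0\<close>.\<close>

lemma phi_T01:
  assumes "Y \<in> T01 A J p" "j \<in> {1..n}"
  shows "\<phi> j p [Y] = 0"
proof -
  have Y: "Y \<in> ctangent A p" "cJ J p Y = (\<lambda>g. - \<i> * Y g)" using assms by (auto simp: T01_def)
  have "\<phi> j p [\<lambda>g. - \<i> * Y g] = - \<i> * \<phi> j p [Y]"
    by (rule multilinear_scale[OF kform_multilinear[OF phi_form[OF assms(2)]] Y(1)])
  then show ?thesis using phi_cJ(1)[OF Y(1) assms(2)] Y(2) by (simp add: complex_eq_iff)
qed

lemma cphi_T10:
  assumes "Y \<in> T10 A J p" "j \<in> {1..n}"
  shows "conj_form (\<phi> j) p [Y] = 0"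
proof -
  have Y: "Y \<in> ctangent A p" "cJ J p Y = (\<lambda>g. \<i> * Y g)" using assms by (auto simp: T10_def)
  have "conj_form (\<phi> j) p [\<lambda>g. \<i> * Y g] = \<i> * conj_form (\<phi> j) p [Y]"
    by (rule multilinear_scale[OF kform_multilinear[OF cphi_form[OF assms(2)]] Y(1)])
  then show ?thesis using phi_cJ(2)[OF Y(1) assms(2)] Y(2) by (simp add: complex_eq_iff)
qed

text \<open>Needed because types are detected by counting the arguments in \<open>T10\<close>: no
  vector of the (0,1) frame may be counted.\<close>

lemma Zb_not_T10: "i \<in> {1..n} \<Longrightarrow> Zb i p \<notin> T10 A J p"
  using cphi_T10[of "Zb i p" p i] cphi_Zb[of i i p] by auto

lemma proj10_lincomb:
  "X \<in> ctangent A p \<Longrightarrow> Y \<in> ctangent A p \<Longrightarrow>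
     proj10 J p (\<lambda>g. X g + c * Y g) = (\<lambda>g. proj10 J p X g + c * proj10 J p Y g)"
  and proj01_lincomb:
  "X \<in> ctangent A p \<Longrightarrow> Y \<in> ctangent A p \<Longrightarrow>
     proj01 J p (\<lambda>g. X g + c * Y g) = (\<lambda>g. proj01 J p X g + c * proj01 J p Y g)"
  by (simp_all add: proj10_def proj01_def cJ_lincomb add_divide_distrib diff_divide_distrib algebra_simps)

lemma proj_ctangent:
  assumes "X \<in> ctangent A p"
  shows "proj10 J p X \<in> ctangent A p" "proj01 J p X \<in> ctangent A p"
proof -
  have "(\<lambda>g. (0 + 1/2 * X g) + c * cJ J p X g) \<in> ctangent A p" for c
    by (intro ctangent_lincomb ctangent_zero assms cJ_ctangent)
  from this[of "- \<i> / 2"] this[of "\<i> / 2"]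
  show "proj10 J p X \<in> ctangent A p" "proj01 J p X \<in> ctangent A p"
    by (simp_all add: proj10_def proj01_def diff_divide_distrib add_divide_distrib)
qed

text \<open>The frame of \<open>T\<^sup>0\<^sup>,\<^sup>1\<close> comes first, so that the increasing index lists with exactly one
  antiholomorphic entry are the lists \<open>k # [n..<2 * n]\<close>.\<close>

definition e :: "nat \<Rightarrow> 'a \<Rightarrow> 'a ctvec" where
  "e k = (if k < n then Zb (Suc k) else Z (Suc (k - n)))"

definition \<epsilon> :: "nat \<Rightarrow> 'a form" where
  "\<epsilon> k = (if k < n then conj_form (\<phi> (Suc k)) else \<phi> (Suc (k - n)))"

lemma sum_lessThan_double:
  fixes F :: "nat \<Rightarrow> complex"
  shows "(\<Sum>k<2 * n. F k) = (\<Sum>i=1..n. F (n + (i - 1)) + F (i - 1))"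
proof -
  have "(\<Sum>k<a + b. F k) = (\<Sum>k<a. F k) + (\<Sum>k<b. F (a + k))" for a b
    by (induction b) auto
  from this[of n n] show ?thesis
    unfolding mult_2 by (simp add: sum.distrib sum.atLeast1_atMost_eq add.commute)
qed

lemma e_field: "k < 2 * n \<Longrightarrow> cvector_field A (e k)"
  by (simp add: e_def Z_field Zb_field)

lemma e_ctangent: "k < 2 * n \<Longrightarrow> e k p \<in> ctangent A p"
  using e_field cvector_field_ctangent by auto

sublocale framed_manifold A "2 * n" e \<epsilon>
proof unfold_locales
  show "cvector_field A (e i)" if "i < 2 * n" for i using that by (rule e_field)
  show "kform A 1 (\<epsilon> i)" if "i < 2 * n" for i
    using that phi_form[of "Suc (i - n)"] cphi_form[of "Suc i"] by (auto simp: \<epsilon>_def)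
  show "Y = (\<lambda>g. \<Sum>i<2 * n. \<epsilon> i p [Y] * e i p g)" if "Y \<in> ctangent A p" for Y p
  proof -
    have "(\<Sum>i<2 * n. \<epsilon> i p [Y] * e i p g)
        = (\<Sum>i=1..n. \<phi> i p [Y] * Z i p g + conj_form (\<phi> i) p [Y] * Zb i p g)" for g
      unfolding sum_lessThan_double by (rule sum.cong) (auto simp: \<epsilon>_def e_def)
    then show ?thesis using type_expansion[OF that] by simp
  qed
qed

lemma multilinear_frame_eqI:
  assumes "multilinear A p k \<theta>" "multilinear A p k \<theta>'"
    and "\<And>js. length js = k \<Longrightarrow> set js \<subseteq> {..<2 * n} \<Longrightarrow>
       \<theta> (map (\<lambda>k. e k p) js) = \<theta>' (map (\<lambda>k. e k p) js)"
  shows "\<theta> = \<theta>'"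
proof (rule multilinear_eqI[OF assms(1,2), of "2 * n" "\<lambda>k. e k p"])
  show "\<exists>c. Y = (\<lambda>g. \<Sum>i<2 * n. c i * e i p g)" if "Y \<in> ctangent A p" for Y
    by (rule exI[of _ "\<lambda>i. \<epsilon> i p [Y]"]) (rule frame_expansion[OF that])
qed (use e_ctangent assms(3) in auto)

section \<open>Types and type components on frame vectors\<close>

lemma proj_e:
  assumes "k < 2 * n"
  shows "proj10 J p (e k p) = (if k < n then (\<lambda>g. 0) else e k p)"
    and "proj01 J p (e k p) = (if k < n then e k p else (\<lambda>g. 0))"
  using assms by (auto simp: proj10_def proj01_def e_def cJ_Z cJ_Zb)

lemma e_T10_iff: "k < 2 * n \<Longrightarrow> e k p \<in> T10 A J p \<longleftrightarrow> n \<le> k"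
  and e_type: "k < 2 * n \<Longrightarrow> e k p \<in> T10 A J p \<union> T01 A J p"
  using Z_T10 Zb_T01 Zb_not_T10 by (auto simp: e_def)

lemma pq_covector_frame:
  assumes "pq_covector A J p a b \<theta>" "set js \<subseteq> {..<2 * n}" "\<theta> (map (\<lambda>k. e k p) js) \<noteq> 0"
  shows "length (filter (\<lambda>k. n \<le> k) js) = a"
proof -
  let ?xs = "map (\<lambda>k. e k p) js"
  have c: "covector A p (a + b) \<theta>" using assms(1) by (simp add: pq_covector_def)
  have "length ?xs = a + b" using assms(3) multilinear_support[OF covector_multilinear[OF c]] by blast
  moreover have "set ?xs \<subseteq> T10 A J p \<union> T01 A J p" using assms(2) e_type by auto
  ultimately have "length (filter (\<lambda>Z. Z \<in> T10 A J p) ?xs) = a"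
    using assms(1,3) unfolding pq_covector_def by blast
  moreover have "filter (\<lambda>k. e k p \<in> T10 A J p) js = filter (\<lambda>k. n \<le> k) js"
    using assms(2) e_T10_iff by (intro filter_cong) auto
  ultimately show ?thesis by (simp add: filter_map comp_def)
qed

text \<open>Every frame vector has a pure type, so any choice of \<open>S\<close> other than the set
  of its (1,0) positions projects some entry to zero. One summand survives, provided that set has
  \<open>a\<close> elements.\<close>

lemma pq_component_frame:
  assumes "multilinear A p (a + b) (\<eta> p)" "length js = a + b" "set js \<subseteq> {..<2 * n}"
  shows "pq_component A J a b \<eta> p (map (\<lambda>k. e k p) js) =
    (if length (filter (\<lambda>k. n \<le> k) js) = a then \<eta> p (map (\<lambda>k. e k p) js) else 0)"
proof -
  let ?xs = "map (\<lambda>k. e k p) js"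
  let ?S = "{i. i < length js \<and> n \<le> js ! i}"
  let ?C = "{S. S \<subseteq> {..<length js} \<and> card S = a}"
  define F where "F = (\<lambda>S. map (\<lambda>i. if i \<in> S then proj10 J p (?xs ! i) else proj01 J p (?xs ! i)) [0..<length js])"
  have j: "js ! i < 2 * n" if "i < length js" for i
    using assms(3) that nth_mem by fastforce
  have xs: "set ?xs \<subseteq> ctangent A p" using assms(3) e_ctangent by auto
  have F0: "F ?S = ?xs"
    unfolding F_def by (rule nth_equalityI) (auto simp: proj_e j)
  have F1: "\<eta> p (F S) = 0" if "S \<subseteq> {..<length js}" "S \<noteq> ?S" for S
  proof (rule multilinear_zero_entry[OF assms(1)])
    from that obtain i where i: "i < length js" "(i \<in> S) \<noteq> (i \<in> ?S)" by auto
    then have "F S ! i = (\<lambda>g. 0)" by (auto simp: F_def proj_e j)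
    moreover have "i < length (F S)" using i by (simp add: F_def)
    ultimately show "(\<lambda>g. 0) \<in> set (F S)" by (metis nth_mem)
  qed
  have fin: "finite ?C" by (rule finite_subset[of _ "Pow {..<length js}"]) auto
  have "pq_component A J a b \<eta> p ?xs = (\<Sum>S\<in>?C. \<eta> p (F S))"
    unfolding pq_component_def F_def using assms(2) xs by simp
  also have "\<dots> = (\<Sum>S\<in>?C. if S = ?S then \<eta> p ?xs else 0)"
    by (rule sum.cong) (use F0 F1 in auto)
  also have "\<dots> = (if card ?S = a then \<eta> p ?xs else 0)"
    using fin by (auto simp: sum.delta')
  finally show ?thesis by (simp add: length_filter_conv_card)
qed

text \<open>Each summand is \<open>\<eta> p\<close> precomposed slot by slot with complex-linear
  projections.\<close>

lemma multilinear_pq_component: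
  assumes "multilinear A p (a + b) (\<eta> p)"
  shows "multilinear A p (a + b) (pq_component A J a b \<eta> p)"
  unfolding multilinear_def
proof (intro conjI allI impI; (elim conjE)?)
  show "pq_component A J a b \<eta> p xs = 0" if "\<not> (length xs = a + b \<and> set xs \<subseteq> ctangent A p)" for xs
    unfolding pq_component_def using that by (rule if_not_P)
  fix xs :: "'a ctvec list" and l Y W c
  assume xs: "length xs = a + b" "set xs \<subseteq> ctangent A p" and l: "l < a + b"
    and Y: "Y \<in> ctangent A p" and W: "W \<in> ctangent A p"
  define pr where "pr = (\<lambda>S (i::nat). if i \<in> S then proj10 J p else proj01 J p)"
  define F where "F = (\<lambda>S xs. map (\<lambda>i. pr S i (xs ! i)) [0..<a + b])"
  have q: "pq_component A J a b \<eta> p (xs[l := V]) = (\<Sum>S | S \<subseteq> {..<a + b} \<and> card S = a. \<eta> p (F S (xs[l := V])))"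
    if "V \<in> ctangent A p" for V
  proof -
    have "set (xs[l := V]) \<subseteq> ctangent A p" using xs(2) that set_update_subset_insert by fastforce
    then show ?thesis
      unfolding pq_component_def F_def pr_def using xs(1)
      by (auto intro!: sum.cong arg_cong[where f = "\<eta> p"])
  qed
  have upd: "F S (xs[l := V]) = (F S xs)[l := pr S l V]" for S V
    unfolding F_def using xs(1) l by (intro nth_equalityI) (auto simp: nth_list_update)
  have pr: "pr S i (\<lambda>g. Y g + c * W g) = (\<lambda>g. pr S i Y g + c * pr S i W g)" for S i
    using proj10_lincomb[OF Y W] proj01_lincomb[OF Y W] by (simp add: pr_def)
  have ct: "pr S i Y \<in> ctangent A p" "pr S i W \<in> ctangent A p" for S i
    using proj_ctangent Y W by (auto simp: pr_def)
  have "\<eta> p (F S (xs[l := \<lambda>g. Y g + c * W g])) = \<eta> p (F S (xs[l := Y])) + c * \<eta> p (F S (xs[l := W]))" for S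
    unfolding upd pr using l by (intro multilinear_update[OF assms ct]) (simp add: F_def)
  then show "pq_component A J a b \<eta> p (xs[l := \<lambda>g. Y g + c * W g]) =
      pq_component A J a b \<eta> p (xs[l := Y]) + c * pq_component A J a b \<eta> p (xs[l := W])"
    by (simp add: q Y W ctangent_lincomb sum.distrib sum_distrib_left)
qed

lemma multilinear_dbar:
  assumes "kform A (a + b) \<omega>"
  shows "multilinear A p (Suc (a + b)) (dbar A J a b \<omega> p)"
  using multilinear_pq_component[of p a "Suc b" "ext_d A (a + b) \<omega>"]
    kform_multilinear[OF kform_ext_d[OF assms]] by (simp add: dbar_def)

lemma dbar_frame:
  assumes "kform A (a + b) \<omega>" "length js = Suc (a + b)" "set js \<subseteq> {..<2 * n}"
  shows "dbar A J a b \<omega> p (map (\<lambda>k. e k p) js) =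
    (if length (filter (\<lambda>k. n \<le> k) js) = a then koszul \<omega> (map e js) p else 0)"
proof -
  have "ext_d A (a + b) \<omega> p (ev (map e js) p) = koszul \<omega> (map e js) p"
    by (rule ext_d_koszul[OF assms(1)]) (use assms e_field in auto)
  then show ?thesis
    unfolding dbar_def
    using pq_component_frame[of p a "Suc b" "ext_d A (a + b) \<omega>" js]
      kform_multilinear[OF kform_ext_d[OF assms(1)], of p] assms(2,3) by (simp add: comp_def)
qed

lemma dbar_fun:
  assumes "smooth_fun A h"
  shows "dbar A J 0 0 (fun_form h) p = (\<lambda>xs. \<Sum>k=1..n. capply (Zb k) h p * conj_form (\<phi> k) p xs)"
proof (rule multilinear_frame_eqI[where k = 1 and p = p])
  have h: "kform A (0 + 0) (fun_form h)" using kform_fun[OF assms] by simp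
  show "multilinear A p 1 (dbar A J 0 0 (fun_form h) p)"
    using multilinear_dbar[OF h] by simp
  show "multilinear A p 1 (\<lambda>xs. \<Sum>k=1..n. capply (Zb k) h p * conj_form (\<phi> k) p xs)"
    by (intro covector_multilinear covector_sum kform_covector cphi_form)
  fix js :: "nat list" assume "length js = 1" "set js \<subseteq> {..<2 * n}"
  then obtain j where js: "js = [j]" and j: "j < 2 * n" by (auto simp: length_Suc_conv)
  have "koszul (fun_form h) [e j] p = capply (e j) h p"
    unfolding koszul_Cons[OF h] koszul_def lie_deriv_def by (simp add: fun_form_def)
  then have lhs: "dbar A J 0 0 (fun_form h) p (map (\<lambda>k. e k p) js) = (if j < n then capply (e j) h p else 0)"
    using dbar_frame[OF h, of js p] js j
    by simp
  show "dbar A J 0 0 (fun_form h) p (map (\<lambda>k. e k p) js) =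
      (\<Sum>k=1..n. capply (Zb k) h p * conj_form (\<phi> k) p (map (\<lambda>k. e k p) js))"
  proof (cases "j < n")
    case True
    have "(\<Sum>k=1..n. capply (Zb k) h p * conj_form (\<phi> k) p [Zb (Suc j) p])
        = (\<Sum>k=1..n. if k = Suc j then capply (Zb k) h p else 0)"
      by (rule sum.cong) (use True cphi_Zb in auto)
    then show ?thesis using lhs js True by (simp add: e_def)
  next
    case False
    then have "(\<Sum>k=1..n. capply (Zb k) h p * conj_form (\<phi> k) p [Z (Suc (j - n)) p]) = 0"
      by (intro sum.neutral) (use j cphi_Z in auto)
    then show ?thesis using lhs js False by (simp add: e_def)
  qed
qed

end

section \<open>The canonical bundle\<close>

lemma ext_prod_vanish: "(\<And>x. x \<in> set xs \<Longrightarrow> a x = 0) \<Longrightarrow> ext_prod a \<theta> xs = 0"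
  by (simp add: ext_prod_def)

context manifold begin

lemma kform_scale:
  assumes "kform A k \<omega>" "smooth_fun A h"
  shows "kform A k (\<lambda>p xs. h p * \<omega> p xs)"
  using kform_lincomb[OF kform_zero assms] by simp

lemma kform_sum:
  "(\<And>i. i \<in> I \<Longrightarrow> kform A k (\<omega> i)) \<Longrightarrow> (\<And>i. i \<in> I \<Longrightarrow> smooth_fun A (h i)) \<Longrightarrow>
     kform A k (\<lambda>p xs. \<Sum>i\<in>I. h i p * \<omega> i p xs)"
  by (simp add: kform_def covector_sum smooth_fun_sum smooth_fun_mult)

lemma wedge_1_form:
  "kform A 1 \<omega> \<Longrightarrow> wedge \<omega> \<eta> p xs = ext_prod (\<lambda>x. \<omega> p [x]) (\<eta> p) xs"
  by (rule wedge_ext_prod) (use multilinear_support[OF kform_multilinear] in auto)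

end

context almost_complex_frame begin

definition Zs :: "('a \<Rightarrow> 'a ctvec) list" where
  "Zs = map Z [1..<Suc n]"

definition psi :: "'a form" where
  "psi = wedge_list (map \<phi> [1..<Suc n])"

lemma length_Zs: "length Zs = n" and Zs_nth: "j < n \<Longrightarrow> Zs ! j = Z (Suc j)"
  by (auto simp: Zs_def simp del: upt_Suc)

lemma Zs_field: "\<forall>X\<in>set Zs. cvector_field A X"
  unfolding Zs_def using Z_field by auto

lemma Zs_frame: "ev Zs p = map (\<lambda>k. e k p) [n..<2 * n]"
  by (rule nth_equalityI) (auto simp: length_Zs Zs_nth e_def)

lemma psi_form: "kform A n psi"
proof -
  have "kform A (length (map \<phi> [1..<Suc n])) (wedge_list (map \<phi> [1..<Suc n]))"
    by (rule kform_wedge_list) (use phi_form in auto)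
  then show ?thesis by (simp add: psi_def del: upt_Suc)
qed

text \<open>In the expansion along the first factor, \<open>Y\<close> either is the argument of that
  factor or stays among the arguments of the remaining product.\<close>

lemma wedge_list_vanish:
  assumes "Y \<in> set xs" "\<And>i. i \<in> set js \<Longrightarrow> i \<in> {1..n} \<and> \<phi> i p [Y] = 0"
  shows "wedge_list (map \<phi> js) p xs = 0"
  using assms
proof (induction js arbitrary: xs)
  case Nil
  then show ?case by (auto simp: wedge_list_def fun_form_def)
next
  case (Cons j js)
  from Cons.prems(1) obtain l where l: "l < length xs" "xs ! l = Y" by (auto simp: in_set_conv_nth)
  have z: "\<phi> j p [xs ! i] * wedge_list (map \<phi> js) p (nths xs (- {i})) = 0" if "i < length xs" for i
  proof (cases "i = l")
    case True
    then show ?thesis using l Cons.prems(2)[of j] by simp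
  next
    case False
    then have "Y \<in> set (nths xs (- {i}))" using l by (auto simp: set_nths)
    then show ?thesis using Cons by simp
  qed
  have w: "wedge_list (map \<phi> (j # js)) p xs
      = ext_prod (\<lambda>x. \<phi> j p [x]) (wedge_list (map \<phi> js) p) xs"
    using wedge_1_form[OF phi_form] Cons.prems(2)[of j] by (simp add: wedge_list_def)
  show ?case unfolding w ext_prod_def by (rule sum.neutral) (use z in auto)
qed

lemma psi_vanish: "Y \<in> set xs \<Longrightarrow> Y \<in> T01 A J p \<Longrightarrow> psi p xs = 0"
  unfolding psi_def by (rule wedge_list_vanish) (auto simp: phi_T01 simp del: upt_Suc)

lemma psi_Zb: "k \<in> {1..n} \<Longrightarrow> Zb k p \<in> set xs \<Longrightarrow> psi p xs = 0"
  using psi_vanish Zb_T01 by blast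

lemma wedge_list_dual:
  "distinct js \<Longrightarrow> set js \<subseteq> {1..n} \<Longrightarrow> wedge_list (map \<phi> js) p (ev (map Z js) p) = 1"
proof (induction js)
  case Nil
  then show ?case by (simp add: wedge_list_def fun_form_def)
next
  case (Cons j js)
  have "ext_prod (\<lambda>x. \<phi> j p [x]) (\<lambda>ys. wedge_list (map \<phi> js) p (Z j p # ys)) (ev (map Z js) p) = 0"
    using Cons.prems phi_Z by (intro ext_prod_vanish) auto
  then show ?case
    using Cons wedge_1_form[OF phi_form, of j] phi_Z[of j j p]
    by (simp add: wedge_list_def ext_prod_Cons)
qed

lemma psi_Zs: "psi p (ev Zs p) = 1"
  unfolding psi_def Zs_def by (rule wedge_list_dual) auto

lemma psi_pq_covector: "pq_covector A J p n 0 (psi p)"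
  unfolding pq_covector_def
proof (intro conjI allI impI; (elim conjE)?)
  show "covector A p (n + 0) (psi p)" using kform_covector[OF psi_form] by simp
  fix xs assume "length xs = n + 0" "set xs \<subseteq> T10 A J p \<union> T01 A J p" "psi p xs \<noteq> 0"
  then have "filter (\<lambda>Z. Z \<in> T10 A J p) xs = xs"
    using psi_vanish by (intro filter_True) blast
  then show "length (filter (\<lambda>Z. Z \<in> T10 A J p) xs) = n" using \<open>length xs = n + 0\<close> by simp
qed

text \<open>\<open>psi\<close> is a volume covector on the (1,0) frame, so replacing one frame
  vector by \<open>W\<close> reads off the corresponding coefficient of \<open>W\<close>. Position
  \<open>j\<close> of \<open>Zs\<close> holds \<open>Z (Suc j)\<close>, and the sign comes from
  moving that slot to the front.\<close>

lemma psi_replace: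
  assumes "W \<in> ctangent A p" "j < n"
  shows "psi p (W # ev (nths Zs (- {j})) p) = (- 1) ^ j * \<phi> (Suc j) p [W]"
proof -
  let ?z = "ev Zs p" and ?r = "ev (nths Zs (- {j})) p"
  note m = kform_multilinear[OF psi_form, of p]
  have r: "?r = take j ?z @ drop (Suc j) ?z"
    using assms(2) by (simp add: nths_omit length_Zs take_map drop_map)
  have z: "?z = take j ?z @ Z (Suc j) p # drop (Suc j) ?z"
    using id_take_nth_drop[of j ?z] assms(2) by (simp add: length_Zs Zs_nth)
  \<comment> \<open>Every other holomorphic frame vector already occurs among the remaining
    arguments.\<close>
  have i0: "psi p (Z i p # ?r) = 0" if "i \<in> {1..n}" "i \<noteq> Suc j" for i
  proof (rule covector_not_distinct[OF kform_covector[OF psi_form]])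
    have "Zs ! (i - 1) \<in> set (nths Zs (- {j}))"
      using that unfolding set_nths by (force simp: length_Zs)
    moreover have "Zs ! (i - 1) = Z i" using that Zs_nth[of "i - 1"] by force
    ultimately have "Z i \<in> set (nths Zs (- {j}))" by simp
    then show "\<not> distinct (Z i p # ?r)" by auto
  qed
  have "1 = (- 1) ^ j * psi p (Z (Suc j) p # ?r)"
    using covector_move_to_front[OF kform_covector[OF psi_form], of p "take j ?z" "Z (Suc j) p" "drop (Suc j) ?z"]
      psi_Zs[of p] z r assms(2) by (simp add: length_Zs)
  then have 1: "psi p (Z (Suc j) p # ?r) = (- 1) ^ j"
    by (metis left_minus_one_mult_self mult.right_neutral)
  have "psi p (W # ?r) = (\<Sum>i=1..n. \<phi> i p [W] * psi p (Z i p # ?r)) +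
      (\<Sum>i=1..n. conj_form (\<phi> i) p [W] * psi p (Zb i p # ?r))"
    using multilinear_type_sum[OF m, of "\<lambda>i. \<phi> i p [W]" "\<lambda>i. conj_form (\<phi> i) p [W]" ?r]
    unfolding type_expansion[OF assms(1), symmetric] .
  also have "(\<Sum>i=1..n. conj_form (\<phi> i) p [W] * psi p (Zb i p # ?r)) = 0"
    by (rule sum.neutral) (auto simp: psi_Zb)
  also have "(\<Sum>i=1..n. \<phi> i p [W] * psi p (Z i p # ?r)) = (\<Sum>i=1..n. if i = Suc j then \<phi> i p [W] * (- 1) ^ j else 0)"
    by (rule sum.cong) (use i0 1 in auto)
  finally show ?thesis using assms(2) by simp
qed

text \<open>Covectors of type (n,0) form a line: on increasing frame lists they can be nonzero only
  at \<open>[n..<2 * n]\<close>, where \<open>psi\<close> takes the value \<open>1\<close>.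
  Subtracting the right multiple of \<open>psi\<close> therefore leaves zero.\<close>

lemma pq_covector_canonical:
  assumes "pq_covector A J p n 0 \<theta>"
  shows "\<theta> xs = \<theta> (ev Zs p) * psi p xs"
proof -
  have c: "covector A p n \<theta>" using assms by (simp add: pq_covector_def)
  have d: "covector A p n (\<lambda>xs. \<theta> xs + (- \<theta> (ev Zs p)) * psi p xs)"
    by (rule covector_lincomb[OF c kform_covector[OF psi_form]])
  have "(\<lambda>xs. \<theta> xs + (- \<theta> (ev Zs p)) * psi p xs) = (\<lambda>xs. 0)"
  proof (rule multilinear_frame_eqI[OF covector_multilinear[OF d] covector_multilinear[OF covector_zero]])
    fix js :: "nat list" assume js: "length js = n" "set js \<subseteq> {..<2 * n}"
    let ?xs = "map (\<lambda>k. e k p) js"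
    show "\<theta> ?xs + (- \<theta> (ev Zs p)) * psi p ?xs = 0"
    proof (cases "length (filter (\<lambda>k. n \<le> k) js) = n")
      case False
      then have "\<theta> ?xs = 0" "psi p ?xs = 0"
        using pq_covector_frame[OF assms js(2)] pq_covector_frame[OF psi_pq_covector js(2)] by auto
      then show ?thesis by simp
    next
      case True
      show ?thesis
      proof (rule covector_strictly_sorted[OF d])
        assume dist: "distinct (sort js)"
        have "\<forall>k\<in>set js. n \<le> k" using True js by (metis length_filter_less less_irrefl)
        then have "set js \<subseteq> {n..<2 * n}" using js by auto
        moreover have "card (set js) = n" using dist js by (simp add: distinct_card)
        ultimately have "set js = {n..<2 * n}" by (intro card_subset_eq) auto
        then have "sort js = [n..<2 * n]"
          using dist by (intro sorted_distinct_set_unique) auto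
        then show "\<theta> (map (\<lambda>k. e k p) (sort js)) + (- \<theta> (ev Zs p)) * psi p (map (\<lambda>k. e k p) (sort js)) = 0"
          using psi_Zs[of p] by (simp add: Zs_frame)
      qed
    qed
  qed
  from fun_cong[OF this, of xs] show ?thesis by simp
qed

end

section \<open>Structure functions and the operator dbar on canonical sections\<close>

locale structure_functions = almost_complex_frame A J n v w v' w' \<phi>
  for A :: "('a::{t2_space, second_countable_topology}, 'e::euclidean_space) atlas"
    and J n v w v' w' \<phi> +
  fixes lam :: "nat \<Rightarrow> nat \<Rightarrow> nat \<Rightarrow> 'a \<Rightarrow> complex"
  assumes lam_smooth: "\<And>i j k. i \<in> {1..n} \<Longrightarrow> j \<in> {1..n} \<Longrightarrow> k \<in> {1..n} \<Longrightarrow> smooth_fun A (lam i j k)"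
    and dbar_phi: "\<And>i. i \<in> {1..n} \<Longrightarrow> dbar A J 1 0 (\<phi> i) =
           (\<lambda>p xs. \<Sum>j=1..n. \<Sum>k=1..n. lam i j k p * wedge (\<phi> j) (conj_form (\<phi> k)) p xs)"
begin

text \<open>Both sides of the structure equation are evaluated on \<open>[Zb k p, Z j p]\<close>.
  The derivative terms of the invariant formula differentiate constants, leaving minus the bracket
  term.\<close>

lemma phi_bracket:
  assumes i: "i \<in> {1..n}" and j: "j \<in> {1..n}" and k: "k \<in> {1..n}"
  shows "\<phi> i p [lie_bracket (Zb k) (Z j) p] = lam i j k p"
proof -
  let ?xs = "[Zb k p, Z j p]"
  note f = phi_form[OF i]
  have f': "kform A 0 (interior_prod (Zb k) (\<phi> i))"
    using kform_interior_prod[of 0 "\<phi> i"] f Zb_field[OF k] by simp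
  have "koszul (\<phi> i) [Zb k, Z j] p = - \<phi> i p [lie_bracket (Zb k) (Z j) p]"
    unfolding koszul_Cons[OF f] koszul_Cons[OF f'] koszul_Nil lie_deriv_def
    using i j k by (simp add: interior_prod_def phi_Z phi_Zb capply_const Zb_ctangent Z_ctangent
        nths_Cons_omit_0[where xs = "[]"])
  moreover have "dbar A J 1 0 (\<phi> i) p ?xs = koszul (\<phi> i) [Zb k, Z j] p"
  proof -
    have "e (k - 1) = Zb k" "e (n + (j - 1)) = Z j" "k - 1 < n" "n + (j - 1) < 2 * n"
      using j k by (auto simp: e_def)
    then show ?thesis
      using dbar_frame[of 1 0 "\<phi> i" "[k - 1, n + (j - 1)]" p] f by simp
  qed
  \<comment> \<open>The arguments come in the order opposite to the factors of the wedge product,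
    hence the minus sign, which cancels the one from the invariant formula.\<close>
  moreover have "dbar A J 1 0 (\<phi> i) p ?xs = - lam i j k p"
  proof -
    have "wedge (\<phi> j') (conj_form (\<phi> k')) p ?xs = (if j' = j \<and> k' = k then - 1 else 0)"
      if "j' \<in> {1..n}" "k' \<in> {1..n}" for j' k'
      using that j k by (auto simp: wedge_1_form[OF phi_form] ext_prod_Cons ext_prod_Nil phi_Z phi_Zb cphi_Zb cphi_Z)
    then have "dbar A J 1 0 (\<phi> i) p ?xs = (\<Sum>j'=1..n. \<Sum>k'=1..n. if j' = j \<and> k' = k then - lam i j k p else 0)"
      unfolding dbar_phi[OF i] by (intro sum.cong) auto
    also have "\<dots> = (\<Sum>j'=1..n. if j' = j then - lam i j k p else 0)"
      by (intro sum.cong) (use k in auto)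
    also have "\<dots> = - lam i j k p" using j by simp
    finally show ?thesis .
  qed
  ultimately show ?thesis by simp
qed

text \<open>The section \<open>dbar h + c h \<alpha>\<close> of \<open>\<Lambda>\<^sup>0\<^sup>,\<^sup>1\<close> is \<open>\<Sum>k. twisted_coeff c h k * conj (\<phi> k)\<close>.\<close>

definition twisted_coeff :: "complex \<Rightarrow> ('a \<Rightarrow> complex) \<Rightarrow> nat \<Rightarrow> 'a \<Rightarrow> complex" where
  "twisted_coeff c h k p = capply (Zb k) h p - c * h p * (\<Sum>i=1..n. lam i i k p)"

definition twisted_dbar :: "complex \<Rightarrow> ('a \<Rightarrow> complex) \<Rightarrow> 'a form" where
  "twisted_dbar c h = (\<lambda>p xs. \<Sum>k=1..n. twisted_coeff c h k p * conj_form (\<phi> k) p xs)"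

lemma twisted_coeff_smooth: "k \<in> {1..n} \<Longrightarrow> smooth_fun A h \<Longrightarrow> smooth_fun A (twisted_coeff c h k)"
  unfolding twisted_coeff_def
  by (intro smooth_fun_diff smooth_fun_mult smooth_fun_const smooth_fun_sum smooth_fun_capply Zb_field lam_smooth)

lemma twisted_dbar_form: "smooth_fun A h \<Longrightarrow> kform A 1 (twisted_dbar c h)"
  unfolding twisted_dbar_def by (intro kform_sum cphi_form twisted_coeff_smooth)

lemma twisted_dbar_T10: "Y \<in> T10 A J p \<Longrightarrow> twisted_dbar c h p [Y] = 0"
  by (simp add: twisted_dbar_def cphi_T10)

lemma twisted_dbar_Zb:
  assumes "k \<in> {1..n}"
  shows "twisted_dbar c h p [Zb k p] = twisted_coeff c h k p"
proof -
  have "twisted_dbar c h p [Zb k p] = (\<Sum>i=1..n. if i = k then twisted_coeff c h i p else 0)"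
    unfolding twisted_dbar_def by (rule sum.cong) (use assms cphi_Zb in auto)
  then show ?thesis using assms by simp
qed

text \<open>Contraction with \<open>Zb k\<close> kills \<open>psi\<close>, so in Cartan's formula
  only the Lie derivative remains. As \<open>psi\<close> is \<open>1\<close> on \<open>Zs\<close>,
  it differentiates \<open>h\<close> alone; by \<open>psi_replace\<close> the bracket terms
  contribute diagonal coefficients of the structure functions, whose two signs
  \<open>(- 1) ^ j\<close> cancel.\<close>

lemma koszul_canonical:
  assumes h: "smooth_fun A h" and k: "k \<in> {1..n}"
  shows "koszul (\<lambda>p xs. h p * psi p xs) (Zb k # Zs) p = twisted_coeff 1 h k p"
proof -
  let ?\<omega> = "\<lambda>p xs. h p * psi p xs"
  have f: "kform A n ?\<omega>" by (rule kform_scale[OF psi_form h])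
  have "interior_prod (Zb k) ?\<omega> = (\<lambda>p xs. 0)"
    using k by (auto simp: interior_prod_def psi_Zb)
  moreover have "koszul (\<lambda>p xs. 0) Zs p = 0"
    using Zs_field by (simp add: koszul_def capply_const cvector_field_ctangent)
  moreover have "(\<Sum>j<n. (- 1) ^ j * (h p * psi p (lie_bracket (Zb k) (Zs ! j) p # ev (nths Zs (- {j})) p)))
      = h p * (\<Sum>j<n. lam (Suc j) (Suc j) k p)"
    unfolding sum_distrib_left
  proof (rule sum.cong)
    fix j assume "j \<in> {..<n}"
    then have j: "j < n" "Suc j \<in> {1..n}" by auto
    have "psi p (lie_bracket (Zb k) (Zs ! j) p # ev (nths Zs (- {j})) p) = (- 1) ^ j * lam (Suc j) (Suc j) k p"
      unfolding Zs_nth[OF j(1)]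
      using psi_replace[OF lie_bracket_ctangent[OF Zb_field[OF k] Z_field[OF j(2)]] j(1)] phi_bracket[OF j(2,2) k]
      by simp
    then show "(- 1) ^ j * (h p * psi p (lie_bracket (Zb k) (Zs ! j) p # ev (nths Zs (- {j})) p))
       = h p * lam (Suc j) (Suc j) k p"
      by (simp add: algebra_simps)
  qed simp
  ultimately show ?thesis
    unfolding koszul_Cons[OF f] lie_deriv_def twisted_coeff_def
    by (simp add: psi_Zs length_Zs sum.atLeast1_atMost_eq)
qed

lemma dbar_canonical_form:
  assumes h: "smooth_fun A h"
  shows "dbar A J n 0 (\<lambda>p xs. h p * psi p xs) = wedge (twisted_dbar 1 h) psi"
proof (intro ext)
  fix p xs
  let ?\<omega> = "\<lambda>p xs. h p * psi p xs" and ?\<beta> = "twisted_dbar 1 h"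
  let ?E = "\<lambda>js. map (\<lambda>k. e k p) js"
  have f: "kform A n ?\<omega>" by (rule kform_scale[OF psi_form h])
  then have f0: "kform A (n + 0) ?\<omega>" by simp
  note b = twisted_dbar_form[OF h, of 1]
  have wf: "kform A (Suc n) (wedge ?\<beta> psi)" by (rule kform_wedge[OF b psi_form])
  have "dbar A J n 0 ?\<omega> p = wedge ?\<beta> psi p"
  proof (rule multilinear_frame_eqI)
    show "multilinear A p (Suc n) (dbar A J n 0 ?\<omega> p)" using multilinear_dbar[OF f0] by simp
    show "multilinear A p (Suc n) (wedge ?\<beta> psi p)" by (rule kform_multilinear[OF wf])
    fix js :: "nat list" assume js: "length js = Suc n" "set js \<subseteq> {..<2 * n}"
    show "dbar A J n 0 ?\<omega> p (?E js) = wedge ?\<beta> psi p (?E js)"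
    proof (cases "length (filter (\<lambda>k. n \<le> k) js) = n")
      case False
      \<comment> \<open>A nonzero term needs a (0,1) vector in slot \<open>i\<close> and (1,0)
        vectors in the other \<open>n\<close> slots, which is the excluded count.\<close>
      have "?\<beta> p [?E js ! i] * psi p (nths (?E js) (- {i})) = 0" if i: "i < length js" for i
      proof (rule ccontr)
        assume nz: "?\<beta> p [?E js ! i] * psi p (nths (?E js) (- {i})) \<noteq> 0"
        have ji: "js ! i < 2 * n" using js(2) nth_mem[OF i] by auto
        have "js ! i < n"
          using nz twisted_dbar_T10[of "e (js ! i) p" p] e_T10_iff[OF ji, of p] i by (cases "js ! i < n") auto
        moreover have "length (filter (\<lambda>k. n \<le> k) (nths js (- {i}))) = n"
          using nz js set_nths_subset[of js "- {i}"]
          by (intro pq_covector_frame[OF psi_pq_covector[of p]]) (auto simp: nths_map)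
        moreover have "filter (\<lambda>k. n \<le> k) js = filter (\<lambda>k. n \<le> k) (take i js @ js ! i # drop (Suc i) js)"
          using id_take_nth_drop[OF i] by simp
        ultimately show False using False by (simp add: nths_omit[OF i])
      qed
      then have "wedge ?\<beta> psi p (?E js) = 0"
        unfolding wedge_1_form[OF b] ext_prod_def by (intro sum.neutral) auto
      then show ?thesis using dbar_frame[OF f0, of js p] js False by simp
    next
      case True
      have ex: "ext_d A n ?\<omega> p (?E js) = koszul ?\<omega> (map e js) p"
        if "length js = Suc n" "set js \<subseteq> {..<2 * n}" for js
        using ext_d_koszul[OF f, of "map e js" p] that e_field by (auto simp: comp_def)
      \<comment> \<open>Only multilinearity of the type component is available. On lists with
        exactly \<open>n\<close> entries of type (1,0) it agrees with \<open>ext_d\<close>, which is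
        alternating, so the indices may be sorted after this replacement.\<close>
      have d: "covector A p (Suc n) (\<lambda>xs. wedge ?\<beta> psi p xs + (- 1) * ext_d A n ?\<omega> p xs)"
        by (intro covector_lincomb kform_covector wf kform_ext_d f)
      have "wedge ?\<beta> psi p (?E js) + (- 1) * ext_d A n ?\<omega> p (?E js) = 0"
      proof (rule covector_strictly_sorted[OF d])
        assume dist: "distinct (sort js)"
        then have dj: "distinct js" by simp
        \<comment> \<open>Among the \<open>n + 1\<close> distinct indices, the \<open>n\<close>
          holomorphic ones exhaust \<open>{n..<2 * n}\<close>; a single antiholomorphic index
          \<open>k\<close> is left.\<close>
        let ?F = "set (filter (\<lambda>k. n \<le> k) js)" and ?G = "set (filter (\<lambda>k. \<not> n \<le> k) js)"
        have "card ?F = n" using dj True by (metis distinct_card distinct_filter)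
        moreover have "?F \<subseteq> {n..<2 * n}" using js by auto
        ultimately have F: "?F = {n..<2 * n}" by (intro card_subset_eq) auto
        have "length (filter (\<lambda>k. \<not> n \<le> k) js) = 1"
          using sum_length_filter_compl[of "\<lambda>k. n \<le> k" js] True js by simp
        then obtain k where k: "filter (\<lambda>k. \<not> n \<le> k) js = [k]" by (auto simp: length_Suc_conv)
        then have kn: "k < n" by (metis filter_eq_ConsD not_le)
        have "set js = ?F \<union> ?G" by auto
        also have "\<dots> = set (k # [n..<2 * n])" unfolding F k by auto
        finally have s: "sort js = k # [n..<2 * n]"
          using dist kn by (intro sorted_distinct_set_unique) auto
        have E: "?E (sort js) = Zb (Suc k) p # ev Zs p" "map e (sort js) = Zb (Suc k) # map e [n..<2 * n]"
          using kn by (simp_all add: s Zs_frame e_def)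
        have "map e [n..<2 * n] = Zs"
          by (rule nth_equalityI) (auto simp: length_Zs Zs_nth e_def)
        then have "ext_d A n ?\<omega> p (?E (sort js)) = twisted_coeff 1 h (Suc k) p"
          using ex[of "sort js"] js koszul_canonical[OF h, of "Suc k"] kn E by simp
        moreover have "wedge ?\<beta> psi p (?E (sort js)) = twisted_coeff 1 h (Suc k) p"
        proof -
          have "(\<lambda>ys. psi p (Zb (Suc k) p # ys)) = (\<lambda>ys. 0)" using kn psi_Zb[of "Suc k"] by auto
          then show ?thesis
            unfolding E wedge_1_form[OF b] ext_prod_Cons using kn
            by (simp add: ext_prod_zero psi_Zs twisted_dbar_Zb)
        qed
        ultimately show "wedge ?\<beta> psi p (?E (sort js)) + (- 1) * ext_d A n ?\<omega> p (?E (sort js)) = 0" by simp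
      qed
      then show ?thesis using dbar_frame[OF f0, of js p] js True ex[OF js] by simp
    qed
  qed
  then show "dbar A J n 0 ?\<omega> p xs = wedge ?\<beta> psi p xs" by simp
qed

end

section \<open>Pluricanonical sections\<close>

context manifold begin

lemma pq_covector_scale:
  assumes "pq_covector A J p a b \<theta>"
  shows "pq_covector A J p a b (\<lambda>xs. c * \<theta> xs)"
proof -
  have "covector A p (a + b) (\<lambda>xs. c * \<theta> xs)"
    using covector_lincomb[OF covector_zero, of p "a + b" \<theta> c] assms by (simp add: pq_covector_def)
  then show ?thesis using assms by (simp add: pq_covector_def)
qed

lemma tensor_section_pq_covector:
  "tensor_section A J ts t \<Longrightarrow> length xss = length ts \<Longrightarrow> i < length ts \<Longrightarrow>
     pq_covector A J p (fst (ts ! i)) (snd (ts ! i)) (\<lambda>xs. t p (xss[i := xs]))"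
  by (simp add: tensor_section_def)

lemma tensor_section_tensor_list:
  assumes len: "length ss = length ts"
    and form: "\<And>i. i < length ts \<Longrightarrow> kform A (fst (ts ! i) + snd (ts ! i)) (ss ! i)"
    and pq: "\<And>i p. i < length ts \<Longrightarrow> pq_covector A J p (fst (ts ! i)) (snd (ts ! i)) ((ss ! i) p)"
  shows "tensor_section A J ts (tensor_list ss)"
  unfolding tensor_section_def
proof (intro conjI allI impI; (elim conjE)?)
  show "tensor_list ss p xss = 0" if "length xss \<noteq> length ts" for p xss
    using that len by (simp add: tensor_list_def)
  fix p and xss :: "'a ctvec list list" and i
  assume xss: "length xss = length ts" and i: "i < length ts"
  have "tensor_list ss p (xss[i := xs]) = (\<Prod>l\<in>{..<length ts} - {i}. (ss ! l) p (xss ! l)) * (ss ! i) p xs" for xs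
  proof -
    have "(\<Prod>l\<in>{..<length ts} - {i}. (ss ! l) p (xss[i := xs] ! l)) = (\<Prod>l\<in>{..<length ts} - {i}. (ss ! l) p (xss ! l))"
      by (rule prod.cong) auto
    then show ?thesis
      using xss len i prod.remove[of "{..<length ts}" i "\<lambda>l. (ss ! l) p (xss[i := xs] ! l)"]
      by (simp add: tensor_list_def mult.commute)
  qed
  then show "pq_covector A J p (fst (ts ! i)) (snd (ts ! i)) (\<lambda>xs. tensor_list ss p (xss[i := xs]))"
    using pq_covector_scale[OF pq[OF i]] by presburger
next
  fix Xss :: "('a \<Rightarrow> 'a ctvec) list list"
  assume X: "\<forall>Xs\<in>set Xss. \<forall>X\<in>set Xs. cvector_field A X"
  show "smooth_fun A (\<lambda>p. tensor_list ss p (map (\<lambda>Xs. ev Xs p) Xss))"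
  proof (cases "length Xss = length ss")
    case True
    have "smooth_fun A (\<lambda>p. (ss ! l) p (ev (Xss ! l) p))" if "l < length ss" for l
      using form[of l] X that True len by (intro kform_smooth[of "fst (ts ! l) + snd (ts ! l)"]) auto
    then have "smooth_fun A (\<lambda>p. \<Prod>l<length ss. (ss ! l) p (ev (Xss ! l) p))"
      by (intro smooth_fun_prod) auto
    moreover have "tensor_list ss p (map (\<lambda>Xs. ev Xs p) Xss) = (\<Prod>l<length ss. (ss ! l) p (ev (Xss ! l) p))" for p
      using True by (simp add: tensor_list_def)
    ultimately show ?thesis by presburger
  next
    case False
    then show ?thesis by (simp add: tensor_list_def smooth_fun_const)
  qed
qed

lemma capply_prod:
  assumes "X p \<in> ctangent A p" "finite I" "\<And>i. i \<in> I \<Longrightarrow> smooth_fun A (h i)"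
  shows "capply X (\<lambda>q. \<Prod>i\<in>I. h i q) p = (\<Sum>i\<in>I. capply X (h i) p * (\<Prod>j\<in>I - {i}. h j p))"
  using assms(2,3)
proof (induction I rule: finite_induct)
  case empty
  then show ?case using assms(1) by (simp add: capply_const)
next
  case (insert i I)
  have "(\<Prod>j\<in>insert i I - {l}. h j p) = h i p * (\<Prod>j\<in>I - {l}. h j p)" if "l \<in> I" for l
  proof -
    have "insert i I - {l} = insert i (I - {l})" using that insert by auto
    then show ?thesis using insert by simp
  qed
  then have "(\<Sum>l\<in>I. capply X (h l) p * (\<Prod>j\<in>insert i I - {l}. h j p))
      = h i p * (\<Sum>l\<in>I. capply X (h l) p * (\<Prod>j\<in>I - {l}. h j p))"
    by (simp add: sum_distrib_left algebra_simps)
  moreover have "insert i I - {i} = I" using insert by auto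
  moreover have "capply X (\<lambda>q. h i q * (\<Prod>i\<in>I. h i q)) p
     = h i p * capply X (\<lambda>q. \<Prod>i\<in>I. h i q) p + (\<Prod>i\<in>I. h i p) * capply X (h i) p"
    using insert.prems by (intro capply_mult assms(1) smooth_fun_prod) auto
  ultimately show ?case using insert by (simp add: algebra_simps)
qed

end

section \<open>From canonical sections to their tensor powers\<close>

context structure_functions begin

lemma twisted_dbar_pq_covector:
  assumes "smooth_fun A h"
  shows "pq_covector A J p 0 1 (twisted_dbar c h p)"
  unfolding pq_covector_def
proof (intro conjI allI impI; (elim conjE)?)
  show "covector A p (0 + 1) (twisted_dbar c h p)"
    using kform_covector[OF twisted_dbar_form[OF assms]] by simp
  fix xs assume "length xs = 0 + 1" and nz: "twisted_dbar c h p xs \<noteq> 0"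
  then obtain Y where "xs = [Y]" by (auto simp: length_Suc_conv)
  then show "length (filter (\<lambda>Z. Z \<in> T10 A J p) xs) = 0"
    using nz twisted_dbar_T10[of Y p c h] by auto
qed

text \<open>Injectivity of the identification along the wedge product: \<open>t\<close> is recovered
  from the values of \<open>wedge_map t\<close> on the lists \<open>Zb k p # ev Zs p\<close>. The
  type conditions reduce the first block to the vectors \<open>Zb k\<close> and the second to
  \<open>Zs\<close>.\<close>

lemma tensor_section_canonical_unique:
  assumes "tensor_section A J [(0, 1), (n, 0)] t"
  shows "t p [ys, xs] = (\<Sum>k=1..n. conj_form (\<phi> k) p ys * wedge_map t p (Zb k p # ev Zs p)) * psi p xs"
proof -
  have s0: "pq_covector A J p 0 1 (\<lambda>ys. t p [ys, zs])" for zs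
    using tensor_section_pq_covector[OF assms, of "[[], zs]" 0 p] by simp
  have s1: "pq_covector A J p n 0 (\<lambda>xs. t p [ys, xs])" for ys
    using tensor_section_pq_covector[OF assms, of "[ys, []]" 1 p] by simp
  have c0: "covector A p 1 (\<lambda>ys. t p [ys, zs])" for zs using s0[of zs] by (simp add: pq_covector_def)
  have w: "wedge_map t p (Zb k p # ev Zs p) = t p [[Zb k p], ev Zs p]" if k: "k \<in> {1..n}" for k
  proof -
    \<comment> \<open>A shuffle that leaves \<open>Zb k\<close> in the second block vanishes, since
      that block is of type (n,0). Only the shuffle sending it to the first block remains.\<close>
    have "t p [[x], Zb k p # zs] = 0" for x zs
      using pq_covector_canonical[OF s1, of "[x]" "Zb k p # zs"] psi_Zb[OF k, of p "Zb k p # zs"] by simp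
    moreover have "t p [ys, zs] = 0" if "length ys \<noteq> 1" for ys zs
      using multilinear_support[OF covector_multilinear[OF c0]] that by blast
    ultimately show ?thesis
      by (simp add: wedge_map_ext_prod sum.lessThan_Suc_shift nths_Cons_omit_0 nths_Cons_omit_Suc
          del: sum.lessThan_Suc)
  qed
  have "t p [ys, ev Zs p] = (\<Sum>k=1..n. conj_form (\<phi> k) p ys * t p [[Zb k p], ev Zs p])"
  proof (cases "\<exists>Y\<in>ctangent A p. ys = [Y]")
    case True
    then obtain Y where Y: "Y \<in> ctangent A p" "ys = [Y]" by blast
    have "t p [[Z k p], ev Zs p] = 0" if "k \<in> {1..n}" for k
    proof (rule ccontr)
      assume "t p [[Z k p], ev Zs p] \<noteq> 0"
      then have "length (filter (\<lambda>k. n \<le> k) [n + (k - 1)]) = 0"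
        using that by (intro pq_covector_frame[OF s0[of "ev Zs p"]]) (auto simp: e_def)
      then show False by simp
    qed
    moreover have "t p [[Y], ev Zs p] = (\<Sum>k=1..n. \<phi> k p [Y] * t p [[Z k p], ev Zs p]) +
        (\<Sum>k=1..n. conj_form (\<phi> k) p [Y] * t p [[Zb k p], ev Zs p])"
      using multilinear_type_sum[OF covector_multilinear[OF c0[of "ev Zs p"]], of "\<lambda>k. \<phi> k p [Y]" "\<lambda>k. conj_form (\<phi> k) p [Y]" "[]"]
      unfolding type_expansion[OF Y(1), symmetric] .
    ultimately show ?thesis using Y(2) by simp
  next
    case False
    then have bad: "length ys \<noteq> 1 \<or> \<not> set ys \<subseteq> ctangent A p" by (cases ys) auto
    have "t p [ys, ev Zs p] = 0"
      using multilinear_support[OF covector_multilinear[OF c0[of "ev Zs p"]] bad] by simp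
    moreover have "conj_form (\<phi> k) p ys = 0" if "k \<in> {1..n}" for k
      using multilinear_support[OF kform_multilinear[OF cphi_form[OF that]] bad] .
    ultimately show ?thesis by simp
  qed
  also have "\<dots> = (\<Sum>k=1..n. conj_form (\<phi> k) p ys * wedge_map t p (Zb k p # ev Zs p))"
    by (rule sum.cong) (simp_all add: w)
  finally show ?thesis using pq_covector_canonical[OF s1, of ys xs] by simp
qed

lemma dbar_canonical_eq:
  assumes h: "smooth_fun A h"
  shows "dbar_canonical A J n (\<lambda>p xs. h p * psi p xs) = tensor_list [twisted_dbar 1 h, psi]"
  unfolding dbar_canonical_def
proof (rule the_equality)
  let ?t = "tensor_list [twisted_dbar 1 h, psi]"
  have t: "tensor_section A J [(0, 1), (n, 0)] ?t"
    by (rule tensor_section_tensor_list)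
       (auto simp: less_Suc_eq numeral_2_eq_2 twisted_dbar_form[OF h, unfolded One_nat_def] psi_form
         twisted_dbar_pq_covector[OF h, unfolded One_nat_def] psi_pq_covector)
  have tw: "wedge_map ?t = dbar A J n 0 (\<lambda>p xs. h p * psi p xs)"
    by (simp add: dbar_canonical_form[OF h] wedge_def)
  show "tensor_section A J [(0, 1), (n, 0)] ?t \<and> wedge_map ?t = dbar A J n 0 (\<lambda>p xs. h p * psi p xs)"
    using t tw by simp
  fix t' assume t': "tensor_section A J [(0, 1), (n, 0)] t' \<and> wedge_map t' = dbar A J n 0 (\<lambda>p xs. h p * psi p xs)"
  show "t' = ?t"
  proof (intro ext)
    fix p xss
    show "t' p xss = ?t p xss"
    proof (cases "length xss = 2")
      case True
      then obtain ys xs where "xss = [ys, xs]" by (auto simp: numeral_2_eq_2 length_Suc_conv)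
      then show ?thesis
        using tensor_section_canonical_unique[OF t, of p ys xs] tensor_section_canonical_unique[of t' p ys xs] t' tw
        by simp
    next
      case False
      then show ?thesis using t t' unfolding tensor_section_def by simp
    qed
  qed
qed

lemma canonical_section_smooth:
  "canonical_section A J n s \<Longrightarrow> smooth_fun A (\<lambda>p. s p (ev Zs p))"
  unfolding canonical_section_def using kform_smooth[OF _ Zs_field] by blast

lemma canonical_section_eq:
  "canonical_section A J n s \<Longrightarrow> s = (\<lambda>p xs. s p (ev Zs p) * psi p xs)"
  unfolding canonical_section_def using pq_covector_canonical by blast

lemma canonical_section_psi:
  "smooth_fun A h \<Longrightarrow> canonical_section A J n (\<lambda>p xs. h p * psi p xs)"
  unfolding canonical_section_def
  using kform_scale[OF psi_form] pq_covector_scale[OF psi_pq_covector] by simp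

text \<open>The candidate for dbar of \<open>f\<close> times the \<open>m\<close>-th power of
  \<open>psi\<close>, with the (0,1) argument block in front as in \<open>leibniz\<close>.\<close>

definition twisted_tensor :: "nat \<Rightarrow> ('a \<Rightarrow> complex) \<Rightarrow> 'a tensor" where
  "twisted_tensor m f = (\<lambda>p yss. case yss of [] \<Rightarrow> 0 | ys # xss \<Rightarrow>
     if length xss = m then twisted_dbar (of_nat m) f p ys * (\<Prod>j<m. psi p (xss ! j)) else 0)"

text \<open>The derivative terms add up by the product rule. Each of the \<open>m\<close> summands
  also carries the full product of the \<open>h i\<close> times the same trace, and this is the
  origin of the factor \<open>of_nat m\<close>.\<close>

lemma twisted_coeff_prod:
  assumes "k \<in> {1..n}" "\<And>i. i < m \<Longrightarrow> smooth_fun A (h i)"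
  shows "(\<Sum>i<m. twisted_coeff 1 (h i) k p * (\<Prod>j\<in>{..<m} - {i}. h j p))
    = twisted_coeff (of_nat m) (\<lambda>q. \<Prod>i<m. h i q) k p"
proof -
  let ?L = "\<Sum>i=1..n. lam i i k p"
  have "(\<Sum>i<m. (h i p * ?L) * (\<Prod>j\<in>{..<m} - {i}. h j p)) = (\<Sum>i<m. (\<Prod>j<m. h j p) * ?L)"
  proof (rule sum.cong)
    fix i assume "i \<in> {..<m}"
    then show "(h i p * ?L) * (\<Prod>j\<in>{..<m} - {i}. h j p) = (\<Prod>j<m. h j p) * ?L"
      using prod.remove[of "{..<m}" i "\<lambda>j. h j p"] by simp
  qed simp
  moreover have "capply (Zb k) (\<lambda>q. \<Prod>i<m. h i q) p = (\<Sum>i<m. capply (Zb k) (h i) p * (\<Prod>j\<in>{..<m} - {i}. h j p))"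
    using assms(2) by (intro capply_prod Zb_ctangent assms(1)) auto
  ultimately show ?thesis
    by (simp add: twisted_coeff_def left_diff_distrib sum_subtractf)
qed

text \<open>Writing every factor as a function times \<open>psi\<close> shows that the Leibniz
  expression depends on the list only through the product of these functions.\<close>

lemma leibniz_eq:
  assumes len: "length ss = m" and ss: "\<forall>s\<in>set ss. canonical_section A J n s"
  shows "leibniz A J n ss = twisted_tensor m (\<lambda>p. \<Prod>i<m. (ss ! i) p (ev Zs p))"
proof (intro ext)
  fix p yss
  let ?h = "\<lambda>i p. (ss ! i) p (ev Zs p)"
  have c: "canonical_section A J n (ss ! i)" if "i < m" for i using ss len that by simp
  have sm: "smooth_fun A (?h i)" if "i < m" for i by (rule canonical_section_smooth[OF c[OF that]])
  have eq: "(ss ! i) p xs = ?h i p * psi p xs" if "i < m" for i xs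
    by (rule fun_cong[OF fun_cong[OF canonical_section_eq[OF c[OF that]]]])
  have d: "dbar_canonical A J n (ss ! i) p [ys, xs] = twisted_dbar 1 (?h i) p ys * psi p xs" if "i < m" for i ys xs
  proof -
    have "dbar_canonical A J n (ss ! i) = tensor_list [twisted_dbar 1 (?h i), psi]"
      using dbar_canonical_eq[OF sm[OF that]] unfolding canonical_section_eq[OF c[OF that], symmetric] .
    then show ?thesis by (simp add: tensor_list_def lessThan_Suc mult.commute)
  qed
  show "leibniz A J n ss p yss = twisted_tensor m (\<lambda>p. \<Prod>i<m. ?h i p) p yss"
  proof (cases "\<exists>ys xss. yss = ys # xss \<and> length xss = m")
    case True
    then obtain ys xss where y: "yss = ys # xss" "length xss = m" by blast
    let ?P = "\<Prod>j<m. psi p (xss ! j)"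
    have "dbar_canonical A J n (ss ! i) p [ys, xss ! i] * (\<Prod>j\<in>{..<m} - {i}. (ss ! j) p (xss ! j))
        = twisted_dbar 1 (?h i) p ys * (\<Prod>j\<in>{..<m} - {i}. ?h j p) * ?P" if "i < m" for i
    proof -
      have "(\<Prod>j\<in>{..<m} - {i}. (ss ! j) p (xss ! j)) = (\<Prod>j\<in>{..<m} - {i}. ?h j p * psi p (xss ! j))"
        by (intro prod.cong refl eq) auto
      then show ?thesis
        using d[OF that] that prod.remove[of "{..<m}" i "\<lambda>j. psi p (xss ! j)"]
        by (simp add: prod.distrib)
    qed
    then have "leibniz A J n ss p yss = (\<Sum>i<m. twisted_dbar 1 (?h i) p ys * (\<Prod>j\<in>{..<m} - {i}. ?h j p)) * ?P"
      by (simp add: leibniz_def y len sum_distrib_right)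
    also have "(\<Sum>i<m. twisted_dbar 1 (?h i) p ys * (\<Prod>j\<in>{..<m} - {i}. ?h j p))
        = (\<Sum>k=1..n. \<Sum>i<m. (twisted_coeff 1 (?h i) k p * conj_form (\<phi> k) p ys) * (\<Prod>j\<in>{..<m} - {i}. ?h j p))"
      unfolding twisted_dbar_def sum_distrib_right by (rule sum.swap)
    also have "\<dots> = (\<Sum>k=1..n. (\<Sum>i<m. twisted_coeff 1 (?h i) k p * (\<Prod>j\<in>{..<m} - {i}. ?h j p)) * conj_form (\<phi> k) p ys)"
      unfolding sum_distrib_right by (intro sum.cong refl) (simp only: mult_ac)
    also have "\<dots> = twisted_dbar (of_nat m) (\<lambda>p. \<Prod>i<m. ?h i p) p ys"
      unfolding twisted_dbar_def by (rule sum.cong) (simp_all add: twisted_coeff_prod[OF _ sm])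
    finally show ?thesis by (simp add: twisted_tensor_def y)
  next
    case False
    then show ?thesis by (cases yss) (auto simp: leibniz_def twisted_tensor_def len)
  qed
qed

text \<open>Additivity in the coefficient function, needed because a decomposition may have several
  products as summands.\<close>

lemma twisted_tensor_sum:
  assumes "\<And>a. a < N \<Longrightarrow> smooth_fun A (h a)"
  shows "(\<lambda>p yss. \<Sum>a<(N::nat). twisted_tensor m (h a) p yss) = twisted_tensor m (\<lambda>p. \<Sum>a<N. h a p)"
proof (intro ext)
  fix p yss
  have k: "(\<Sum>a<N. twisted_coeff c (h a) k p) = twisted_coeff c (\<lambda>p. \<Sum>a<N. h a p) k p" if "k \<in> {1..n}" for c k
  proof -
    have "(\<Sum>a<N. c * h a p * L) = c * (\<Sum>a<N. h a p) * L" for L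
      by (simp add: sum_distrib_left sum_distrib_right)
    moreover have "capply (Zb k) (\<lambda>p. \<Sum>a<N. h a p) p = (\<Sum>a<N. capply (Zb k) (h a) p)"
      using assms by (intro capply_sum Zb_ctangent that) auto
    ultimately show ?thesis unfolding twisted_coeff_def sum_subtractf by simp
  qed
  have "(\<Sum>a<N. twisted_dbar c (h a) p ys) = twisted_dbar c (\<lambda>p. \<Sum>a<N. h a p) p ys" for c ys
  proof -
    have "(\<Sum>a<N. twisted_dbar c (h a) p ys) = (\<Sum>k=1..n. \<Sum>a<N. twisted_coeff c (h a) k p * conj_form (\<phi> k) p ys)"
      unfolding twisted_dbar_def by (rule sum.swap)
    also have "\<dots> = twisted_dbar c (\<lambda>p. \<Sum>a<N. h a p) p ys"
      unfolding twisted_dbar_def sum_distrib_right[symmetric] by (rule sum.cong) (simp_all add: k)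
    finally show ?thesis .
  qed
  then show "(\<Sum>a<N. twisted_tensor m (h a) p yss) = twisted_tensor m (\<lambda>p. \<Sum>a<N. h a p) p yss"
    by (cases yss) (simp_all add: twisted_tensor_def sum_distrib_right[symmetric])
qed

text \<open>The coefficient is absorbed into the first tensor factor, which exists because
  \<open>m \<ge> 1\<close>.\<close>

lemma tensor_list_psi:
  assumes "m \<ge> 1"
  shows "(\<lambda>p xss. f p * tensor_list (replicate m psi) p xss)
    = tensor_list ((\<lambda>p xs. f p * psi p xs) # replicate (m - 1) psi)"
proof (intro ext)
  fix p and xss :: "'a ctvec list list"
  obtain l where m: "m = Suc l" using assms by (cases m) auto
  show "f p * tensor_list (replicate m psi) p xss
      = tensor_list ((\<lambda>p xs. f p * psi p xs) # replicate (m - 1) psi) p xss"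
    by (simp add: tensor_list_def m prod.lessThan_Suc_shift del: prod.lessThan_Suc replicate_Suc)
qed

lemma canonical_sections_psi:
  assumes "smooth_fun A f"
  shows "\<forall>s\<in>set ((\<lambda>p xs. f p * psi p xs) # replicate l psi). canonical_section A J n s"
  using canonical_section_psi[OF assms] canonical_section_psi[OF smooth_fun_const, of 1] by auto

text \<open>One product decomposition supplies the value. For any other, comparison of coefficients
  shows that its products of coefficient functions add up to \<open>f\<close>, so
  \<open>leibniz_eq\<close> and \<open>twisted_tensor_sum\<close> give the same tensor.\<close>

lemma dbar_pluricanonical_eq:
  assumes f: "smooth_fun A f" and m: "m \<ge> 1"
  shows "dbar_pluricanonical A J n m (\<lambda>p xss. f p * tensor_list (replicate m psi) p xss) = twisted_tensor m f"
  unfolding dbar_pluricanonical_def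
proof (rule the_equality)
  let ?T = "\<lambda>p xss. f p * tensor_list (replicate m psi) p xss"
  let ?ss = "(\<lambda>p xs. f p * psi p xs) # replicate (m - 1) psi"
  have "leibniz A J n ?ss = twisted_tensor m (\<lambda>p. \<Prod>i<m. (?ss ! i) p (ev Zs p))"
    by (rule leibniz_eq[OF _ canonical_sections_psi[OF f]]) (use m in auto)
  moreover have "(\<Prod>i<m. (?ss ! i) p (ev Zs p)) = f p" for p
  proof -
    obtain l where "m = Suc l" using m by (cases m) auto
    then show ?thesis by (simp add: prod.lessThan_Suc_shift psi_Zs del: prod.lessThan_Suc)
  qed
  ultimately have "leibniz A J n ?ss = twisted_tensor m f" by simp
  then show "\<exists>N ss. (\<forall>a<N. length (ss a) = m \<and> (\<forall>s\<in>set (ss a). canonical_section A J n s)) \<and>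
      ?T = (\<lambda>p xss. \<Sum>a<N. tensor_list (ss a) p xss) \<and>
      twisted_tensor m f = (\<lambda>p yss. \<Sum>a<(N::nat). leibniz A J n (ss a) p yss)"
    using canonical_sections_psi[OF f, of "m - 1"] tensor_list_psi[OF m, of f] m
    by (intro exI[of _ 1] exI[of _ "\<lambda>_. ?ss"]) auto
next
  fix U
  let ?T = "\<lambda>p xss. f p * tensor_list (replicate m psi) p xss"
  assume "\<exists>N ss. (\<forall>a<N. length (ss a) = m \<and> (\<forall>s\<in>set (ss a). canonical_section A J n s)) \<and>
      ?T = (\<lambda>p xss. \<Sum>a<N. tensor_list (ss a) p xss) \<and>
      U = (\<lambda>p yss. \<Sum>a<(N::nat). leibniz A J n (ss a) p yss)"
  then obtain N ss where ss: "\<And>a. a < N \<Longrightarrow> length (ss a) = m"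
      "\<And>a. a < N \<Longrightarrow> \<forall>s\<in>set (ss a). canonical_section A J n s"
    and T: "?T = (\<lambda>p xss. \<Sum>a<N. tensor_list (ss a) p xss)"
    and U: "U = (\<lambda>p yss. \<Sum>a<(N::nat). leibniz A J n (ss a) p yss)" by blast
  let ?h = "\<lambda>a p. \<Prod>i<m. (ss a ! i) p (ev Zs p)"
  have f_eq: "f p = (\<Sum>a<N. ?h a p)" for p
  proof -
    \<comment> \<open>On \<open>m\<close> copies of the frame list every \<open>psi\<close> equals
      \<open>1\<close>, so this evaluation extracts the coefficient functions from both sides of
      \<open>T\<close>.\<close>
    have "f p * tensor_list (replicate m psi) p (replicate m (ev Zs p))
        = (\<Sum>a<N. tensor_list (ss a) p (replicate m (ev Zs p)))"
      by (rule fun_cong[OF fun_cong[OF T]])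
    then show ?thesis using ss(1) by (simp add: tensor_list_def psi_Zs)
  qed
  have sm: "smooth_fun A (?h a)" if "a < N" for a
    using ss[OF that] by (intro smooth_fun_prod canonical_section_smooth) auto
  have "U = (\<lambda>p yss. \<Sum>a<N. twisted_tensor m (?h a) p yss)"
    unfolding U by (intro ext sum.cong) (simp_all add: leibniz_eq[OF ss])
  also have "\<dots> = twisted_tensor m (\<lambda>p. \<Sum>a<N. ?h a p)"
    by (rule twisted_tensor_sum[OF sm])
  finally show "U = twisted_tensor m f" using f_eq by presburger
qed

lemma pluricanonical_section_psi:
  assumes f: "smooth_fun A f" and m: "m \<ge> 1"
  shows "pluricanonical_section A J n m (\<lambda>p xss. f p * tensor_list (replicate m psi) p xss)"
  unfolding pluricanonical_section_def tensor_list_psi[OF m]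
proof (rule tensor_section_tensor_list)
  let ?ss = "(\<lambda>p xs. f p * psi p xs) # replicate (m - 1) psi"
  show l: "length ?ss = length (replicate m (n, 0::nat))" using m by simp
  have "canonical_section A J n (?ss ! i)" if "i < m" for i
    by (rule bspec[OF canonical_sections_psi[OF f] nth_mem]) (use that in simp)
  then show "kform A (fst (replicate m (n, 0) ! i) + snd (replicate m (n, 0) ! i)) (?ss ! i)"
    "pq_covector A J p (fst (replicate m (n, 0) ! i)) (snd (replicate m (n, 0) ! i)) ((?ss ! i) p)"
    if "i < length (replicate m (n, 0::nat))" for i p
    using that by (simp_all add: canonical_section_def)
qed

lemma pseudoholomorphic_iff:
  assumes f: "smooth_fun A f" and m: "m \<ge> 1"
  shows "pseudoholomorphic A J n m (\<lambda>p xss. f p * tensor_list (replicate m psi) p xss) \<longleftrightarrow>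
    twisted_dbar (of_nat m) f = (\<lambda>p xs. 0)"
proof -
  have "twisted_tensor m f = (\<lambda>p yss. 0) \<longleftrightarrow> twisted_dbar (of_nat m) f = (\<lambda>p xs. 0)"
  proof
    assume z: "twisted_tensor m f = (\<lambda>p yss. 0)"
    show "twisted_dbar (of_nat m) f = (\<lambda>p xs. 0)"
    proof (intro ext)
      fix p ys
      \<comment> \<open>Filling the last \<open>m\<close> blocks with \<open>ev Zs p\<close> turns
        their product into \<open>1\<close> and isolates the (0,1) factor.\<close>
      have "twisted_tensor m f p (ys # replicate m (ev Zs p)) = 0" by (simp add: z)
      then show "twisted_dbar (of_nat m) f p ys = 0" by (simp add: twisted_tensor_def psi_Zs)
    qed
  next
    assume "twisted_dbar (of_nat m) f = (\<lambda>p xs. 0)"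
    then show "twisted_tensor m f = (\<lambda>p yss. 0)"
      by (auto simp: twisted_tensor_def fun_eq_iff split: list.split)
  qed
  then show ?thesis
    using pluricanonical_section_psi[OF assms] dbar_pluricanonical_eq[OF assms]
    by (simp add: pseudoholomorphic_def)
qed

lemma twisted_dbar_eq:
  assumes "smooth_fun A f"
  shows "twisted_dbar c f p xs = dbar A J 0 0 (fun_form f) p xs +
    c * f p * - (\<Sum>k=1..n. (\<Sum>i=1..n. lam i i k p) * conj_form (\<phi> k) p xs)"
proof -
  have "(\<Sum>k=1..n. c * f p * L k * g k) = c * f p * (\<Sum>k=1..n. L k * g k)" for L g :: "nat \<Rightarrow> complex"
    by (simp add: sum_distrib_left mult.assoc)
  then show ?thesis
    by (simp add: dbar_fun[OF assms] twisted_dbar_def twisted_coeff_def left_diff_distrib sum_subtractf)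
qed

end

theorem lemma3p3:
  fixes A :: "('a::{t2_space, second_countable_topology}, 'e::euclidean_space) atlas"
    and J :: "'a \<Rightarrow> 'a tvec \<Rightarrow> 'a tvec"
    and n m :: nat
    and v w :: "nat \<Rightarrow> 'a \<Rightarrow> 'a tvec"
    and v' w' \<phi> :: "nat \<Rightarrow> 'a form"
    and \<psi> \<alpha> :: "'a form"
    and lam :: "nat \<Rightarrow> nat \<Rightarrow> nat \<Rightarrow> 'a \<Rightarrow> complex"
    and f :: "'a \<Rightarrow> complex"
  assumes "smooth_manifold A" and "DIM('e) = 2 * n" and "almost_complex A J"
    and "global_frame A n v w"
    and "\<And>i p. i \<in> {1..n} \<Longrightarrow> J p (v i p) = w i p"
    and "\<And>i p. i \<in> {1..n} \<Longrightarrow> J p (w i p) = (\<lambda>g. - v i p g)"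
    and "\<And>i. i \<in> {1..n} \<Longrightarrow> kform A 1 (v' i) \<and> kform A 1 (w' i)"
    and "\<And>i j p. i \<in> {1..n} \<Longrightarrow> j \<in> {1..n} \<Longrightarrow>
           v' i p [cplx (v j p)] = (if i = j then 1 else 0) \<and> v' i p [cplx (w j p)] = 0 \<and>
           w' i p [cplx (w j p)] = (if i = j then 1 else 0) \<and> w' i p [cplx (v j p)] = 0"
    and "\<phi> = (\<lambda>i p xs. v' i p xs + \<i> * w' i p xs)"
    and "\<psi> = wedge_list (map \<phi> [1..<Suc n])"
    and "\<And>i j k. i \<in> {1..n} \<Longrightarrow> j \<in> {1..n} \<Longrightarrow> k \<in> {1..n} \<Longrightarrow> smooth_fun A (lam i j k)"
    and "\<And>i. i \<in> {1..n} \<Longrightarrow> dbar A J 1 0 (\<phi> i) =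
           (\<lambda>p xs. \<Sum>j=1..n. \<Sum>k=1..n. lam i j k p * wedge (\<phi> j) (conj_form (\<phi> k)) p xs)"
    and "\<alpha> = (\<lambda>p xs. - (\<Sum>k=1..n. (\<Sum>i=1..n. lam i i k p) * conj_form (\<phi> k) p xs))"
    and "m \<ge> 1"
    and "smooth_fun A f"
  shows "pseudoholomorphic A J n m (\<lambda>p xss. f p * tensor_list (replicate m \<psi>) p xss) \<longleftrightarrow>
         (\<lambda>p xs. dbar A J 0 0 (fun_form f) p xs + of_nat m * f p * \<alpha> p xs) = (\<lambda>p xs. 0)"
proof -
  interpret structure_functions A J n v w v' w' \<phi> lam
    by (unfold_locales; fact)
  have "\<psi> = psi" unfolding assms(10) psi_def ..
  moreover have "(\<lambda>p xs. dbar A J 0 0 (fun_form f) p xs + of_nat m * f p * \<alpha> p xs) = twisted_dbar (of_nat m) f"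
    unfolding assms(13) using twisted_dbar_eq[OF assms(15)] by (intro ext) simp
  ultimately show ?thesis
    using pseudoholomorphic_iff[OF assms(15,14)] by simp
qed

end
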